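(* Let $\pi:\mathscr{F}M\to M$ be a fiber bundle over a smooth manifold $M$ endowed with a non-linear connection $\mathbb{P}^\nabla$ with curvature tensor $R^\nabla$, and let $\mathbb{P}^{\nabla^{\mathrm{Vert}}}$ be the induced non-linear connection on the fiber bundle $\mathrm{Vert}\,\mathscr{F}M\to M$. Then for every local section $f\in\Gamma_{\mathrm{loc}}(M,\mathscr{F}M)$ and all vector fields $X,Y\in\Gamma(M,TM)$ one has $$R^\nabla_{X,Y}f\;=\;\Big(D^{\nabla^{\mathrm{Vert}}}_X D^\nabla_Y f\;-\;\Theta\big(D^{\nabla^{\mathrm{Vert}}}_Y D^\nabla_X f\big)\Big)\;-\;D^\nabla_{[X,Y]}f ,$$ where the inner difference (inside the large parentheses) is the affine difference in the fibers of the double projection $\Pi:\mathrm{Vert}\,\mathrm{Vert}\,\mathscr{F}M\to\mathrm{Vert}\,\mathscr{F}M\oplus\mathrm{Vert}\,\mathscr{F}M$, and the outer difference is the difference in $\mathrm{Vert}\,\mathscr{F}M$ considered as a vector bundle over $\mathscr{F}M$.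
   Context: All manifolds, bundles and maps are smooth. A fiber bundle $\pi:\mathscr{F}M\to M$ with model fiber manifold $\mathscr{F}$ is a smooth locally trivial bundle; $\mathscr{F}_pM=\pi^{-1}(p)$. $\mathrm{Vert}\,\mathscr{F}M=\ker\pi_*\subset T\mathscr{F}M$ is the vertical tangent bundle; it is a vector bundle over $\mathscr{F}M$ and is also regarded as a fiber bundle over $M$, with fiber over $p$ equal to $T(\mathscr{F}_pM)$. $\mathrm{Vert}\,\mathrm{Vert}\,\mathscr{F}M$ is the vertical tangent bundle of the fiber bundle $\mathrm{Vert}\,\mathscr{F}M\to M$; its fiber over $p\in M$ is the iterated tangent bundle $T(T(\mathscr{F}_pM))$. $\Gamma_{\mathrm{loc}}(M,\cdot)$ denotes local sections over open subsets of $M$. Non-linear connection: a field $\mathbb{P}^\nabla\in\Gamma(\mathscr{F}M,\mathrm{End}\,T\mathscr{F}M)$ with $(\mathbb{P}^\nabla)^2=\mathbb{P}^\nabla$ and image $\mathrm{im}(\mathbb{P}^\nabla_f)=\mathrm{Vert}_f\mathscr{F}M$ for every $f\in\mathscr{F}M$. Covariant derivative: for a local section $f$ of $\mathscr{F}M$ and a vector field $X$ on $M$, $D^\nabla_Xf\in\Gamma_{\mathrm{loc}}(M,\mathrm{Vert}\,\mathscr{F}M)$ is given by $(D^\nabla_Xf)_p=\mathbb{P}^\nabla_{f(p)}(f_{*,p}X_p)$. The same definition applies to any fiber bundle over $M$ with a non-linear connection, in particular to $\mathrm{Vert}\,\mathscr{F}M$, giving $D^{\nabla^{\mathrm{Vert}}}$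 with values in local sections of $\mathrm{Vert}\,\mathrm{Vert}\,\mathscr{F}M$. Curvature: for vector fields $X,Y$ on $\mathscr{F}M$, $$R^\nabla(X,Y)=-\mathbb{P}^\nabla[(\mathrm{id}-\mathbb{P}^\nabla)X,(\mathrm{id}-\mathbb{P}^\nabla)Y]-(\mathrm{id}-\mathbb{P}^\nabla)[\mathbb{P}^\nabla X,\mathbb{P}^\nabla Y]=-\mathbb{P}^\nabla[(\mathrm{id}-\mathbb{P}^\nabla)X,(\mathrm{id}-\mathbb{P}^\nabla)Y]$$ (the second summand vanishes because the vertical distribution is integrable). This is a tensorial (i.e. $C^\infty(\mathscr{F}M)$-bilinear) alternating horizontal $2$-form on $\mathscr{F}M$ with values in $\mathrm{Vert}\,\mathscr{F}M$. For a local section $f$ of $\mathscr{F}M$ and vector fields $X,Y$ on $M$, $R^\nabla_{X,Y}f$ is the local section of $\mathrm{Vert}\,\mathscr{F}M$ over $M$ with $(R^\nabla_{X,Y}f)_p=R^\nabla_{f(p)}(f_{*,p}X_p,f_{*,p}Y_p)\in\mathrm{Vert}_{f(p)}\mathscr{F}M$. Involution and double projection: for a manifold $\mathscr{F}$, $\Theta:T(T\mathscr{F})\to T(T\mathscr{F})$ is the canonical involutive diffeomorphism characterized by $$\Theta\Big(\tfrac{d}{dt}\big|_0\tfrac{d}{d\varepsilon}\big|_0\gamma(t,\varepsilon)\Big)=\tfrac{d}{dt}\big|_0\tfrac{d}{d\varepsilon}\big|_0\gamma(\varepsilon,t)$$ for all smooth $\gamma:\mathbb{R}^2\to\mathscr{F}$,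 and $\Pi:T(T\mathscr{F})\to T\mathscr{F}\oplus T\mathscr{F}$ is $$\Pi\Big(\tfrac{d}{dt}\big|_0\tfrac{d}{d\varepsilon}\big|_0\gamma(t,\varepsilon)\Big)=\tfrac{d}{d\varepsilon}\big|_0\gamma(0,\varepsilon)\oplus\tfrac{d}{dt}\big|_0\gamma(t,0).$$ Applied fiberwise to $T(T(\mathscr{F}_pM))$, $p\in M$, these define a fiber bundle automorphism $\Theta$ of $\mathrm{Vert}\,\mathrm{Vert}\,\mathscr{F}M$ and a double projection $\Pi:\mathrm{Vert}\,\mathrm{Vert}\,\mathscr{F}M\to\mathrm{Vert}\,\mathscr{F}M\oplus\mathrm{Vert}\,\mathscr{F}M$. Affine difference: local coordinates $(f^\alpha)$ on $\mathscr{F}$ induce coordinates $(f^\alpha;\dot f^\alpha;\delta f^\alpha;\delta\dot f^\alpha)$ on $T(T\mathscr{F})$, whose values on $\tfrac{d}{dt}|_0\tfrac{d}{d\varepsilon}|_0\gamma(t,\varepsilon)$ are $(f^\alpha\circ\gamma)(0,0)$, $\tfrac{\partial}{\partial t}|_{(0,0)}(f^\alpha\circ\gamma)$, $\tfrac{\partial}{\partial\varepsilon}|_{(0,0)}(f^\alpha\circ\gamma)$ and $\tfrac{\partial^2}{\partial t\,\partial\varepsilon}|_{(0,0)}(f^\alpha\circ\gamma)$. The fibers of $\Pi$ are affine spaces modelled on the fibers of $T\mathscr{F}$, with difference map $$(f^\alpha;\dot f^\alpha;\delta f^\alpha;F^\alpha)-(f^\alpha;\dot f^\alpha;\delta f^\alpha;\hat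 F^\alpha)=(f^\alpha;F^\alpha-\hat F^\alpha)\in T\mathscr{F},$$ which is independent of the chosen coordinates. Applied fiberwise over $M$ this gives the difference map $\mathrm{Vert}\,\mathrm{Vert}\,\mathscr{F}M\times_{\mathrm{Vert}\,\mathscr{F}M\oplus\mathrm{Vert}\,\mathscr{F}M}\mathrm{Vert}\,\mathrm{Vert}\,\mathscr{F}M\to\mathrm{Vert}\,\mathscr{F}M$. Induced connection: $\mathbb{P}^{\nabla^{\mathrm{Vert}}}$ is the unique non-linear connection on the fiber bundle $\mathrm{Vert}\,\mathscr{F}M\to M$ such that $$D^{\nabla^{\mathrm{Vert}}}_X\Big(\tfrac{d}{d\varepsilon}\big|_0f_\varepsilon\Big)=\Theta\Big(\tfrac{d}{d\varepsilon}\big|_0D^\nabla_Xf_\varepsilon\Big)$$ for every vector field $X$ on $M$ and every smooth one-parameter family $(f_\varepsilon)_{\varepsilon\in\mathbb{R}}$ of local sections of $\mathscr{F}M$, with infinitesimal variation $\tfrac{d}{d\varepsilon}|_0f_\varepsilon\in\Gamma_{\mathrm{loc}}(M,\mathrm{Vert}\,\mathscr{F}M)$. *)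

theory Defs
  imports "HOL-Analysis.Analysis"
begin

section \<open>Smooth maps between model spaces\<close>

primrec Ck_on :: "nat \<Rightarrow> 'e::real_normed_vector set \<Rightarrow> ('e \<Rightarrow> 'g::real_normed_vector) \<Rightarrow> bool" where
  "Ck_on 0 S f \<longleftrightarrow> continuous_on S f"
| "Ck_on (Suc k) S f \<longleftrightarrow>
     (\<forall>x\<in>S. f differentiable (at x)) \<and>
     (\<forall>v. Ck_on k S (\<lambda>x. frechet_derivative f (at x) v))"

text \<open>Only used for open \<open>S\<close> and finite-dimensional spaces, where this is the usual
  \<open>C\<^sup>\<infinity>\<close>.\<close>

definition smooth_on :: "'e::real_normed_vector set \<Rightarrow> ('e \<Rightarrow> 'g::real_normed_vector) \<Rightarrow> bool" where
  "smooth_on S f \<longleftrightarrow> (\<forall>k. Ck_on k S f)"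


section \<open>Manifolds and smooth maps\<close>

text \<open>A chart is a pair of its domain and its coordinate map; the values of the coordinate map
  outside of the domain are irrelevant. A manifold is given by an atlas, which determines the
  underlying set and the topology. The model space is a finite-dimensional real inner product
  space (finite-dimensionality is part of \<open>smooth_manifold\<close>). The class \<open>euclidean_space\<close> is
  avoided because it excludes dimension zero.\<close>

type_synonym ('a, 'e) chart = "'a set \<times> ('a \<Rightarrow> 'e)"
type_synonym ('a, 'e) atlas = "('a, 'e) chart set"

definition carrier :: "('a, 'e) atlas \<Rightarrow> 'a set" where
  "carrier A = (\<Union>c\<in>A. fst c)"

definition charts_at :: "('a, 'e) atlas \<Rightarrow> 'a \<Rightarrow> ('a, 'e) chart set" where
  "charts_at A p = {c \<in> A. p \<in> fst c}"

definition smoothly_related ::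
  "('a, 'e::real_normed_vector) chart \<Rightarrow> ('a, 'e) chart \<Rightarrow> bool" where
  "smoothly_related c d \<longleftrightarrow>
     open (snd c ` (fst c \<inter> fst d)) \<and>
     smooth_on (snd c ` (fst c \<inter> fst d)) (snd d \<circ> inv_into (fst c) (snd c))"

definition is_chart :: "('a, 'e::real_normed_vector) chart \<Rightarrow> bool" where
  "is_chart c \<longleftrightarrow> inj_on (snd c) (fst c) \<and> open (snd c ` fst c)"

definition atlas_topology :: "('a, 'e::real_normed_vector) atlas \<Rightarrow> 'a topology" where
  "atlas_topology A =
     topology (\<lambda>S. S \<subseteq> carrier A \<and> (\<forall>c\<in>A. open (snd c ` (S \<inter> fst c))))"

lemma istopology_atlas:
  assumes "\<And>c. c \<in> A \<Longrightarrow> is_chart c"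
  shows "istopology (\<lambda>S. S \<subseteq> carrier A \<and> (\<forall>c\<in>A. open (snd c ` (S \<inter> fst c))))"
proof -
  have "open (snd c ` (S \<inter> T \<inter> fst c))"
    if "c \<in> A" "open (snd c ` (S \<inter> fst c))" "open (snd c ` (T \<inter> fst c))" for c S T
  proof -
    have "snd c ` (S \<inter> T \<inter> fst c) = snd c ` (S \<inter> fst c) \<inter> snd c ` (T \<inter> fst c)"
      using assms[OF that(1)] unfolding is_chart_def inj_on_def by blast
    then show ?thesis using that by auto
  qed
  moreover have "open (snd c ` (\<Union>K \<inter> fst c))"
    if "\<forall>S\<in>K. open (snd c ` (S \<inter> fst c))" for c :: "('a, 'b) chart" and K
  proof -
    have "snd c ` (\<Union>K \<inter> fst c) = (\<Union>S\<in>K. snd c ` (S \<inter> fst c))" by blast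
    then show ?thesis using that by auto
  qed
  ultimately show ?thesis
    unfolding istopology_def by (auto simp: Sup_le_iff)
qed

definition smooth_manifold :: "('a, 'e::real_inner) atlas \<Rightarrow> bool" where
  "smooth_manifold A \<longleftrightarrow>
     (\<exists>B :: 'e set. finite B \<and> span B = UNIV) \<and>
     (\<forall>c\<in>A. is_chart c) \<and>
     (\<forall>c\<in>A. \<forall>d\<in>A. smoothly_related c d) \<and>
     Hausdorff_space (atlas_topology A) \<and>
     second_countable (atlas_topology A)"

definition maximal_atlas :: "('a, 'e::real_normed_vector) atlas \<Rightarrow> ('a, 'e) atlas" where
  "maximal_atlas A = {c. fst c \<subseteq> carrier A \<and> is_chart c \<and>
     (\<forall>d\<in>A. smoothly_related c d \<and> smoothly_related d c)}"

definition standard_atlas :: "('e, 'e) atlas" where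
  "standard_atlas = {(UNIV, \<lambda>x. x)}"

definition product_atlas :: "('a, 'e) atlas \<Rightarrow> ('b, 'g) atlas \<Rightarrow> ('a \<times> 'b, 'e \<times> 'g) atlas" where
  "product_atlas A B = (\<lambda>(c, d). (fst c \<times> fst d, map_prod (snd c) (snd d))) ` (A \<times> B)"

text \<open>Smoothness on an open subset \<open>S\<close>. Requiring the coordinate domains to be open for all
  pairs of charts amounts to openness of \<open>S\<close> together with continuity of \<open>f\<close>.\<close>

definition smooth_map ::
  "('a, 'e::real_normed_vector) atlas \<Rightarrow> ('b, 'g::real_normed_vector) atlas \<Rightarrow> 'a set \<Rightarrow> ('a \<Rightarrow> 'b) \<Rightarrow> bool"
  where
  "smooth_map A B S f \<longleftrightarrow>
     S \<subseteq> carrier A \<and> f ` S \<subseteq> carrier B \<and>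
     (\<forall>c\<in>A. \<forall>d\<in>B.
        let Q = snd c ` {x \<in> fst c \<inter> S. f x \<in> fst d}
        in open Q \<and> smooth_on Q (snd d \<circ> f \<circ> inv_into (fst c) (snd c)))"

definition diffeomorphism ::
  "('a, 'e::real_normed_vector) atlas \<Rightarrow> ('b, 'g::real_normed_vector) atlas \<Rightarrow> 'a set \<Rightarrow> 'b set \<Rightarrow> ('a \<Rightarrow> 'b) \<Rightarrow> bool"
  where
  "diffeomorphism A B S T f \<longleftrightarrow>
     bij_betw f S T \<and> smooth_map A B S f \<and> smooth_map B A T (inv_into S f)"


section \<open>Tangent bundles\<close>

text \<open>A tangent vector is a class of curves that are smooth near \<open>0\<close> and agree to first order at
  \<open>0\<close>; \<open>velocity A \<gamma>\<close> is \<open>d/dt|\<^sub>0 \<gamma>(t)\<close>.\<close>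

type_synonym 'a tangent = "(real \<Rightarrow> 'a) set"

definition smooth_curve :: "('a, 'e::real_normed_vector) atlas \<Rightarrow> (real \<Rightarrow> 'a) \<Rightarrow> bool" where
  "smooth_curve A \<gamma> \<longleftrightarrow> (\<exists>N. 0 \<in> N \<and> smooth_map standard_atlas A N \<gamma>)"

definition velocity :: "('a, 'e::real_normed_vector) atlas \<Rightarrow> (real \<Rightarrow> 'a) \<Rightarrow> 'a tangent" where
  "velocity A \<gamma> = {\<sigma>. smooth_curve A \<sigma> \<and> \<sigma> 0 = \<gamma> 0 \<and>
     (\<forall>c\<in>charts_at A (\<gamma> 0).
        vector_derivative (snd c \<circ> \<sigma>) (at 0) = vector_derivative (snd c \<circ> \<gamma>) (at 0))}"

definition tangent_space :: "('a, 'e::real_normed_vector) atlas \<Rightarrow> 'a \<Rightarrow> 'a tangent set" where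
  "tangent_space A p = {velocity A \<gamma> |\<gamma>. smooth_curve A \<gamma> \<and> \<gamma> 0 = p}"

definition tangent_bundle :: "('a, 'e::real_normed_vector) atlas \<Rightarrow> 'a tangent set" where
  "tangent_bundle A = (\<Union>p\<in>carrier A. tangent_space A p)"

definition rep :: "'a tangent \<Rightarrow> real \<Rightarrow> 'a" where
  "rep v = (SOME \<gamma>. \<gamma> \<in> v)"

definition base :: "'a tangent \<Rightarrow> 'a" where
  "base v = rep v 0"

definition deriv_along :: "'a tangent \<Rightarrow> ('a \<Rightarrow> 'g::real_normed_vector) \<Rightarrow> 'g" where
  "deriv_along v h = vector_derivative (h \<circ> rep v) (at 0)"

definition pushforward ::
  "('b, 'g::real_normed_vector) atlas \<Rightarrow> ('a \<Rightarrow> 'b) \<Rightarrow> 'a tangent \<Rightarrow> 'b tangent" where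
  "pushforward B f v = velocity B (f \<circ> rep v)"

definition tangent_atlas ::
  "('a, 'e::real_normed_vector) atlas \<Rightarrow> ('a tangent, 'e \<times> 'e) atlas" where
  "tangent_atlas A =
     (\<lambda>c. ({v \<in> tangent_bundle A. base v \<in> fst c},
           \<lambda>v. (snd c (base v), deriv_along v (snd c)))) ` A"

text \<open>The vector space structure of the tangent spaces: \<open>tangent_with_coords A p k\<close> is the
  tangent vector at \<open>p\<close> with component \<open>k c\<close> in every chart \<open>c\<close> around \<open>p\<close>.\<close>

definition tangent_with_coords ::
  "('a, 'e::real_normed_vector) atlas \<Rightarrow> 'a \<Rightarrow> (('a, 'e) chart \<Rightarrow> 'e) \<Rightarrow> 'a tangent" where
  "tangent_with_coords A p k =
     (THE u. u \<in> tangent_space A p \<and> (\<forall>c\<in>charts_at A p. deriv_along u (snd c) = k c))"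

definition tadd :: "('a, 'e::real_normed_vector) atlas \<Rightarrow> 'a tangent \<Rightarrow> 'a tangent \<Rightarrow> 'a tangent" where
  "tadd A v w = tangent_with_coords A (base v) (\<lambda>c. deriv_along v (snd c) + deriv_along w (snd c))"

definition tscale :: "('a, 'e::real_normed_vector) atlas \<Rightarrow> real \<Rightarrow> 'a tangent \<Rightarrow> 'a tangent" where
  "tscale A r v = tangent_with_coords A (base v) (\<lambda>c. r *\<^sub>R deriv_along v (snd c))"

definition tdiff :: "('a, 'e::real_normed_vector) atlas \<Rightarrow> 'a tangent \<Rightarrow> 'a tangent \<Rightarrow> 'a tangent" where
  "tdiff A v w = tadd A v (tscale A (- 1) w)"


section \<open>Vector fields\<close>

definition vector_field_on ::
  "('a, 'e::real_normed_vector) atlas \<Rightarrow> 'a set \<Rightarrow> ('a \<Rightarrow> 'a tangent) \<Rightarrow> bool" where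
  "vector_field_on A W X \<longleftrightarrow>
     openin (atlas_topology A) W \<and> (\<forall>p\<in>W. X p \<in> tangent_space A p) \<and>
     smooth_map A (tangent_atlas A) W X"

definition lie_bracket ::
  "('a, 'e::real_normed_vector) atlas \<Rightarrow> ('a \<Rightarrow> 'a tangent) \<Rightarrow> ('a \<Rightarrow> 'a tangent) \<Rightarrow> 'a \<Rightarrow> 'a tangent"
  where
  "lie_bracket A X Y p = (THE v. v \<in> tangent_space A p \<and>
     (\<forall>N (h :: 'a \<Rightarrow> real). openin (atlas_topology A) N \<and> p \<in> N \<and> smooth_map A standard_atlas N h \<longrightarrow>
        deriv_along v h =
          deriv_along (X p) (\<lambda>q. deriv_along (Y q) h) - deriv_along (Y p) (\<lambda>q. deriv_along (X q) h)))"


section \<open>Fiber bundles and the vertical bundle\<close>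

text \<open>The total space is modelled on the product of the model spaces of base and fiber, which
  only fixes its dimension; its atlas is otherwise arbitrary.\<close>

definition fiber_bundle ::
  "('a, 'm::real_inner) atlas \<Rightarrow> ('c, 'f::real_inner) atlas \<Rightarrow> ('b, 'm \<times> 'f) atlas \<Rightarrow> ('b \<Rightarrow> 'a) \<Rightarrow> bool"
  where
  "fiber_bundle M F E \<pi> \<longleftrightarrow>
     smooth_manifold M \<and> smooth_manifold F \<and> smooth_manifold E \<and>
     smooth_map E M (carrier E) \<pi> \<and>
     (\<forall>p\<in>carrier M. \<exists>U \<tau>. openin (atlas_topology M) U \<and> p \<in> U \<and>
        diffeomorphism E (product_atlas M F)
          {e \<in> carrier E. \<pi> e \<in> U} (U \<times> carrier F) (\<lambda>e. (\<pi> e, \<tau> e)))"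

definition local_section ::
  "('a, 'm::real_normed_vector) atlas \<Rightarrow> ('b, 'e::real_normed_vector) atlas \<Rightarrow> ('b \<Rightarrow> 'a) \<Rightarrow>
   'a set \<Rightarrow> ('a \<Rightarrow> 'b) \<Rightarrow> bool" where
  "local_section M E \<pi> U f \<longleftrightarrow>
     openin (atlas_topology M) U \<and> smooth_map M E U f \<and> (\<forall>p\<in>U. \<pi> (f p) = p)"

definition vertical_space ::
  "('a, 'm::real_normed_vector) atlas \<Rightarrow> ('b, 'e::real_normed_vector) atlas \<Rightarrow> ('b \<Rightarrow> 'a) \<Rightarrow>
   'b \<Rightarrow> 'b tangent set" where
  "vertical_space M E \<pi> e =
     {v \<in> tangent_space E e. pushforward M \<pi> v = velocity M (\<lambda>_. \<pi> e)}"

definition vertical_bundle ::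
  "('a, 'm::real_normed_vector) atlas \<Rightarrow> ('b, 'e::real_normed_vector) atlas \<Rightarrow> ('b \<Rightarrow> 'a) \<Rightarrow>
   'b tangent set" where
  "vertical_bundle M E \<pi> = (\<Union>e\<in>carrier E. vertical_space M E \<pi> e)"

text \<open>Adapted charts of the total space have the form \<open>(x, y)\<close> with \<open>x\<close> coordinates of the base,
  so that \<open>y\<close> restricts to coordinates on each fiber. In the induced coordinates
  \<open>(x, y, dx, dy)\<close> of the tangent bundle the vertical bundle is the slice \<open>dx = 0\<close>, and its
  submanifold structure is given by the charts \<open>(x, (y, dy))\<close>. With this atlas and the projection
  \<open>\<pi> \<circ> base\<close> it is again a bundle over the same base, with fiber model \<open>'f \<times> 'f\<close>.\<close>

definition adapted_charts ::
  "('a, 'm::real_normed_vector) atlas \<Rightarrow> ('b, 'm \<times> 'f::real_normed_vector) atlas \<Rightarrow> ('b \<Rightarrow> 'a) \<Rightarrow>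
   ('b, 'm \<times> 'f) atlas" where
  "adapted_charts M E \<pi> =
     {c \<in> maximal_atlas E. \<exists>d\<in>M. \<forall>e\<in>fst c. \<pi> e \<in> fst d \<and> fst (snd c e) = snd d (\<pi> e)}"

definition vertical_atlas ::
  "('a, 'm::real_normed_vector) atlas \<Rightarrow> ('b, 'm \<times> 'f::real_normed_vector) atlas \<Rightarrow> ('b \<Rightarrow> 'a) \<Rightarrow>
   ('b tangent, 'm \<times> ('f \<times> 'f)) atlas" where
  "vertical_atlas M E \<pi> =
     (\<lambda>c. ({v \<in> vertical_bundle M E \<pi>. base v \<in> fst c},
           \<lambda>v. (fst (snd c (base v)), (snd (snd c (base v)), snd (deriv_along v (snd c))))))
     ` adapted_charts M E \<pi>"


section \<open>Non-linear connections, covariant derivative and curvature\<close>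

text \<open>A smooth section of the endomorphism bundle is encoded as the corresponding smooth,
  fiberwise linear self-map of the tangent bundle.\<close>

definition nonlinear_connection ::
  "('a, 'm::real_normed_vector) atlas \<Rightarrow> ('b, 'e::real_normed_vector) atlas \<Rightarrow> ('b \<Rightarrow> 'a) \<Rightarrow>
   ('b tangent \<Rightarrow> 'b tangent) \<Rightarrow> bool" where
  "nonlinear_connection M E \<pi> P \<longleftrightarrow>
     smooth_map (tangent_atlas E) (tangent_atlas E) (tangent_bundle E) P \<and>
     (\<forall>e\<in>carrier E.
        (\<forall>v\<in>tangent_space E e. P v \<in> tangent_space E e) \<and>
        (\<forall>v\<in>tangent_space E e. \<forall>w\<in>tangent_space E e. P (tadd E v w) = tadd E (P v) (P w)) \<and>
        (\<forall>v\<in>tangent_space E e. \<forall>r. P (tscale E r v) = tscale E r (P v)) \<and>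
        (\<forall>v\<in>tangent_space E e. P (P v) = P v) \<and>
        P ` tangent_space E e = vertical_space M E \<pi> e)"

definition cov_deriv ::
  "('b, 'e::real_normed_vector) atlas \<Rightarrow> ('b tangent \<Rightarrow> 'b tangent) \<Rightarrow>
   ('a \<Rightarrow> 'a tangent) \<Rightarrow> ('a \<Rightarrow> 'b) \<Rightarrow> 'a \<Rightarrow> 'b tangent" where
  "cov_deriv E P X f = (\<lambda>p. P (pushforward E f (X p)))"

definition hor :: "('b, 'e::real_normed_vector) atlas \<Rightarrow> ('b tangent \<Rightarrow> 'b tangent) \<Rightarrow> 'b tangent \<Rightarrow> 'b tangent"
  where
  "hor E P v = tdiff E v (P v)"

definition curvature_field ::
  "('b, 'e::real_normed_vector) atlas \<Rightarrow> ('b tangent \<Rightarrow> 'b tangent) \<Rightarrow>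
   ('b \<Rightarrow> 'b tangent) \<Rightarrow> ('b \<Rightarrow> 'b tangent) \<Rightarrow> 'b \<Rightarrow> 'b tangent" where
  "curvature_field E P X Y e =
     tdiff E
       (tscale E (- 1) (P (lie_bracket E (hor E P \<circ> X) (hor E P \<circ> Y) e)))
       (hor E P (lie_bracket E (P \<circ> X) (P \<circ> Y) e))"

text \<open>By tensoriality the curvature is defined on tangent vectors \<open>u, v\<close> at \<open>e\<close>, through
  arbitrary extensions to local vector fields.\<close>

definition curvature ::
  "('b, 'e::real_normed_vector) atlas \<Rightarrow> ('b tangent \<Rightarrow> 'b tangent) \<Rightarrow>
   'b \<Rightarrow> 'b tangent \<Rightarrow> 'b tangent \<Rightarrow> 'b tangent" where
  "curvature E P e u v = (THE w. \<forall>W X Y.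
     e \<in> W \<and> vector_field_on E W X \<and> vector_field_on E W Y \<and> X e = u \<and> Y e = v \<longrightarrow>
     w = curvature_field E P X Y e)"

definition curvature_along ::
  "('b, 'e::real_normed_vector) atlas \<Rightarrow> ('b tangent \<Rightarrow> 'b tangent) \<Rightarrow>
   ('a \<Rightarrow> 'a tangent) \<Rightarrow> ('a \<Rightarrow> 'a tangent) \<Rightarrow> ('a \<Rightarrow> 'b) \<Rightarrow> 'a \<Rightarrow> 'b tangent" where
  "curvature_along E P X Y f =
     (\<lambda>p. curvature E P (f p) (pushforward E f (X p)) (pushforward E f (Y p)))"


section \<open>The second vertical bundle\<close>

text \<open>The iterated tangent bundle of a fiber is represented by surfaces \<open>\<gamma>(t, \<epsilon>)\<close> in that fiber;
  \<open>surface_velocity\<close> is \<open>d/dt|\<^sub>0 d/d\<epsilon>|\<^sub>0 \<gamma>(t, \<epsilon>)\<close>, a tangent vector of the vertical bundle.\<close>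

definition fiber_surface ::
  "('b, 'e::real_normed_vector) atlas \<Rightarrow> ('b \<Rightarrow> 'a) \<Rightarrow> (real \<times> real \<Rightarrow> 'b) \<Rightarrow> bool" where
  "fiber_surface E \<pi> \<gamma> \<longleftrightarrow>
     smooth_map standard_atlas E UNIV \<gamma> \<and> (\<forall>s. \<pi> (\<gamma> s) = \<pi> (\<gamma> (0, 0)))"

definition surface_velocity ::
  "('a, 'm::real_normed_vector) atlas \<Rightarrow> ('b, 'm \<times> 'f::real_normed_vector) atlas \<Rightarrow> ('b \<Rightarrow> 'a) \<Rightarrow>
   (real \<times> real \<Rightarrow> 'b) \<Rightarrow> 'b tangent tangent" where
  "surface_velocity M E \<pi> \<gamma> =
     velocity (vertical_atlas M E \<pi>) (\<lambda>t. velocity E (\<lambda>\<epsilon>. \<gamma> (t, \<epsilon>)))"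

definition involution ::
  "('a, 'm::real_normed_vector) atlas \<Rightarrow> ('b, 'm \<times> 'f::real_normed_vector) atlas \<Rightarrow> ('b \<Rightarrow> 'a) \<Rightarrow>
   'b tangent tangent \<Rightarrow> 'b tangent tangent" where
  "involution M E \<pi> \<xi> = (THE \<eta>. \<exists>\<gamma>. fiber_surface E \<pi> \<gamma> \<and>
     \<xi> = surface_velocity M E \<pi> \<gamma> \<and>
     \<eta> = surface_velocity M E \<pi> (\<lambda>(t, \<epsilon>). \<gamma> (\<epsilon>, t)))"

definition double_projection ::
  "('a, 'm::real_normed_vector) atlas \<Rightarrow> ('b, 'm \<times> 'f::real_normed_vector) atlas \<Rightarrow> ('b \<Rightarrow> 'a) \<Rightarrow>
   'b tangent tangent \<Rightarrow> 'b tangent \<times> 'b tangent" where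
  "double_projection M E \<pi> \<xi> = (THE vw. \<exists>\<gamma>. fiber_surface E \<pi> \<gamma> \<and>
     \<xi> = surface_velocity M E \<pi> \<gamma> \<and>
     vw = (velocity E (\<lambda>\<epsilon>. \<gamma> (0, \<epsilon>)), velocity E (\<lambda>t. \<gamma> (t, 0))))"

text \<open>The last group of the coordinates \<open>(y; dy/dt; dy/d\<epsilon>; d\<^sup>2y/dt d\<epsilon>)\<close> induced by the fiber
  coordinates \<open>y\<close> of an adapted chart.\<close>

definition mixed_coord ::
  "('b, 'm \<times> 'f::real_normed_vector) chart \<Rightarrow> (real \<times> real \<Rightarrow> 'b) \<Rightarrow> 'f" where
  "mixed_coord c \<gamma> =
     vector_derivative (\<lambda>t. vector_derivative (\<lambda>\<epsilon>. snd (snd c (\<gamma> (t, \<epsilon>)))) (at 0)) (at 0)"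

text \<open>Meaningful for \<open>\<xi>, \<eta>\<close> with the same double projection.\<close>

definition affine_diff ::
  "('a, 'm::real_normed_vector) atlas \<Rightarrow> ('b, 'm \<times> 'f::real_normed_vector) atlas \<Rightarrow> ('b \<Rightarrow> 'a) \<Rightarrow>
   'b tangent tangent \<Rightarrow> 'b tangent tangent \<Rightarrow> 'b tangent" where
  "affine_diff M E \<pi> \<xi> \<eta> = (THE w. \<forall>\<gamma> \<delta>.
     fiber_surface E \<pi> \<gamma> \<and> \<xi> = surface_velocity M E \<pi> \<gamma> \<and>
     fiber_surface E \<pi> \<delta> \<and> \<eta> = surface_velocity M E \<pi> \<delta> \<longrightarrow>
       w \<in> vertical_space M E \<pi> (\<gamma> (0, 0)) \<and>
       (\<forall>c\<in>charts_at (adapted_charts M E \<pi>) (\<gamma> (0, 0)).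
          snd (deriv_along w (snd c)) = mixed_coord c \<gamma> - mixed_coord c \<delta>))"

definition section_family ::
  "('a, 'm::real_normed_vector) atlas \<Rightarrow> ('b, 'e::real_normed_vector) atlas \<Rightarrow> ('b \<Rightarrow> 'a) \<Rightarrow>
   'a set \<Rightarrow> (real \<Rightarrow> 'a \<Rightarrow> 'b) \<Rightarrow> bool" where
  "section_family M E \<pi> U f \<longleftrightarrow>
     openin (atlas_topology M) U \<and>
     smooth_map (product_atlas standard_atlas M) E (UNIV \<times> U) (\<lambda>(\<epsilon>, p). f \<epsilon> p) \<and>
     (\<forall>\<epsilon>. \<forall>p\<in>U. \<pi> (f \<epsilon> p) = p)"

definition variation ::
  "('b, 'e::real_normed_vector) atlas \<Rightarrow> (real \<Rightarrow> 'a \<Rightarrow> 'b) \<Rightarrow> 'a \<Rightarrow> 'b tangent" where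
  "variation E f = (\<lambda>p. velocity E (\<lambda>\<epsilon>. f \<epsilon> p))"

definition induced_connection ::
  "('a, 'm::real_normed_vector) atlas \<Rightarrow> ('b, 'm \<times> 'f::real_normed_vector) atlas \<Rightarrow> ('b \<Rightarrow> 'a) \<Rightarrow>
   ('b tangent \<Rightarrow> 'b tangent) \<Rightarrow> ('b tangent tangent \<Rightarrow> 'b tangent tangent) \<Rightarrow> bool" where
  "induced_connection M E \<pi> P PV \<longleftrightarrow>
     nonlinear_connection M (vertical_atlas M E \<pi>) (\<pi> \<circ> base) PV \<and>
     (\<forall>X U f. vector_field_on M (carrier M) X \<and> section_family M E \<pi> U f \<longrightarrow>
        (\<forall>p\<in>U. cov_deriv (vertical_atlas M E \<pi>) PV X (variation E f) p =
           involution M E \<pi>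
             (variation (vertical_atlas M E \<pi>) (\<lambda>\<epsilon>. cov_deriv E P X (f \<epsilon>)) p)))"

end

theory Submission
  imports Defs
begin

text \<open>In an adapted chart \<open>(x, y)\<close> of the total space a section is a function \<open>y(x)\<close> and the connection
  is \<open>P (a, w) = (0, w + G(x, y) a)\<close>, so \<open>D\<^sub>X f\<close> is \<open>w\<^sub>X = Dy(X) + G(x, y) X\<close>. Locally \<open>D\<^sub>Y f\<close> is the variation
  of a family of sections, and the defining property of the induced connection turns
  \<open>D\<^sub>X D\<^sub>Y f\<close> into the point of the second vertical bundle with first order coordinates \<open>w\<^sub>X, w\<^sub>Y\<close> and
  mixed coordinate \<open>Dw\<^sub>Y(X) + D\<^sub>yG(w\<^sub>Y) X\<close>. The involution swaps the first order coordinates, so the affine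
  difference is the difference of the mixed coordinates. After subtracting \<open>D\<^bsub>[X,Y]\<^esub> f\<close> the second
  derivatives of \<open>y\<close> cancel by symmetry, and what remains,
  \<open>DG(X, - G X) Y - DG(Y, - G Y) X\<close>, is minus the vertical part of the bracket of
  the horizontal lifts \<open>(X, - G X)\<close> and \<open>(Y, - G Y)\<close>.\<close>

section \<open>Calculus of smooth maps\<close>

text \<open>Most objects of the statement are definite descriptions: the Lie bracket, the curvature
  of two tangent vectors, the involution, the double projection, the affine difference and even the
  sum of two tangent vectors. Each requires a value that exists and is unique. Coordinates supply
  both: \<open>tvec\<close> and \<open>xi\<close> name a vector by its coordinates in one chart, and
  every operation is evaluated on such names. Three obstacles shape the proof. \<open>Ck_on\<close>
  only speaks of derivatives in fixed directions, whereas the chain rule and the connection need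
  directions that vary with the point; orthonormal coordinates reduce these to finite sums. Surfaces
  and families of sections have to be defined for all real parameters although charts are local;
  hence bounded parameters instead of straight lines. The induced connection is known only through
  its values on variations, and a variation matches a given vertical section only near one point;
  this is enough because a pushforward depends only on a germ.\<close>

abbreviation FD :: "('a::real_normed_vector \<Rightarrow> 'b::real_normed_vector) \<Rightarrow> 'a \<Rightarrow> 'a \<Rightarrow> 'b" where
  "FD f x \<equiv> frechet_derivative f (at x)"

section \<open>Finite-dimensional model spaces\<close>

definition findim :: "'a::real_normed_vector itself \<Rightarrow> bool" where
  "findim _ \<longleftrightarrow> (\<exists>B::'a set. finite B \<and> span B = UNIV)"

text \<open>Gram-Schmidt followed by normalisation. The expansion turns a derivative in a direction
  depending on the point into a finite sum of scalar multiples of derivatives in fixed directions,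
  the only ones that \<open>Ck_on\<close> mentions.\<close>

lemma findim_coords:
  assumes "findim TYPE('a::real_inner)"
  obtains B :: "'a::real_inner set" where "finite B" "\<And>x. (\<Sum>b\<in>B. (x \<bullet> b) *\<^sub>R b) = x"
proof -
  obtain B0 :: "'a set" where "finite B0" "span B0 = UNIV"
    using assms unfolding findim_def by auto
  then obtain C where C: "finite C" "span C = (UNIV :: 'a set)" "pairwise orthogonal C"
    using basis_orthogonal[of B0] by metis
  define s where "s c = (1 / norm c) *\<^sub>R c" for c :: 'a
  have s0: "(c \<bullet> s c) *\<^sub>R s c = c" if "c \<noteq> 0" for c
    using that by (simp add: s_def dot_square_norm power2_eq_square)
  define C' where "C' = C - {0}"
  have C': "finite C'" "span C' = UNIV" "pairwise orthogonal C'" "0 \<notin> C'"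
    unfolding C'_def using C by (auto simp: span_delete_0 pairwise_def)
  have key: "(\<Sum>c\<in>C'. (x \<bullet> s c) *\<^sub>R s c) = x" for x
  proof -
    have "x \<in> span C'" using C' by auto
    then show ?thesis
    proof (induction rule: span_induct_alt)
      case base
      then show ?case by simp
    next
      case (step r c y)
      have "(c \<bullet> s d) *\<^sub>R s d = (if d = c then c else 0)" if "d \<in> C'" for d
      proof (cases "d = c")
        case True
        moreover have "c \<noteq> 0" using \<open>c \<in> C'\<close> C'(4) by blast
        ultimately show ?thesis using s0 by simp
      next
        case False
        then have "orthogonal c d"
          using C'(3) \<open>d \<in> C'\<close> \<open>c \<in> C'\<close> by (auto simp: pairwise_def)
        then show ?thesis using False by (simp add: s_def orthogonal_def)
      qed
      then have "(\<Sum>d\<in>C'. (c \<bullet> s d) *\<^sub>R s d) = c"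
        using C' \<open>c \<in> C'\<close> by (simp add: sum.delta)
      moreover have "(\<Sum>d\<in>C'. ((r *\<^sub>R c + y) \<bullet> s d) *\<^sub>R s d)
          = r *\<^sub>R (\<Sum>d\<in>C'. (c \<bullet> s d) *\<^sub>R s d) + (\<Sum>d\<in>C'. (y \<bullet> s d) *\<^sub>R s d)"
        by (simp add: inner_add_left scaleR_left_distrib sum.distrib scaleR_right.sum)
      ultimately show ?case using step by simp
    qed
  qed
  \<comment> \<open>Two distinct orthogonal vectors with the same normalisation would make
    \<open>c\<close> orthogonal to \<open>s c\<close>, against \<open>s0\<close>. Injectivity
    carries the sum over to the image set.\<close>
  have inj: "inj_on s C'"
  proof (rule inj_onI, rule ccontr)
    fix c d assume h: "c \<in> C'" "d \<in> C'" "s c = s d" "c \<noteq> d"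
    then have "c \<bullet> d = 0" using C'(3) by (auto simp: pairwise_def orthogonal_def)
    then have "c \<bullet> s d = 0" by (simp add: s_def)
    then have "c \<bullet> s c = 0" using h by simp
    then show False using s0[of c] h C' by auto
  qed
  show ?thesis
    by (rule that[of "s ` C'"]) (use C' key inj in \<open>simp_all add: sum.reindex\<close>)
qed

lemma findim_real [simp]: "findim TYPE(real)"
  unfolding findim_def
proof (intro exI conjI)
  show "finite {1::real}" by simp
  have "x \<in> span {1}" for x :: real
    using span_scale[OF span_base[of 1 "{1::real}"], of x] by simp
  then show "span {1::real} = UNIV" by auto
qed

lemma findim_prod:
  assumes "findim TYPE('a::real_normed_vector)" "findim TYPE('b::real_normed_vector)"
  shows "findim TYPE('a::real_normed_vector \<times> 'b::real_normed_vector)"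
proof -
  obtain A :: "'a set" and B :: "'b set"
    where A: "finite A" "span A = UNIV" and B: "finite B" "span B = UNIV"
    using assms unfolding findim_def by auto
  let ?C = "(\<lambda>a. (a, 0)) ` A \<union> (\<lambda>b. (0, b)) ` B"
  have "linear (\<lambda>a::'a. (a, 0::'b))" "linear (\<lambda>b::'b. (0::'a, b))"
    by (auto intro!: linearI)
  then have "span ((\<lambda>a. (a, 0::'b)) ` A) = range (\<lambda>a. (a, 0))"
    "span ((\<lambda>b. (0::'a, b)) ` B) = range (\<lambda>b. (0, b))"
    using A B by (simp_all add: linear_span_image)
  then have "(a, 0) \<in> span ?C" "(0, b) \<in> span ?C" for a b
    using span_mono[of "(\<lambda>a. (a, 0::'b)) ` A" ?C] span_mono[of "(\<lambda>b. (0::'a, b)) ` B" ?C] by auto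
  then have "(a, b) \<in> span ?C" for a b
    using span_add[of "(a, 0)" ?C "(0, b)"] by simp
  then have "span ?C = UNIV" by auto
  moreover have "finite ?C" using A B by auto
  ultimately show ?thesis unfolding findim_def by blast
qed

section \<open>Derivatives and functions of finite differentiability order\<close>

lemma FD_eqI: "(f has_derivative f') (at x) \<Longrightarrow> FD f x = f'"
  using frechet_derivative_at by metis

text \<open>\<open>frechet_derivative\<close> is a choice among all derivatives at the point.
  Functions that agree near the point have the same derivatives, so the two choices coincide even
  where no derivative exists.\<close>

lemma FD_cong_open:
  assumes "open S" "x \<in> S" "\<And>y. y \<in> S \<Longrightarrow> f y = g y"
  shows "FD f x = FD g x"
proof -
  have "(f has_derivative f') (at x) \<longleftrightarrow> (g has_derivative f') (at x)" for f'
    using assms has_derivative_transform_within_open[of f f' x UNIV S g]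
      has_derivative_transform_within_open[of g f' x UNIV S f] by metis
  then show ?thesis unfolding frechet_derivative_def by simp
qed

lemma differentiable_cong_open:
  assumes "open S" "x \<in> S" "\<And>y. y \<in> S \<Longrightarrow> f y = g y" "f differentiable (at x)"
  shows "g differentiable (at x)"
  using assms has_derivative_transform_within_open[of f _ x UNIV S g] unfolding differentiable_def by metis

lemma Ck_on_cong:
  assumes "open S" "\<And>y. y \<in> S \<Longrightarrow> f y = g y" "Ck_on k S f"
  shows "Ck_on k S g"
  using assms(2,3)
proof (induction k arbitrary: f g)
  case 0
  then show ?case by (simp cong: continuous_on_cong)
next
  case (Suc k)
  have "Ck_on k S (\<lambda>x. FD g x v)" for v
  proof (rule Suc.IH)
    show "FD f x v = FD g x v" if "x \<in> S" for x
      using FD_cong_open[OF assms(1) that, of f g] Suc.prems(1) by simp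
    show "Ck_on k S (\<lambda>x. FD f x v)" using Suc.prems by simp
  qed
  moreover have "\<forall>x\<in>S. g differentiable (at x)"
    using Suc.prems differentiable_cong_open[OF assms(1), of _ f g] by auto
  ultimately show ?case by simp
qed

lemma Ck_on_subset: "Ck_on k S f \<Longrightarrow> T \<subseteq> S \<Longrightarrow> Ck_on k T f"
  by (induction k arbitrary: f) (auto intro: continuous_on_subset)

lemma Ck_on_Suc_imp: "Ck_on (Suc k) S f \<Longrightarrow> Ck_on k S f"
proof (induction k arbitrary: f)
  case 0
  then show ?case
    by (auto intro!: continuous_at_imp_continuous_on differentiable_imp_continuous_within)
next
  case (Suc k)
  from Ck_on.simps(2)[THEN iffD1, OF Suc.prems]
  have h: "\<forall>x\<in>S. f differentiable (at x)" "\<And>v. Ck_on (Suc k) S (\<lambda>x. FD f x v)" by blast+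
  show ?case using h(1) Suc.IH[OF h(2)] by simp
qed

text \<open>The closure rules below share one shape: exhibit an explicit derivative, then apply the
  induction hypothesis to its value in each fixed direction. Openness of \<open>S\<close> lets the
  explicit formula replace \<open>FD\<close>.\<close>

lemma Ck_on_SucI:
  assumes "open S" "\<And>x. x \<in> S \<Longrightarrow> (f has_derivative f' x) (at x)"
    "\<And>v. Ck_on k S (\<lambda>x. f' x v)"
  shows "Ck_on (Suc k) S f"
proof -
  have "Ck_on k S (\<lambda>x. FD f x v)" for v
    using FD_eqI[OF assms(2)] by (intro Ck_on_cong[OF assms(1) _ assms(3)[of v]]) simp
  then show ?thesis using assms(2) by (auto simp: differentiable_def)
qed

lemma Ck_on_Suc_derivative: "Ck_on (Suc k) S f \<Longrightarrow> x \<in> S \<Longrightarrow> (f has_derivative FD f x) (at x)"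
  using frechet_derivative_works by auto

lemma Ck_on_Suc_dir: "Ck_on (Suc k) S f \<Longrightarrow> Ck_on k S (\<lambda>x. FD f x v)"
  by simp

lemma Ck_on_linear:
  assumes "open S" "bounded_linear L" "Ck_on k S f"
  shows "Ck_on k S (\<lambda>x. L (f x))"
  using assms(3)
proof (induction k arbitrary: f)
  case 0
  then show ?case using assms(2) by (simp add: bounded_linear.continuous_on)
next
  case (Suc k)
  show ?case
    by (rule Ck_on_SucI[OF assms(1) bounded_linear.has_derivative[OF assms(2)
          Ck_on_Suc_derivative[OF Suc.prems]] Suc.IH[OF Ck_on_Suc_dir[OF Suc.prems]]])
qed

lemma Ck_on_add:
  assumes "open S" "Ck_on k S f" "Ck_on k S g"
  shows "Ck_on k S (\<lambda>x. f x + g x)"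
  using assms(2,3)
proof (induction k arbitrary: f g)
  case 0
  then show ?case by (simp add: continuous_on_add)
next
  case (Suc k)
  show ?case
    by (rule Ck_on_SucI[OF assms(1) has_derivative_add[OF Suc.prems[THEN Ck_on_Suc_derivative]]
          Suc.IH[OF Suc.prems[THEN Ck_on_Suc_dir]]])
qed

lemma Ck_on_const: "Ck_on k S (\<lambda>x. a)"
proof (induction k arbitrary: a)
  case (Suc k)
  then show ?case by (simp add: frechet_derivative_const)
qed simp

lemma Ck_on_sum:
  assumes "open S" "\<And>i. i \<in> I \<Longrightarrow> Ck_on k S (f i)"
  shows "Ck_on k S (\<lambda>x. \<Sum>i\<in>I. f i x)"
  using assms(2)
  by (induction I rule: infinite_finite_induct) (auto intro!: Ck_on_const Ck_on_add[OF assms(1)])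

text \<open>The product rule contains \<open>f\<close> and \<open>g\<close> undifferentiated as
  well, so they are also needed one order lower; this is where \<open>Ck_on_Suc_imp\<close> comes
  in.\<close>

lemma Ck_on_scaleR:
  assumes "open S" "Ck_on k S f" "Ck_on k S g"
  shows "Ck_on k S (\<lambda>x. f x *\<^sub>R g x)"
  using assms(2,3)
proof (induction k arbitrary: f g)
  case 0
  then show ?case by (simp add: continuous_on_scaleR)
next
  case (Suc k)
  show ?case
    by (rule Ck_on_SucI[OF assms(1) has_derivative_scaleR[OF Suc.prems[THEN Ck_on_Suc_derivative]]
          Ck_on_add[OF assms(1) Suc.IH[OF Ck_on_Suc_imp[OF Suc.prems(1)] Ck_on_Suc_dir[OF Suc.prems(2)]]
            Suc.IH[OF Ck_on_Suc_dir[OF Suc.prems(1)] Ck_on_Suc_imp[OF Suc.prems(2)]]]])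
qed

lemma Ck_on_Pair:
  assumes "open S" "Ck_on k S f" "Ck_on k S g"
  shows "Ck_on k S (\<lambda>x. (f x, g x))"
  using assms(2,3)
proof (induction k arbitrary: f g)
  case 0
  then show ?case by (simp add: continuous_on_Pair)
next
  case (Suc k)
  show ?case
    by (rule Ck_on_SucI[OF assms(1) has_derivative_Pair[OF Suc.prems[THEN Ck_on_Suc_derivative]]
          Suc.IH[OF Suc.prems[THEN Ck_on_Suc_dir]]])
qed

lemma linear_expand:
  assumes "linear L" "(\<Sum>b\<in>B. (x \<bullet> b) *\<^sub>R b) = x"
  shows "(\<Sum>b\<in>B. (x \<bullet> b) *\<^sub>R L b) = L x"
proof -
  have "L x = L (\<Sum>b\<in>B. (x \<bullet> b) *\<^sub>R b)" using assms(2) by simp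
  also have "\<dots> = (\<Sum>b\<in>B. (x \<bullet> b) *\<^sub>R L b)"
    using assms(1) by (simp add: linear_sum linear_cmul o_def)
  finally show ?thesis by simp
qed

text \<open>The direction \<open>FD f x v\<close> in which the outer derivative is taken varies with
  \<open>x\<close>. Expanding it in orthonormal coordinates leaves products of its components with
  fixed-direction derivatives of \<open>g\<close>, and the induction, with \<open>g\<close>
  arbitrary, applies to the latter.\<close>

lemma Ck_on_compose:
  fixes f :: "'a::real_normed_vector \<Rightarrow> 'b::real_inner" and g :: "'b \<Rightarrow> 'c::real_normed_vector"
  assumes fd: "findim TYPE('b)" and S: "open S" and sub: "f ` S \<subseteq> T"
    and "Ck_on k S f" "Ck_on k T g"
  shows "Ck_on k S (\<lambda>x. g (f x))"
  using assms(4,5)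
proof (induction k arbitrary: g)
  case 0
  then show ?case using sub by (auto intro: continuous_on_compose2)
next
  case (Suc k)
  obtain B :: "'b set" where B: "finite B" "\<And>x. (\<Sum>b\<in>B. (x \<bullet> b) *\<^sub>R b) = x"
    using findim_coords[OF fd] by blast
  have f': "(f has_derivative FD f x) (at x)" if "x \<in> S" for x
    using Ck_on_Suc_derivative[OF Suc.prems(1) that] .
  have g': "(g has_derivative FD g (f x)) (at (f x))" if "x \<in> S" for x
    using Ck_on_Suc_derivative[OF Suc.prems(2)] sub that by blast
  have d: "((\<lambda>x. g (f x)) has_derivative (\<lambda>v. \<Sum>b\<in>B. (FD f x v \<bullet> b) *\<^sub>R FD g (f x) b)) (at x)"
    if "x \<in> S" for x
    using has_derivative_compose[OF f'[OF that] g'[OF that]]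
    unfolding linear_expand[OF has_derivative_linear[OF g'[OF that]] B(2)] .
  show ?case
  proof (rule Ck_on_SucI[OF S d], assumption, intro Ck_on_sum[OF S] Ck_on_scaleR[OF S])
    fix b v
    show "Ck_on k S (\<lambda>x. FD f x v \<bullet> b)"
      by (rule Ck_on_linear[OF S bounded_linear_inner_left Ck_on_Suc_dir[OF Suc.prems(1)]])
    show "Ck_on k S (\<lambda>x. FD g (f x) b)"
      by (rule Suc.IH[OF Ck_on_Suc_imp[OF Suc.prems(1)] Ck_on_Suc_dir[OF Suc.prems(2)]])
  qed
qed

section \<open>Smooth functions and their closure rules\<close>

lemma smooth_on_iff:
  "smooth_on S f \<longleftrightarrow> (\<forall>x\<in>S. f differentiable (at x)) \<and> (\<forall>v. smooth_on S (\<lambda>x. FD f x v))"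
proof
  assume h: "smooth_on S f"
  then have "Ck_on (Suc k) S f" for k unfolding smooth_on_def by blast
  then show "(\<forall>x\<in>S. f differentiable (at x)) \<and> (\<forall>v. smooth_on S (\<lambda>x. FD f x v))"
    unfolding smooth_on_def by auto
next
  assume h: "(\<forall>x\<in>S. f differentiable (at x)) \<and> (\<forall>v. smooth_on S (\<lambda>x. FD f x v))"
  then have S: "Ck_on (Suc k) S f" for k unfolding smooth_on_def by auto
  show "smooth_on S f" unfolding smooth_on_def using S Ck_on_Suc_imp by blast
qed

lemma smooth_deriv:
  assumes "smooth_on S f" "x \<in> S"
  shows "(f has_derivative FD f x) (at x)"
  using assms frechet_derivative_works smooth_on_iff by metis

lemma smooth_on_dir: "smooth_on S f \<Longrightarrow> smooth_on S (\<lambda>x. FD f x v)"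
  using smooth_on_iff by metis

lemma linear_FD: "smooth_on S f \<Longrightarrow> x \<in> S \<Longrightarrow> linear (FD f x)"
  using smooth_deriv has_derivative_linear by blast

lemma smooth_on_continuous: "smooth_on S f \<Longrightarrow> continuous_on S f"
  unfolding smooth_on_def by (metis Ck_on.simps(1))

lemma smooth_on_cong:
  assumes "open S" "smooth_on S f" "\<And>y. y \<in> S \<Longrightarrow> f y = g y"
  shows "smooth_on S g"
  using assms(2) Ck_on_cong[OF assms(1,3)] unfolding smooth_on_def by simp

lemma smooth_on_subset: "smooth_on S f \<Longrightarrow> T \<subseteq> S \<Longrightarrow> smooth_on T f"
  using Ck_on_subset unfolding smooth_on_def by blast

text \<open>Needed when maps are examined through charts: the intermediate chart of a composition
  changes from point to point, so smoothness is only established near each point.\<close>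

lemma smooth_on_local:
  assumes "\<And>x. x \<in> S \<Longrightarrow> \<exists>T. open T \<and> x \<in> T \<and> smooth_on T f"
  shows "smooth_on S f"
proof -
  have "Ck_on k S f" if "\<And>x. x \<in> S \<Longrightarrow> \<exists>T. open T \<and> x \<in> T \<and> Ck_on k T f" for k
    using that
  proof (induction k arbitrary: f)
    case 0
    have "continuous (at x) f" if "x \<in> S" for x
    proof -
      obtain T where "open T" "x \<in> T" "continuous_on T f" using "0.prems"[OF \<open>x \<in> S\<close>] by auto
      then show ?thesis using continuous_on_eq_continuous_at by blast
    qed
    then show ?case by (simp add: continuous_at_imp_continuous_on)
  next
    case (Suc k)
    have "f differentiable (at x)" if "x \<in> S" for x
      using Suc.prems[OF that] by auto
    moreover have "Ck_on k S (\<lambda>x. FD f x v)" for v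
      by (rule Suc.IH) (use Suc.prems in fastforce)
    ultimately show ?case by simp
  qed
  then show ?thesis using assms unfolding smooth_on_def by blast
qed

lemma smooth_on_const: "smooth_on S (\<lambda>x. a)"
  unfolding smooth_on_def using Ck_on_const by blast

lemma smooth_on_linear:
  assumes "open S" "bounded_linear L" "smooth_on S f"
  shows "smooth_on S (\<lambda>x. L (f x))"
  using assms(3) Ck_on_linear[OF assms(1,2)] unfolding smooth_on_def by simp

lemma smooth_on_ident: "smooth_on S (\<lambda>x. x)"
  using smooth_on_const smooth_on_iff[of S "\<lambda>x. x"] by auto

lemma smooth_on_add:
  "open S \<Longrightarrow> smooth_on S f \<Longrightarrow> smooth_on S g \<Longrightarrow> smooth_on S (\<lambda>x. f x + g x)"
  unfolding smooth_on_def by (simp add: Ck_on_add)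

lemma smooth_on_scaleR:
  "open S \<Longrightarrow> smooth_on S f \<Longrightarrow> smooth_on S g \<Longrightarrow> smooth_on S (\<lambda>x. f x *\<^sub>R g x)"
  unfolding smooth_on_def by (simp add: Ck_on_scaleR)

lemma smooth_on_sum:
  "open S \<Longrightarrow> (\<And>i. i \<in> I \<Longrightarrow> smooth_on S (f i)) \<Longrightarrow> smooth_on S (\<lambda>x. \<Sum>i\<in>I. f i x)"
  unfolding smooth_on_def by (simp add: Ck_on_sum)

lemma smooth_on_Pair:
  "open S \<Longrightarrow> smooth_on S f \<Longrightarrow> smooth_on S g \<Longrightarrow> smooth_on S (\<lambda>x. (f x, g x))"
  unfolding smooth_on_def by (simp add: Ck_on_Pair)

lemma smooth_on_fst: "open S \<Longrightarrow> smooth_on S f \<Longrightarrow> smooth_on S (\<lambda>x. fst (f x))"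
  by (rule smooth_on_linear[OF _ bounded_linear_fst])

lemma smooth_on_snd: "open S \<Longrightarrow> smooth_on S f \<Longrightarrow> smooth_on S (\<lambda>x. snd (f x))"
  by (rule smooth_on_linear[OF _ bounded_linear_snd])

lemma smooth_on_minus: "open S \<Longrightarrow> smooth_on S f \<Longrightarrow> smooth_on S (\<lambda>x. - f x)"
  by (rule smooth_on_linear[OF _ bounded_linear_minus[OF bounded_linear_ident]])

lemma smooth_on_compose:
  fixes f :: "'a::real_normed_vector \<Rightarrow> 'b::real_inner"
  assumes "findim TYPE('b)" "open S" "smooth_on S f" "f ` S \<subseteq> T" "smooth_on T g"
  shows "smooth_on S (\<lambda>x. g (f x))"
  unfolding smooth_on_def
proof
  fix k
  show "Ck_on k S (\<lambda>x. g (f x))"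
    using assms(3,5) unfolding smooth_on_def
    by (intro Ck_on_compose[OF assms(1,2,4), of k g]) (blast+)
qed

text \<open>The orthonormal expansion of the direction again, now giving smoothness when point and
  direction vary together.\<close>

lemma smooth_on_FD:
  fixes h :: "'b::real_inner \<Rightarrow> 'c::real_normed_vector"
  assumes fd: "findim TYPE('b)" and S: "open S" and h: "smooth_on T h"
    and f: "smooth_on S f" "f ` S \<subseteq> T" and g: "smooth_on S g"
  shows "smooth_on S (\<lambda>x. FD h (f x) (g x))"
proof -
  obtain B :: "'b set" where B: "finite B" "\<And>x. (\<Sum>b\<in>B. (x \<bullet> b) *\<^sub>R b) = x"
    using findim_coords[OF fd] by blast
  have 1: "smooth_on S (\<lambda>x. \<Sum>b\<in>B. (g x \<bullet> b) *\<^sub>R FD h (f x) b)"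
    by (intro smooth_on_sum[OF S] smooth_on_scaleR[OF S] smooth_on_linear[OF S bounded_linear_inner_left g]
        smooth_on_compose[OF fd S f smooth_on_dir[OF h]])
  show ?thesis
  proof (rule smooth_on_cong[OF S 1])
    show "(\<Sum>b\<in>B. (g x \<bullet> b) *\<^sub>R FD h (f x) b) = FD h (f x) (g x)" if "x \<in> S" for x
      using linear_expand[OF linear_FD[OF h] B(2)] f that by auto
  qed
qed

text \<open>The product rule for the pairing of a varying differential with a varying vector. The
  first summand freezes the vector at \<open>g x\<close>, so the second derivative is again
  expressed through a fixed direction.\<close>

lemma has_derivative_FD:
  fixes h :: "'b::real_inner \<Rightarrow> 'c::real_normed_vector"
  assumes fd: "findim TYPE('b)" and h: "smooth_on T h" "open T" and fx: "f x \<in> T"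
    and f: "(f has_derivative f') (at x)" and g: "(g has_derivative g') (at x)"
  shows "((\<lambda>x. FD h (f x) (g x)) has_derivative
     (\<lambda>v. FD (\<lambda>u. FD h u (g x)) (f x) (f' v) + FD h (f x) (g' v))) (at x)"
proof -
  obtain B :: "'b set" where B: "finite B" "\<And>x. (\<Sum>b\<in>B. (x \<bullet> b) *\<^sub>R b) = x"
    using findim_coords[OF fd] by blast
  have db: "((\<lambda>u. FD h u b) has_derivative FD (\<lambda>u. FD h u b) y) (at y)" if "y \<in> T" for y b
    using smooth_deriv[OF smooth_on_dir[OF h(1)] that] .
  have fr: "((\<lambda>u. FD h (f u) b) has_derivative (\<lambda>v. FD (\<lambda>u. FD h u b) (f x) (f' v))) (at x)" for b
    using has_derivative_compose[OF f db[OF fx]] .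
  have main: "((\<lambda>x. \<Sum>b\<in>B. (g x \<bullet> b) *\<^sub>R FD h (f x) b) has_derivative
      (\<lambda>v. \<Sum>b\<in>B. (g x \<bullet> b) *\<^sub>R FD (\<lambda>u. FD h u b) (f x) (f' v) + (g' v \<bullet> b) *\<^sub>R FD h (f x) b)) (at x)"
    by (intro has_derivative_sum has_derivative_scaleR has_derivative_inner_left g fr)
  have 1: "(\<Sum>b\<in>B. (z \<bullet> b) *\<^sub>R FD h y b) = FD h y z" if "y \<in> T" for y z
    using linear_expand[OF linear_FD[OF h(1) that] B(2)] .
  \<comment> \<open>Differentiating the expansion with a frozen vector \<open>z\<close> identifies
    the first half of the sum in \<open>main\<close> as a derivative of
    \<open>\<lambda>u. FD h u z\<close>.\<close>
  have 2: "((\<lambda>u. FD h u z) has_derivative (\<lambda>w. \<Sum>b\<in>B. (z \<bullet> b) *\<^sub>R FD (\<lambda>u. FD h u b) y w)) (at y)"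
    if "y \<in> T" for y z
  proof (rule has_derivative_transform_within_open[OF _ h(2) that 1])
    show "((\<lambda>u. \<Sum>b\<in>B. (z \<bullet> b) *\<^sub>R FD h u b) has_derivative
        (\<lambda>w. \<Sum>b\<in>B. (z \<bullet> b) *\<^sub>R FD (\<lambda>u. FD h u b) y w)) (at y)"
      by (intro has_derivative_sum has_derivative_scaleR_right db that)
  qed
  have "continuous (at x) f" using f has_derivative_continuous by blast
  then obtain N where N: "open N" "x \<in> N" "f ` N \<subseteq> T"
    using h(2) fx unfolding continuous_at_open by (metis image_subsetI)
  have "((\<lambda>x. FD h (f x) (g x)) has_derivative
      (\<lambda>v. \<Sum>b\<in>B. (g x \<bullet> b) *\<^sub>R FD (\<lambda>u. FD h u b) (f x) (f' v) + (g' v \<bullet> b) *\<^sub>R FD h (f x) b)) (at x)"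
    by (rule has_derivative_transform_within_open[OF main N(1,2)]) (use N 1 in auto)
  moreover have "(\<Sum>b\<in>B. (g x \<bullet> b) *\<^sub>R FD (\<lambda>u. FD h u b) (f x) (f' v) + (g' v \<bullet> b) *\<^sub>R FD h (f x) b)
     = FD (\<lambda>u. FD h u (g x)) (f x) (f' v) + FD h (f x) (g' v)" for v
    using FD_eqI[OF 2[OF fx, of "g x"]] 1[OF fx] by (simp add: sum.distrib)
  ultimately show ?thesis by simp
qed

text \<open>Schwarz's theorem. The second difference quotient of \<open>f\<close> along \<open>v\<close> and \<open>w\<close> is symmetric, and
  the mean value theorem, applied twice, expresses it as an iterated derivative at a nearby point.\<close>

lemma second_difference:
  fixes f :: "'a::real_normed_vector \<Rightarrow> real"
  assumes f: "smooth_on T f" and sub: "\<And>a b. 0 \<le> a \<Longrightarrow> a \<le> s \<Longrightarrow> 0 \<le> b \<Longrightarrow> b \<le> s \<Longrightarrow> x + a *\<^sub>R v + b *\<^sub>R w \<in> T"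
    and s: "s > 0"
  shows "\<exists>a b. 0 \<le> a \<and> a \<le> s \<and> 0 \<le> b \<and> b \<le> s \<and>
    f (x + s *\<^sub>R v + s *\<^sub>R w) - f (x + s *\<^sub>R v) - f (x + s *\<^sub>R w) + f x
      = s * (s * FD (\<lambda>y. FD f y v) (x + a *\<^sub>R v + b *\<^sub>R w) w)"
proof -
  define g where "g a = f (x + a *\<^sub>R v + s *\<^sub>R w) - f (x + a *\<^sub>R v + 0 *\<^sub>R w)" for a
  have lin: "FD f y (r *\<^sub>R z) = r *\<^sub>R FD f y z" if "y \<in> T" for y r z
    using linear_cmul[OF linear_FD[OF f that]] .
  have lin2: "FD (\<lambda>y. FD f y v) y (r *\<^sub>R z) = r *\<^sub>R FD (\<lambda>y. FD f y v) y z" if "y \<in> T" for y r z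
    using linear_cmul[OF linear_FD[OF smooth_on_dir[OF f] that]] .
  have df: "((\<lambda>a. f (x + a *\<^sub>R v + b *\<^sub>R w)) has_derivative (\<lambda>h. h * FD f (x + a *\<^sub>R v + b *\<^sub>R w) v)) (at a)"
    if "0 \<le> a" "a \<le> s" "0 \<le> b" "b \<le> s" for a b
  proof -
    have "((\<lambda>a. x + a *\<^sub>R v + b *\<^sub>R w) has_derivative (\<lambda>h. h *\<^sub>R v)) (at a)"
      by (auto intro!: derivative_eq_intros)
    from has_derivative_compose[OF this smooth_deriv[OF f sub[OF that]]]
    show ?thesis using lin[OF sub[OF that]] by simp
  qed
  have dg: "(g has_derivative (\<lambda>h. h * (FD f (x + a *\<^sub>R v + s *\<^sub>R w) v - FD f (x + a *\<^sub>R v + 0 *\<^sub>R w) v))) (at a)"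
    if "0 \<le> a" "a \<le> s" for a
    unfolding g_def
    using has_derivative_diff[OF df[OF that, of s] df[OF that, of 0]] s by (simp add: algebra_simps)
  have "\<exists>z. 0 < z \<and> z < s \<and> g s - g 0 = (s - 0) * (FD f (x + z *\<^sub>R v + s *\<^sub>R w) v - FD f (x + z *\<^sub>R v + 0 *\<^sub>R w) v)"
    using dg s by (intro MVT2) (auto simp: has_field_derivative_def mult_commute_abs)
  then obtain a where a: "0 < a" "a < s"
    "g s - g 0 = s * (FD f (x + a *\<^sub>R v + s *\<^sub>R w) v - FD f (x + a *\<^sub>R v + 0 *\<^sub>R w) v)" by auto
  define k where "k b = FD f (x + a *\<^sub>R v + b *\<^sub>R w) v" for b
  have dk: "(k has_derivative (\<lambda>h. h * FD (\<lambda>y. FD f y v) (x + a *\<^sub>R v + b *\<^sub>R w) w)) (at b)"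
    if "0 \<le> b" "b \<le> s" for b
  proof -
    have i: "x + a *\<^sub>R v + b *\<^sub>R w \<in> T" using sub[of a b] that a by simp
    have "((\<lambda>b. x + a *\<^sub>R v + b *\<^sub>R w) has_derivative (\<lambda>h. h *\<^sub>R w)) (at b)"
      by (auto intro!: derivative_eq_intros)
    from has_derivative_compose[OF this smooth_deriv[OF smooth_on_dir[OF f, of v] i]]
    show ?thesis unfolding k_def using lin2[OF i] by simp
  qed
  have "\<exists>z. 0 < z \<and> z < s \<and> k s - k 0 = (s - 0) * (FD (\<lambda>y. FD f y v) (x + a *\<^sub>R v + z *\<^sub>R w) w)"
    using dk s by (intro MVT2) (auto simp: has_field_derivative_def mult_commute_abs)
  then obtain b where b: "0 < b" "b < s"
    "k s - k 0 = s * (FD (\<lambda>y. FD f y v) (x + a *\<^sub>R v + b *\<^sub>R w) w)" by auto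
  have "g s - g 0 = s * (k s - k 0)" using a by (simp add: k_def)
  then have "g s - g 0 = s * (s * FD (\<lambda>y. FD f y v) (x + a *\<^sub>R v + b *\<^sub>R w) w)" using b by simp
  then show ?thesis using a b by (intro exI[of _ a] exI[of _ b]) (simp add: g_def)
qed

lemma FD_symmetric_real:
  fixes f :: "'a::real_normed_vector \<Rightarrow> real"
  assumes S: "open S" and f: "smooth_on S f" and x: "x \<in> S"
  shows "FD (\<lambda>y. FD f y v) x w = FD (\<lambda>y. FD f y w) x v"
proof (rule ccontr)
  assume ne: "FD (\<lambda>y. FD f y v) x w \<noteq> FD (\<lambda>y. FD f y w) x v"
  define e where "e = \<bar>FD (\<lambda>y. FD f y v) x w - FD (\<lambda>y. FD f y w) x v\<bar> / 2"
  have e: "e > 0" using ne by (simp add: e_def)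
  have c: "continuous (at x) (\<lambda>y. FD (\<lambda>y. FD f y v) y w)" for v w
    using smooth_on_continuous[OF smooth_on_dir[OF smooth_on_dir[OF f]]] S x
      continuous_on_eq_continuous_at by blast
  from c[unfolded continuous_at_eps_delta, rule_format, OF e] obtain d1 d2
    where d1: "d1 > 0" "\<And>y. dist y x < d1 \<Longrightarrow> dist (FD (\<lambda>y. FD f y v) y w) (FD (\<lambda>y. FD f y v) x w) < e"
      and d2: "d2 > 0" "\<And>y. dist y x < d2 \<Longrightarrow> dist (FD (\<lambda>y. FD f y w) y v) (FD (\<lambda>y. FD f y w) x v) < e"
    by meson
  obtain d3 where d3: "d3 > 0" "ball x d3 \<subseteq> S" using S x openE by blast
  define d where "d = min d1 (min d2 d3)"
  have d: "d > 0" "d \<le> d1" "d \<le> d2" "d \<le> d3" using d1 d2 d3 by (auto simp: d_def)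
  \<comment> \<open>The side is chosen so that \<open>s * (norm v + norm w + 1) = d / 2\<close>; the
    added \<open>1\<close> keeps the denominator positive for \<open>v = w = 0\<close>.\<close>
  define s where "s = d / (2 * (norm v + norm w + 1))"
  have nn: "norm v + norm w + 1 > 0" by (smt (verit) norm_ge_zero)
  have s: "s > 0" using d nn by (simp add: s_def)
  have near: "dist (x + a *\<^sub>R v + b *\<^sub>R w) x < d" if "0 \<le> a" "a \<le> s" "0 \<le> b" "b \<le> s" for a b
  proof -
    have "norm (a *\<^sub>R v + b *\<^sub>R w) \<le> a * norm v + b * norm w"
      using norm_triangle_ineq[of "a *\<^sub>R v" "b *\<^sub>R w"] that by simp
    also have "\<dots> \<le> s * norm v + s * norm w"
      using that by (intro add_mono mult_right_mono) auto
    also have "\<dots> \<le> s * (norm v + norm w + 1)" using s by (simp add: algebra_simps)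
    also have "\<dots> = d / 2" using nn by (simp add: s_def field_simps)
    also have "\<dots> < d" using d by simp
    finally show ?thesis by (simp add: dist_norm add.assoc)
  qed
  have inS: "x + a *\<^sub>R v + b *\<^sub>R w \<in> S" "x + b *\<^sub>R w + a *\<^sub>R v \<in> S"
    if "0 \<le> a" "a \<le> s" "0 \<le> b" "b \<le> s" for a b
  proof -
    have "dist x (x + a *\<^sub>R v + b *\<^sub>R w) < d3" using near[OF that] d by (simp add: dist_commute)
    then show "x + a *\<^sub>R v + b *\<^sub>R w \<in> S" using d3 by auto
    then show "x + b *\<^sub>R w + a *\<^sub>R v \<in> S" by (simp add: algebra_simps)
  qed
  let ?X = "f (x + s *\<^sub>R v + s *\<^sub>R w) - f (x + s *\<^sub>R v) - f (x + s *\<^sub>R w) + f x"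
  obtain a b where ab: "0 \<le> a" "a \<le> s" "0 \<le> b" "b \<le> s"
    "?X = s * (s * FD (\<lambda>y. FD f y v) (x + a *\<^sub>R v + b *\<^sub>R w) w)"
    using second_difference[OF f inS(1) s] by blast
  obtain a' b' where ab': "0 \<le> a'" "a' \<le> s" "0 \<le> b'" "b' \<le> s"
    "f (x + s *\<^sub>R w + s *\<^sub>R v) - f (x + s *\<^sub>R w) - f (x + s *\<^sub>R v) + f x
      = s * (s * FD (\<lambda>y. FD f y w) (x + a' *\<^sub>R w + b' *\<^sub>R v) v)"
    using second_difference[of S f s x w v, OF f _ s] inS(2) by blast
  have "f (x + s *\<^sub>R w + s *\<^sub>R v) = f (x + s *\<^sub>R v + s *\<^sub>R w)" by (simp add: add_ac)
  then have "?X = s * (s * FD (\<lambda>y. FD f y w) (x + a' *\<^sub>R w + b' *\<^sub>R v) v)" using ab'(5) by linarith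
  \<comment> \<open>The second difference has been computed in both orders, so the two mixed
    derivatives agree at two points near \<open>x\<close>. Continuity puts them within
    \<open>e\<close>, half the gap, of two values that are \<open>2 * e\<close> apart.\<close>
  then have eq: "FD (\<lambda>y. FD f y v) (x + a *\<^sub>R v + b *\<^sub>R w) w = FD (\<lambda>y. FD f y w) (x + a' *\<^sub>R w + b' *\<^sub>R v) v"
    using ab(5) s by simp
  have "dist (x + a' *\<^sub>R w + b' *\<^sub>R v) x < d" using near[OF ab'(3,4,1,2)] by (simp add: algebra_simps)
  then have "\<bar>FD (\<lambda>y. FD f y w) (x + a' *\<^sub>R w + b' *\<^sub>R v) v - FD (\<lambda>y. FD f y w) x v\<bar> < e"
    using d2(2) d by (simp add: dist_real_def)
  moreover have "\<bar>FD (\<lambda>y. FD f y v) (x + a *\<^sub>R v + b *\<^sub>R w) w - FD (\<lambda>y. FD f y v) x w\<bar> < e"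
    using d1(2) near[OF ab(1-4)] d by (simp add: dist_real_def)
  moreover have "False" if "\<bar>p - q\<bar> < \<bar>r - q\<bar> / 2" "\<bar>p - r\<bar> < \<bar>r - q\<bar> / 2" for p q r :: real
    using that abs_triangle_ineq4[of "p - q" "p - r"] by simp
  ultimately show False using eq unfolding e_def by metis
qed

text \<open>A vector is determined by its inner products, and the inner product with a fixed
  \<open>b\<close> commutes with both differentiations, so the real case applies to each
  component.\<close>

lemma FD_symmetric:
  fixes f :: "'a::real_normed_vector \<Rightarrow> 'b::real_inner"
  assumes S: "open S" and f: "smooth_on S f" and x: "x \<in> S"
  shows "FD (\<lambda>y. FD f y v) x w = FD (\<lambda>y. FD f y w) x v"
proof -
  have 1: "FD (\<lambda>y. g y \<bullet> b) y u = FD g y u \<bullet> b" if "smooth_on S g" "y \<in> S"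
    for g :: "'a \<Rightarrow> 'b" and y b u
    using FD_eqI[OF has_derivative_inner_left[OF smooth_deriv[OF that]]] by metis
  have 2: "FD (\<lambda>y. FD (\<lambda>y. f y \<bullet> b) y v) x w = FD (\<lambda>y. FD f y v) x w \<bullet> b" for b v w
  proof -
    have "FD (\<lambda>y. FD (\<lambda>y. f y \<bullet> b) y v) x w = FD (\<lambda>y. FD f y v \<bullet> b) x w"
      using FD_cong_open[OF S x] 1[OF f] by (metis (no_types, lifting))
    also have "\<dots> = FD (\<lambda>y. FD f y v) x w \<bullet> b" using 1[OF smooth_on_dir[OF f] x] .
    finally show ?thesis .
  qed
  have "smooth_on S (\<lambda>y. f y \<bullet> b)" for b
    using smooth_on_linear[OF S bounded_linear_inner_left f] .
  then have "FD (\<lambda>y. FD f y v) x w \<bullet> b = FD (\<lambda>y. FD f y w) x v \<bullet> b" for b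
    using FD_symmetric_real[OF S _ x] 2 by metis
  then show ?thesis by (metis (no_types, lifting) vector_eq_rdot)
qed

text \<open>Sine and cosine are treated together in the induction, as each is the derivative of the
  other up to sign.\<close>

lemma smooth_on_sin: "smooth_on S (\<lambda>t::real. sin t)"
proof -
  have d: "FD sin x = (\<lambda>v. cos x * v)" "FD cos x = (\<lambda>v. - sin x * v)" for x :: real
    by (rule FD_eqI, auto intro!: derivative_eq_intros)+
  have df: "sin differentiable (at x)" "cos differentiable (at x)" for x :: real
    using DERIV_sin DERIV_cos unfolding has_field_derivative_def differentiable_def by blast+
  have "Ck_on k UNIV (sin :: real \<Rightarrow> real) \<and> Ck_on k UNIV (cos :: real \<Rightarrow> real)" for k
  proof (induction k)
    case 0
    then show ?case by (auto intro: continuous_intros)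
  next
    case (Suc k)
    have "Ck_on k UNIV (\<lambda>x. cos x * v)" "Ck_on k UNIV (\<lambda>x. - (sin x * v))" for v :: real
      using Ck_on_linear[OF _ bounded_linear_mult_left, of UNIV k cos v]
        Ck_on_linear[OF _ bounded_linear_minus[OF bounded_linear_mult_left], of UNIV k sin v] Suc
      by auto
    then show ?case by (simp add: d df)
  qed
  then show ?thesis using Ck_on_subset unfolding smooth_on_def by blast
qed

section \<open>Smooth maps between manifolds\<close>

abbreviation cinv :: "('a, 'e) chart \<Rightarrow> 'e \<Rightarrow> 'a" where
  "cinv c \<equiv> inv_into (fst c) (snd c)"

abbreviation cimg :: "('a, 'e) chart \<Rightarrow> 'e set" where
  "cimg c \<equiv> snd c ` fst c"

definition all_charts :: "('a, 'e::real_normed_vector) atlas \<Rightarrow> bool" where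
  "all_charts A \<longleftrightarrow> (\<forall>c\<in>A. is_chart c)"

text \<open>The compatibility part of \<open>smooth_manifold\<close>. In this form the condition is
  inherited by the tangent and the vertical atlas, which then enter the same coordinate lemmas as
  the given manifolds.\<close>

definition smooth_atlas :: "('a, 'e::real_inner) atlas \<Rightarrow> bool" where
  "smooth_atlas A \<longleftrightarrow> findim TYPE('e) \<and> all_charts A \<and> (\<forall>c\<in>A. \<forall>d\<in>A. smoothly_related c d)"

lemma manifold_imp_atlas: "smooth_manifold A \<Longrightarrow> smooth_atlas A"
  unfolding smooth_manifold_def smooth_atlas_def findim_def all_charts_def by blast

lemma atlas_charts: "smooth_atlas A \<Longrightarrow> all_charts A"
  unfolding smooth_atlas_def by blast

lemma atlas_findim: "smooth_atlas (A :: ('a, 'e::real_inner) atlas) \<Longrightarrow> findim TYPE('e)"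
  unfolding smooth_atlas_def by blast

lemma cinv_chart: "is_chart c \<Longrightarrow> x \<in> fst c \<Longrightarrow> cinv c (snd c x) = x"
  unfolding is_chart_def by simp

lemma chart_cinv: "u \<in> cimg c \<Longrightarrow> snd c (cinv c u) = u"
  by (rule f_inv_into_f)

lemma cinv_in: "u \<in> cimg c \<Longrightarrow> cinv c u \<in> fst c"
  by (rule inv_into_into)

lemma chart_open: "is_chart c \<Longrightarrow> open (cimg c)"
  unfolding is_chart_def by blast

lemma chart_image_eq:
  assumes "is_chart c"
  shows "snd c ` {x \<in> fst c. R x} = {u \<in> cimg c. R (cinv c u)}"
  using cinv_chart[OF assms] by force

text \<open>Domains become preimages under the inverse chart instead of images under the chart, so
  that openness can be derived by continuity.\<close>

lemma smooth_map_iff: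
  fixes A :: "('a, 'e::real_normed_vector) atlas" and B :: "('b, 'g::real_normed_vector) atlas"
  assumes "all_charts A"
  shows "smooth_map A B S f \<longleftrightarrow> S \<subseteq> carrier A \<and> f ` S \<subseteq> carrier B \<and>
     (\<forall>c\<in>A. \<forall>d\<in>B. let Q = {u \<in> cimg c. cinv c u \<in> S \<and> f (cinv c u) \<in> fst d}
        in open Q \<and> smooth_on Q (\<lambda>u. snd d (f (cinv c u))))"
proof -
  have "snd c ` {x \<in> fst c \<inter> S. f x \<in> fst d} = {u \<in> cimg c. cinv c u \<in> S \<and> f (cinv c u) \<in> fst d}"
    if "c \<in> A" for c and d :: "('b, 'g) chart"
    using chart_image_eq[of c "\<lambda>x. x \<in> S \<and> f x \<in> fst d"] assms that
    by (simp add: all_charts_def Int_def conj_assoc)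
  then show ?thesis unfolding smooth_map_def Let_def o_def by (simp cong: ball_cong)
qed

lemma smooth_map_chartD:
  assumes "all_charts A" "smooth_map A B S f" "c \<in> A" "d \<in> B"
  shows "open {u \<in> cimg c. cinv c u \<in> S \<and> f (cinv c u) \<in> fst d}"
    and "smooth_on {u \<in> cimg c. cinv c u \<in> S \<and> f (cinv c u) \<in> fst d} (\<lambda>u. snd d (f (cinv c u)))"
  using assms(2-4) unfolding smooth_map_iff[OF assms(1)] Let_def by blast+

lemma smooth_map_in: "smooth_map A B S f \<Longrightarrow> x \<in> S \<Longrightarrow> f x \<in> carrier B"
  unfolding smooth_map_def by blast

lemma smooth_map_sub: "smooth_map A B S f \<Longrightarrow> S \<subseteq> carrier A"
  unfolding smooth_map_def by blast

lemma smooth_map_cong: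
  assumes A: "all_charts A" and f: "smooth_map A B S f" and eq: "\<And>x. x \<in> S \<Longrightarrow> f x = g x"
  shows "smooth_map A B S g"
proof -
  have "open {u \<in> cimg c. cinv c u \<in> S \<and> g (cinv c u) \<in> fst d} \<and>
      smooth_on {u \<in> cimg c. cinv c u \<in> S \<and> g (cinv c u) \<in> fst d} (\<lambda>u. snd d (g (cinv c u)))"
    if "c \<in> A" "d \<in> B" for c d
  proof -
    have "{u \<in> cimg c. cinv c u \<in> S \<and> g (cinv c u) \<in> fst d}
        = {u \<in> cimg c. cinv c u \<in> S \<and> f (cinv c u) \<in> fst d}" using eq by auto
    then show ?thesis
      using smooth_map_chartD[OF A f that]
      by (auto intro!: smooth_on_cong[OF smooth_map_chartD[OF A f that]] simp: eq)
  qed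
  then show ?thesis
    using f eq unfolding smooth_map_iff[OF A] Let_def by auto
qed

text \<open>Around each point a chart \<open>b\<close> of \<open>B\<close> at \<open>f x\<close> is
  inserted, and the coordinate expression becomes a composition of two smooth functions on an open
  set \<open>W\<close>. Openness of the restricted domain is part of the result.\<close>

lemma smooth_map_compose:
  fixes A :: "('a, 'e::real_normed_vector) atlas" and B :: "('b, 'g::real_inner) atlas"
  assumes A: "all_charts A" and B: "all_charts B" and fd: "findim TYPE('g)"
    and f: "smooth_map A B S f" and g: "smooth_map B C T g"
  shows "smooth_map A C {x \<in> S. f x \<in> T} (\<lambda>x. g (f x))"
  unfolding smooth_map_iff[OF A] Let_def
proof (intro conjI ballI)
  show "{x \<in> S. f x \<in> T} \<subseteq> carrier A" using smooth_map_sub[OF f] by auto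
  show "(\<lambda>x. g (f x)) ` {x \<in> S. f x \<in> T} \<subseteq> carrier C" using smooth_map_in[OF g] by auto
  fix c d assume c: "c \<in> A" and d: "d \<in> C"
  let ?Q = "{u \<in> cimg c. cinv c u \<in> {x \<in> S. f x \<in> T} \<and> g (f (cinv c u)) \<in> fst d}"
  let ?h = "\<lambda>u. snd d (g (f (cinv c u)))"
  have loc: "\<exists>W. open W \<and> u \<in> W \<and> W \<subseteq> ?Q \<and> smooth_on W ?h" if u: "u \<in> ?Q" for u
  proof -
    have "f (cinv c u) \<in> carrier B" using u smooth_map_sub[OF g] by auto
    then obtain b where b: "b \<in> B" "f (cinv c u) \<in> fst b" unfolding carrier_def by auto
    have cb: "is_chart b" using B b unfolding all_charts_def by blast
    let ?P = "{u \<in> cimg c. cinv c u \<in> S \<and> f (cinv c u) \<in> fst b}"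
    let ?F = "\<lambda>u. snd b (f (cinv c u))"
    let ?R = "{y \<in> cimg b. cinv b y \<in> T \<and> g (cinv b y) \<in> fst d}"
    note P = smooth_map_chartD[OF A f c b(1)] and R = smooth_map_chartD[OF B g b(1) d]
    define W where "W = ?P \<inter> ?F -` ?R"
    have W: "open W"
      unfolding W_def using smooth_on_continuous[OF P(2)] P(1) R(1) by (rule continuous_open_preimage)
    have inv: "cinv b (?F w) = f (cinv c w)" if "w \<in> ?P" for w
      using that cinv_chart[OF cb] by auto
    have "u \<in> W" using u b inv unfolding W_def by auto
    moreover have "w \<in> ?Q" if "w \<in> W" for w
    proof -
      have "w \<in> ?P" "?F w \<in> ?R" using that unfolding W_def by blast+
      then show ?thesis using inv[of w] by simp
    qed
    then have sub: "W \<subseteq> ?Q" by blast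
    moreover have "smooth_on W ?h"
    proof (rule smooth_on_cong[OF W smooth_on_compose[OF fd W smooth_on_subset[OF P(2)] _ R(2)]])
      show "W \<subseteq> ?P" "?F ` W \<subseteq> ?R" unfolding W_def by auto
      show "snd d (g (cinv b (?F y))) = ?h y" if "y \<in> W" for y
        using inv that unfolding W_def by auto
    qed
    ultimately show ?thesis using W by blast
  qed
  have "\<exists>W. open W \<and> u \<in> W \<and> W \<subseteq> ?Q" if "u \<in> ?Q" for u using loc[OF that] by blast
  then show "open ?Q" by (subst open_subopen) blast
  show "smooth_on ?Q ?h" using loc by (intro smooth_on_local) blast
qed

lemma smooth_map_comp:
  fixes A :: "('a, 'e::real_normed_vector) atlas" and B :: "('b, 'g::real_inner) atlas"
  assumes "all_charts A" "all_charts B" "findim TYPE('g)"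
    "smooth_map A B S f" "smooth_map B C T g" "f ` S \<subseteq> T"
  shows "smooth_map A C S (\<lambda>x. g (f x))"
proof -
  have "{x \<in> S. f x \<in> T} = S" using assms(6) by auto
  then show ?thesis using smooth_map_compose[OF assms(1-5)] by simp
qed

section \<open>The standard atlas, open sets and charts as smooth maps\<close>

lemma std_charts [simp]: "all_charts standard_atlas"
  unfolding all_charts_def standard_atlas_def is_chart_def by simp

lemma smooth_map_from_standard:
  "smooth_map standard_atlas B S f \<longleftrightarrow> f ` S \<subseteq> carrier B \<and>
     (\<forall>d\<in>B. open {u \<in> S. f u \<in> fst d} \<and> smooth_on {u \<in> S. f u \<in> fst d} (\<lambda>u. snd d (f u)))"
  unfolding smooth_map_iff[OF std_charts]
  by (simp add: standard_atlas_def carrier_def Let_def)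

lemma smooth_map_to_standard:
  assumes "all_charts A"
  shows "smooth_map A standard_atlas S f \<longleftrightarrow> S \<subseteq> carrier A \<and>
     (\<forall>c\<in>A. open {u \<in> cimg c. cinv c u \<in> S} \<and>
        smooth_on {u \<in> cimg c. cinv c u \<in> S} (\<lambda>u. f (cinv c u)))"
  unfolding smooth_map_iff[OF assms]
  by (simp add: standard_atlas_def carrier_def Let_def)

lemma smooth_map_standard: "smooth_map standard_atlas standard_atlas S f \<longleftrightarrow> open S \<and> smooth_on S f"
  unfolding smooth_map_from_standard by (simp add: standard_atlas_def carrier_def)

lemma openin_atlas:
  assumes "all_charts A"
  shows "openin (atlas_topology A) S \<longleftrightarrow> S \<subseteq> carrier A \<and> (\<forall>c\<in>A. open (snd c ` (S \<inter> fst c)))"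
  using istopology_atlas[of A] assms unfolding all_charts_def atlas_topology_def
  by (simp add: topology_inverse')

text \<open>The open coordinate domains for the pairs \<open>(c, d)\<close>, united over all
  \<open>d\<close>, exhaust the part of \<open>S\<close> seen in \<open>c\<close>, as
  \<open>f\<close> maps \<open>S\<close> into the carrier.\<close>

lemma smooth_map_openin:
  assumes A: "all_charts A" and f: "smooth_map A B S f"
  shows "openin (atlas_topology A) S"
  unfolding openin_atlas[OF A]
proof (intro conjI ballI)
  show "S \<subseteq> carrier A" using smooth_map_sub[OF f] .
  fix c assume c: "c \<in> A"
  then have ch: "is_chart c" using A unfolding all_charts_def by blast
  have "snd c ` (S \<inter> fst c) = {u \<in> cimg c. cinv c u \<in> S}"
    using chart_image_eq[OF ch, of "\<lambda>x. x \<in> S"] by (simp add: Int_def conj_commute)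
  also have "\<dots> = (\<Union>d\<in>B. {u \<in> cimg c. cinv c u \<in> S \<and> f (cinv c u) \<in> fst d})"
    using smooth_map_in[OF f] unfolding carrier_def by fastforce
  finally show "open (snd c ` (S \<inter> fst c))"
    using smooth_map_chartD(1)[OF A f c] by auto
qed

lemma chart_in_max:
  assumes "smooth_atlas A" "c \<in> A"
  shows "c \<in> maximal_atlas A"
  using assms unfolding smooth_atlas_def maximal_atlas_def all_charts_def carrier_def by auto

lemma max_chart: "c \<in> maximal_atlas A \<Longrightarrow> is_chart c"
  unfolding maximal_atlas_def by blast

lemma smooth_map_chart:
  assumes A: "all_charts A" and c: "c \<in> maximal_atlas A"
  shows "smooth_map A standard_atlas (fst c) (snd c)"
  unfolding smooth_map_to_standard[OF A]
proof (intro conjI ballI)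
  show "fst c \<subseteq> carrier A" using c unfolding maximal_atlas_def by blast
  fix d assume d: "d \<in> A"
  then have "is_chart d" using A unfolding all_charts_def by blast
  then have "snd d ` (fst d \<inter> fst c) = {u \<in> cimg d. cinv d u \<in> fst c}"
    using chart_image_eq[of d "\<lambda>x. x \<in> fst c"] by (simp add: Int_def)
  moreover have "smoothly_related d c" using c d unfolding maximal_atlas_def by blast
  ultimately show "open {u \<in> cimg d. cinv d u \<in> fst c}"
    "smooth_on {u \<in> cimg d. cinv d u \<in> fst c} (\<lambda>u. snd c (cinv d u))"
    unfolding smoothly_related_def o_def by auto
qed

lemma smooth_map_cinv:
  assumes c: "c \<in> maximal_atlas A"
  shows "smooth_map standard_atlas A (cimg c) (cinv c)"
  unfolding smooth_map_from_standard
proof (intro conjI ballI)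
  have ch: "is_chart c" using max_chart[OF c] .
  show "cinv c ` cimg c \<subseteq> carrier A"
    using c cinv_in[of _ c] unfolding maximal_atlas_def by blast
  fix d assume d: "d \<in> A"
  have "snd c ` (fst c \<inter> fst d) = {u \<in> cimg c. cinv c u \<in> fst d}"
    using chart_image_eq[OF ch, of "\<lambda>x. x \<in> fst d"] by (simp add: Int_def)
  moreover have "smoothly_related c d" using c d unfolding maximal_atlas_def by blast
  ultimately show "open {u \<in> cimg c. cinv c u \<in> fst d}"
    "smooth_on {u \<in> cimg c. cinv c u \<in> fst d} (\<lambda>u. snd d (cinv c u))"
    unfolding smoothly_related_def o_def by auto
qed

text \<open>Serves as a restriction operator: restricting a smooth map to an open set, or to the
  preimage of an open set, is composition with this identity.\<close>

lemma smooth_map_ident: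
  assumes A: "smooth_atlas A" and S: "openin (atlas_topology A) S"
  shows "smooth_map A A S (\<lambda>x. x)"
proof -
  note ac = atlas_charts[OF A]
  have "open {u \<in> cimg c. cinv c u \<in> S \<and> cinv c u \<in> fst d} \<and>
     smooth_on {u \<in> cimg c. cinv c u \<in> S \<and> cinv c u \<in> fst d} (\<lambda>u. snd d (cinv c u))"
    if c: "c \<in> A" and d: "d \<in> A" for c d
  proof -
    have ch: "is_chart c" using ac c unfolding all_charts_def by blast
    have 1: "snd c ` (S \<inter> fst c) = {u \<in> cimg c. cinv c u \<in> S}"
      using chart_image_eq[OF ch, of "\<lambda>x. x \<in> S"] by (simp add: Int_def conj_commute)
    note 2 = smooth_map_cinv[OF chart_in_max[OF A c], unfolded smooth_map_from_standard, THEN conjunct2, rule_format, OF d]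
    have "{u \<in> cimg c. cinv c u \<in> S \<and> cinv c u \<in> fst d}
        = {u \<in> cimg c. cinv c u \<in> S} \<inter> {u \<in> cimg c. cinv c u \<in> fst d}" by blast
    moreover have "open {u \<in> cimg c. cinv c u \<in> S}"
      using S c unfolding openin_atlas[OF ac] 1[symmetric] by blast
    ultimately show ?thesis
      using 2 by (auto intro: smooth_on_subset)
  qed
  then show ?thesis
    using S unfolding smooth_map_iff[OF ac] Let_def openin_atlas[OF ac] by auto
qed

lemma smooth_map_preimage:
  fixes B :: "('b, 'g::real_inner) atlas"
  assumes A: "all_charts A" and B: "smooth_atlas B"
    and f: "smooth_map A B S f" and T: "openin (atlas_topology B) T"
  shows "smooth_map A B {x \<in> S. f x \<in> T} f"
  using smooth_map_compose[OF A atlas_charts[OF B] atlas_findim[OF B] f smooth_map_ident[OF B T]] .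

lemma smooth_map_restrict:
  assumes A: "smooth_atlas A" and f: "smooth_map A B S f"
    and T: "openin (atlas_topology A) T" "T \<subseteq> S"
  shows "smooth_map A B T f"
proof -
  have "{x \<in> T. x \<in> S} = T" using T(2) by auto
  then show ?thesis
    using smooth_map_compose[OF atlas_charts[OF A] atlas_charts[OF A] atlas_findim[OF A]
        smooth_map_ident[OF A T(1)] f] by simp
qed

lemma smooth_atlas_standard: "findim TYPE('e) \<Longrightarrow> smooth_atlas (standard_atlas :: ('e::real_inner, 'e) atlas)"
  unfolding smooth_atlas_def using std_charts
  by (simp add: standard_atlas_def smoothly_related_def o_def smooth_on_ident)

lemma openin_standard: "openin (atlas_topology (standard_atlas :: ('e::real_normed_vector, 'e) atlas)) S \<longleftrightarrow> open S"
  unfolding openin_atlas[OF std_charts] by (simp add: standard_atlas_def carrier_def)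

lemma openin_chart_preimage:
  fixes A :: "('a, 'e::real_inner) atlas"
  assumes A: "smooth_atlas A" and c: "c \<in> maximal_atlas A" and V: "open V"
  shows "openin (atlas_topology A) {x \<in> fst c. snd c x \<in> V}"
  using smooth_map_openin[OF atlas_charts[OF A] smooth_map_preimage[OF atlas_charts[OF A]
    smooth_atlas_standard[OF atlas_findim[OF A]] smooth_map_chart[OF atlas_charts[OF A] c]]] V
  unfolding openin_standard by blast

lemma openin_chart_domain:
  assumes "smooth_atlas A" "c \<in> maximal_atlas A"
  shows "openin (atlas_topology A) (fst c)"
  using smooth_map_openin[OF atlas_charts[OF assms(1)] smooth_map_chart[OF atlas_charts[OF assms(1)] assms(2)]] .

lemma open_chart_image:
  fixes A :: "('a, 'e::real_inner) atlas"
  assumes A: "smooth_atlas A" and c: "c \<in> maximal_atlas A" and V: "openin (atlas_topology A) V"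
  shows "open {u \<in> cimg c. cinv c u \<in> V}"
  using smooth_map_openin[OF std_charts smooth_map_preimage[OF std_charts A smooth_map_cinv[OF c] V]]
  unfolding openin_standard .

text \<open>Smoothness is defined through the atlas itself, but adapted charts belong to the maximal
  atlas. Composing with the smooth maps \<open>cinv c\<close> and \<open>snd d\<close> transfers it
  to all compatible charts.\<close>

lemma local_rep:
  assumes A: "smooth_atlas A" and B: "smooth_atlas B" and f: "smooth_map A B S f"
    and c: "c \<in> maximal_atlas A" and d: "d \<in> maximal_atlas B"
  shows "open {u \<in> cimg c. cinv c u \<in> S \<and> f (cinv c u) \<in> fst d}"
    and "smooth_on {u \<in> cimg c. cinv c u \<in> S \<and> f (cinv c u) \<in> fst d} (\<lambda>u. snd d (f (cinv c u)))"
proof -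
  note ac = atlas_charts[OF A] and bc = atlas_charts[OF B]
  have 1: "smooth_map standard_atlas B {u \<in> cimg c. cinv c u \<in> S} (\<lambda>u. f (cinv c u))"
    using smooth_map_compose[OF std_charts ac atlas_findim[OF A] smooth_map_cinv[OF c] f] .
  have 2: "smooth_map standard_atlas standard_atlas
      {u \<in> {u \<in> cimg c. cinv c u \<in> S}. f (cinv c u) \<in> fst d} (\<lambda>u. snd d (f (cinv c u)))"
    using smooth_map_compose[OF std_charts bc atlas_findim[OF B] 1 smooth_map_chart[OF bc d]] .
  show "open {u \<in> cimg c. cinv c u \<in> S \<and> f (cinv c u) \<in> fst d}"
    and "smooth_on {u \<in> cimg c. cinv c u \<in> S \<and> f (cinv c u) \<in> fst d} (\<lambda>u. snd d (f (cinv c u)))"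
    using 2 unfolding smooth_map_standard by (simp_all add: conj_assoc)
qed

lemma carrier_chart:
  assumes "smooth_atlas A" "x \<in> carrier A"
  obtains c where "c \<in> A" "c \<in> maximal_atlas A" "x \<in> fst c"
  using assms chart_in_max[OF assms(1)] unfolding carrier_def by blast

section \<open>Tangent vectors in coordinates\<close>

abbreviation cvel :: "('a, 'e::real_normed_vector) chart \<Rightarrow> (real \<Rightarrow> 'a) \<Rightarrow> 'e" where
  "cvel c \<gamma> \<equiv> vector_derivative (\<lambda>t. snd c (\<gamma> t)) (at 0)"

text \<open>The tangent vector with coordinates \<open>(u, \<xi>)\<close> in \<open>c\<close>. The
  straight line may leave the chart image, where \<open>cinv c\<close> is arbitrary, but only its
  germ at \<open>0\<close> matters.\<close>

definition tvec :: "('a, 'e::real_normed_vector) atlas \<Rightarrow> ('a, 'e) chart \<Rightarrow> 'e \<Rightarrow> 'e \<Rightarrow> 'a tangent" where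
  "tvec A c u \<xi> = velocity A (\<lambda>t. cinv c (u + t *\<^sub>R \<xi>))"

lemma smooth_curve_chart:
  assumes A: "smooth_atlas A" and \<gamma>: "smooth_curve A \<gamma>" and c: "c \<in> maximal_atlas A" "\<gamma> 0 \<in> fst c"
  obtains N where "open N" "0 \<in> N" "\<And>t. t \<in> N \<Longrightarrow> \<gamma> t \<in> fst c" "smooth_on N (\<lambda>t. snd c (\<gamma> t))"
proof -
  note ac = atlas_charts[OF A]
  obtain N where N: "0 \<in> N" "smooth_map standard_atlas A N \<gamma>" using \<gamma> unfolding smooth_curve_def by blast
  have "smooth_map standard_atlas standard_atlas {t \<in> N. \<gamma> t \<in> fst c} (\<lambda>t. snd c (\<gamma> t))"
    using smooth_map_compose[OF std_charts ac atlas_findim[OF A] N(2) smooth_map_chart[OF ac c(1)]] .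
  then have 1: "open {t \<in> N. \<gamma> t \<in> fst c}" and 2: "smooth_on {t \<in> N. \<gamma> t \<in> fst c} (\<lambda>t. snd c (\<gamma> t))"
    unfolding smooth_map_standard by blast+
  show ?thesis by (rule that[OF 1 _ _ 2]) (use N c in auto)
qed

lemma smooth_curve_carrier: "smooth_curve A \<gamma> \<Longrightarrow> \<gamma> 0 \<in> carrier A"
  unfolding smooth_curve_def using smooth_map_in[of standard_atlas A _ \<gamma> 0] by auto

lemma smooth_curve_compose:
  fixes A :: "('a, 'e::real_inner) atlas"
  assumes A: "smooth_atlas A" and \<gamma>: "smooth_curve A \<gamma>" and f: "smooth_map A B S f" "\<gamma> 0 \<in> S"
  shows "smooth_curve B (\<lambda>t. f (\<gamma> t))"
proof -
  obtain N where N: "0 \<in> N" "smooth_map standard_atlas A N \<gamma>" using \<gamma> unfolding smooth_curve_def by blast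
  have "smooth_map standard_atlas B {t \<in> N. \<gamma> t \<in> S} (\<lambda>t. f (\<gamma> t))"
    using smooth_map_compose[OF std_charts atlas_charts[OF A] atlas_findim[OF A] N(2) f(1)] .
  then show ?thesis unfolding smooth_curve_def using N f(2) by (intro exI[of _ "{t \<in> N. \<gamma> t \<in> S}"]) simp
qed

lemma smooth_curveI:
  assumes c: "c \<in> maximal_atlas A" and A: "smooth_atlas A"
    and N: "open N" "0 \<in> N" and u: "smooth_on N u" "u ` N \<subseteq> cimg c"
    and eq: "\<And>t. t \<in> N \<Longrightarrow> \<gamma> t = cinv c (u t)"
  shows "smooth_curve A \<gamma>"
proof -
  have "smooth_map standard_atlas A N (\<lambda>t. cinv c (u t))"
    using smooth_map_comp[OF std_charts std_charts atlas_findim[OF A]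
        conjI[OF N(1) u(1), folded smooth_map_standard] smooth_map_cinv[OF c] u(2)] .
  then have "smooth_map standard_atlas A N \<gamma>"
    by (rule smooth_map_cong[OF std_charts]) (simp add: eq)
  then show ?thesis unfolding smooth_curve_def using N by blast
qed

lemma curve_deriv:
  assumes A: "smooth_atlas A" and \<gamma>: "smooth_curve A \<gamma>" and c: "c \<in> maximal_atlas A" "\<gamma> 0 \<in> fst c"
  shows "((\<lambda>t. snd c (\<gamma> t)) has_vector_derivative cvel c \<gamma>) (at 0)"
proof -
  obtain N where N: "open N" "0 \<in> N" "\<And>t. t \<in> N \<Longrightarrow> \<gamma> t \<in> fst c" "smooth_on N (\<lambda>t. snd c (\<gamma> t))"
    using smooth_curve_chart[OF A \<gamma> c] by blast
  then have "(\<lambda>t. snd c (\<gamma> t)) differentiable (at 0)" using smooth_on_iff by blast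
  then show ?thesis using vector_derivative_works by blast
qed

lemma curve_deriv_function:
  assumes A: "smooth_atlas A" and \<gamma>: "smooth_curve A \<gamma>" and c: "c \<in> maximal_atlas A" "\<gamma> 0 \<in> fst c"
    and h: "((\<lambda>u. h (cinv c u)) has_derivative L) (at (snd c (\<gamma> 0)))"
  shows "((\<lambda>t. h (\<gamma> t)) has_vector_derivative L (cvel c \<gamma>)) (at 0)"
proof -
  obtain N where N: "open N" "0 \<in> N" "\<And>t. t \<in> N \<Longrightarrow> \<gamma> t \<in> fst c" "smooth_on N (\<lambda>t. snd c (\<gamma> t))"
    using smooth_curve_chart[OF A \<gamma> c] by blast
  have "((\<lambda>t. h (cinv c (snd c (\<gamma> t)))) has_derivative (\<lambda>t. L (t *\<^sub>R cvel c \<gamma>))) (at 0)"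
    using has_derivative_compose[OF curve_deriv[OF A \<gamma> c, unfolded has_vector_derivative_def] h] .
  moreover have "L (t *\<^sub>R cvel c \<gamma>) = t *\<^sub>R L (cvel c \<gamma>)" for t
    using has_derivative_linear[OF h] by (simp add: linear_cmul)
  ultimately have "((\<lambda>t. h (cinv c (snd c (\<gamma> t)))) has_vector_derivative L (cvel c \<gamma>)) (at 0)"
    unfolding has_vector_derivative_def by simp
  then show ?thesis
    by (rule has_vector_derivative_transform_within_open[OF _ N(1,2)])
      (simp add: N(3) cinv_chart[OF max_chart[OF c(1)]])
qed

lemma transition_deriv:
  assumes A: "smooth_atlas A" and c: "c \<in> maximal_atlas A" and d: "d \<in> maximal_atlas A"
    and u: "u \<in> cimg c" "cinv c u \<in> fst d"
  shows "((\<lambda>u. snd d (cinv c u)) has_derivative FD (\<lambda>u. snd d (cinv c u)) u) (at u)"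
proof -
  have "smooth_on {u \<in> cimg c. cinv c u \<in> fst c \<and> cinv c u \<in> fst d} (\<lambda>u. snd d (cinv c u))"
    using local_rep(2)[OF A A smooth_map_ident[OF A openin_chart_domain[OF A c]] c d] .
  then show ?thesis by (rule smooth_deriv) (use u cinv_in[OF u(1)] in simp)
qed

text \<open>\<open>velocity\<close> compares two curves in all atlas charts at the point. One chart
  of the maximal atlas is enough: by the chain rule, equal coordinate velocities remain equal after
  a transition map.\<close>

lemma mem_velocity:
  assumes A: "smooth_atlas A" and \<gamma>: "smooth_curve A \<gamma>" and c: "c \<in> maximal_atlas A" "\<gamma> 0 \<in> fst c"
  shows "\<sigma> \<in> velocity A \<gamma> \<longleftrightarrow> smooth_curve A \<sigma> \<and> \<sigma> 0 = \<gamma> 0 \<and> cvel c \<sigma> = cvel c \<gamma>"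
proof -
  have change: "cvel d \<sigma> = cvel d \<gamma>"
    if "smooth_curve A \<sigma>" "\<sigma> 0 = \<gamma> 0" "cvel c \<sigma> = cvel c \<gamma>" "c \<in> maximal_atlas A" "d \<in> maximal_atlas A"
      "\<gamma> 0 \<in> fst c" "\<gamma> 0 \<in> fst d" for c d
  proof -
    have dd: "((\<lambda>u. snd d (cinv c u)) has_derivative FD (\<lambda>u. snd d (cinv c u)) (snd c (\<gamma> 0))) (at (snd c (\<gamma> 0)))"
      using that by (intro transition_deriv[OF A]) (auto simp: cinv_chart[OF max_chart])
    note tr = curve_deriv_function[where h = "snd d", OF A _ that(4)]
    from tr[OF \<gamma> that(6) dd] tr[OF that(1), unfolded that(2), OF that(6) dd]
    show ?thesis using that(3) by (metis vector_derivative_at)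
  qed
  obtain d where d: "d \<in> A" "d \<in> maximal_atlas A" "\<gamma> 0 \<in> fst d"
    using carrier_chart[OF A smooth_curve_carrier[OF \<gamma>]] by blast
  show ?thesis
  proof
    assume "\<sigma> \<in> velocity A \<gamma>"
    then have h: "smooth_curve A \<sigma>" "\<sigma> 0 = \<gamma> 0" "cvel d \<sigma> = cvel d \<gamma>"
      using d unfolding velocity_def charts_at_def o_def by blast+
    then show "smooth_curve A \<sigma> \<and> \<sigma> 0 = \<gamma> 0 \<and> cvel c \<sigma> = cvel c \<gamma>"
      using change[OF h d(2) c(1) d(3) c(2)] by blast
  next
    assume "smooth_curve A \<sigma> \<and> \<sigma> 0 = \<gamma> 0 \<and> cvel c \<sigma> = cvel c \<gamma>"
    then show "\<sigma> \<in> velocity A \<gamma>"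
      using change[OF _ _ _ c(1) chart_in_max[OF A] c(2)] unfolding velocity_def charts_at_def o_def by auto
  qed
qed

lemma velocity_eq_iff:
  assumes A: "smooth_atlas A" and \<gamma>: "smooth_curve A \<gamma>" and \<sigma>: "smooth_curve A \<sigma>"
    and c: "c \<in> maximal_atlas A" "\<gamma> 0 \<in> fst c"
  shows "velocity A \<gamma> = velocity A \<sigma> \<longleftrightarrow> \<gamma> 0 = \<sigma> 0 \<and> cvel c \<gamma> = cvel c \<sigma>"
proof
  assume "velocity A \<gamma> = velocity A \<sigma>"
  moreover have "\<sigma> \<in> velocity A \<sigma>" using \<sigma> unfolding velocity_def by auto
  ultimately show "\<gamma> 0 = \<sigma> 0 \<and> cvel c \<gamma> = cvel c \<sigma>" using mem_velocity[OF A \<gamma> c] by auto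
next
  assume h: "\<gamma> 0 = \<sigma> 0 \<and> cvel c \<gamma> = cvel c \<sigma>"
  then have "\<sigma> 0 \<in> fst c" using c by simp
  then show "velocity A \<gamma> = velocity A \<sigma>"
    using mem_velocity[OF A \<gamma> c] mem_velocity[OF A \<sigma> c(1)] h by auto
qed

text \<open>\<open>vector_derivative\<close> is a choice that agrees for functions with the same
  germ, so the curves may be arbitrary. This later permits replacing a vertical section by a
  variation that equals it only near one point.\<close>

lemma velocity_cong:
  assumes "eventually (\<lambda>t. \<gamma> t = \<sigma> t) (nhds (0::real))"
  shows "velocity A \<gamma> = velocity A \<sigma>"
proof -
  obtain N where N: "open N" "0 \<in> N" "\<And>t. t \<in> N \<Longrightarrow> \<gamma> t = \<sigma> t"
    using assms unfolding eventually_nhds by blast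
  have "((\<lambda>t. snd c (\<gamma> t)) has_vector_derivative D) (at 0) \<longleftrightarrow> ((\<lambda>t. snd c (\<sigma> t)) has_vector_derivative D) (at 0)"
    for c :: "('a, 'b) chart" and D
    using has_vector_derivative_transform_within_open[OF _ N(1,2), of "\<lambda>t. snd c (\<gamma> t)" D "\<lambda>t. snd c (\<sigma> t)"]
      has_vector_derivative_transform_within_open[OF _ N(1,2), of "\<lambda>t. snd c (\<sigma> t)" D "\<lambda>t. snd c (\<gamma> t)"] N(3) by auto
  then have "cvel c \<gamma> = cvel c \<sigma>" for c :: "('a, 'b) chart" unfolding vector_derivative_def by presburger
  then show ?thesis unfolding velocity_def o_def using N by simp
qed

lemma straight_curve:
  fixes A :: "('a, 'e::real_inner) atlas"
  assumes A: "smooth_atlas A" and c: "c \<in> maximal_atlas A" and u: "u \<in> cimg c"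
  shows "smooth_curve A (\<lambda>t. cinv c (u + t *\<^sub>R \<xi>))" and "cvel c (\<lambda>t. cinv c (u + t *\<^sub>R \<xi>)) = \<xi>"
proof -
  have "open ((\<lambda>t. u + t *\<^sub>R \<xi>) -` cimg c)"
    by (intro open_vimage chart_open max_chart[OF c] continuous_intros)
  moreover define N where "N = (\<lambda>t. u + t *\<^sub>R \<xi>) -` cimg c"
  ultimately have N: "open N" "0 \<in> N" using u by auto
  have s: "smooth_on N (\<lambda>t. u + t *\<^sub>R \<xi>)"
    by (intro smooth_on_add smooth_on_scaleR smooth_on_const smooth_on_ident N)
  show "smooth_curve A (\<lambda>t. cinv c (u + t *\<^sub>R \<xi>))"
    by (rule smooth_curveI[OF c A N s]) (auto simp: N_def)
  have "((\<lambda>t. u + t *\<^sub>R \<xi>) has_vector_derivative \<xi>) (at 0)"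
    unfolding has_vector_derivative_def by (auto intro!: derivative_eq_intros)
  then have "((\<lambda>t. snd c (cinv c (u + t *\<^sub>R \<xi>))) has_vector_derivative \<xi>) (at 0)"
    by (rule has_vector_derivative_transform_within_open[OF _ N]) (auto simp: N_def chart_cinv)
  then show "cvel c (\<lambda>t. cinv c (u + t *\<^sub>R \<xi>)) = \<xi>" by (rule vector_derivative_at)
qed

lemma velocity_eq_tvec:
  assumes A: "smooth_atlas A" and \<gamma>: "smooth_curve A \<gamma>" and c: "c \<in> maximal_atlas A" "\<gamma> 0 \<in> fst c"
  shows "velocity A \<gamma> = tvec A c (snd c (\<gamma> 0)) (cvel c \<gamma>)"
proof -
  have u: "snd c (\<gamma> 0) \<in> cimg c" using c by blast
  show ?thesis unfolding tvec_def
    using velocity_eq_iff[OF A \<gamma> straight_curve(1)[OF A c(1) u] c] straight_curve(2)[OF A c(1) u]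
      cinv_chart[OF max_chart[OF c(1)] c(2)] by simp
qed

text \<open>The standard way of evaluating a velocity below: express the curve in a chart near
  \<open>0\<close> and differentiate the coordinate curve.\<close>

lemma velocity_eqI:
  assumes A: "smooth_atlas A" and c: "c \<in> maximal_atlas A"
    and N: "open N" "0 \<in> N" and w: "smooth_on N w" "w ` N \<subseteq> cimg c"
    and eq: "\<And>t. t \<in> N \<Longrightarrow> \<gamma> t = cinv c (w t)" and d: "(w has_vector_derivative \<xi>) (at 0)"
  shows "velocity A \<gamma> = tvec A c (w 0) \<xi>"
proof -
  have sc: "smooth_curve A \<gamma>" using smooth_curveI[OF c A N w eq] .
  have w': "snd c (\<gamma> t) = w t" if "t \<in> N" for t
    using eq[OF that] w(2) that chart_cinv by (metis image_subset_iff)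
  have "((\<lambda>t. snd c (\<gamma> t)) has_vector_derivative \<xi>) (at 0)"
    by (rule has_vector_derivative_transform_within_open[OF d N]) (simp add: w')
  then have "cvel c \<gamma> = \<xi>" by (rule vector_derivative_at)
  moreover have "\<gamma> 0 \<in> fst c" using eq[OF N(2)] w(2) N(2) cinv_in by (metis image_subset_iff)
  ultimately show ?thesis using velocity_eq_tvec[OF A sc c] w'[OF N(2)] by simp
qed

lemma rep_velocity:
  assumes "smooth_curve A \<gamma>"
  shows "rep (velocity A \<gamma>) \<in> velocity A \<gamma>"
proof -
  have "\<gamma> \<in> velocity A \<gamma>" using assms unfolding velocity_def by auto
  then show ?thesis unfolding rep_def by (rule someI[of "\<lambda>\<gamma>'. \<gamma>' \<in> velocity A \<gamma>"])
qed

lemma base_velocity: "smooth_curve A \<gamma> \<Longrightarrow> base (velocity A \<gamma>) = \<gamma> 0"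
  using rep_velocity unfolding base_def velocity_def by blast

lemma
  assumes A: "smooth_atlas A" and c: "c \<in> maximal_atlas A" and u: "u \<in> cimg c"
  shows smooth_curve_rep_tvec: "smooth_curve A (rep (tvec A c u \<xi>))"
    and rep_tvec_0: "rep (tvec A c u \<xi>) 0 = cinv c u"
    and cvel_rep_tvec: "cvel c (rep (tvec A c u \<xi>)) = \<xi>"
    and base_tvec: "base (tvec A c u \<xi>) = cinv c u"
proof -
  note s = straight_curve[OF A c u, of \<xi>]
  have "cinv c (u + 0 *\<^sub>R \<xi>) \<in> fst c" using cinv_in[OF u] by simp
  from rep_velocity[OF s(1), unfolded mem_velocity[OF A s(1) c this] s(2)]
  show "smooth_curve A (rep (tvec A c u \<xi>))" "rep (tvec A c u \<xi>) 0 = cinv c u"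
    "cvel c (rep (tvec A c u \<xi>)) = \<xi>"
    unfolding tvec_def by auto
  then show "base (tvec A c u \<xi>) = cinv c u" unfolding base_def by simp
qed

lemma deriv_along_tvec:
  assumes A: "smooth_atlas A" and c: "c \<in> maximal_atlas A" and u: "u \<in> cimg c"
    and h: "((\<lambda>u. h (cinv c u)) has_derivative L) (at u)"
  shows "deriv_along (tvec A c u \<xi>) h = L \<xi>"
  using curve_deriv_function[OF A smooth_curve_rep_tvec[OF A c u, of \<xi>] c, of h L]
    rep_tvec_0[OF A c u, of \<xi>] cvel_rep_tvec[OF A c u, of \<xi>] cinv_in[OF u] chart_cinv[OF u] h
  unfolding deriv_along_def o_def by (simp add: vector_derivative_at)

lemma deriv_along_tvec_self:
  assumes A: "smooth_atlas A" and c: "c \<in> maximal_atlas A" and u: "u \<in> cimg c"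
  shows "deriv_along (tvec A c u \<xi>) (snd c) = \<xi>"
  using cvel_rep_tvec[OF A c u] unfolding deriv_along_def o_def .

lemma tvec_eq_iff:
  assumes A: "smooth_atlas A" and c: "c \<in> maximal_atlas A" and u: "u \<in> cimg c" "u' \<in> cimg c"
  shows "tvec A c u \<xi> = tvec A c u' \<xi>' \<longleftrightarrow> u = u' \<and> \<xi> = \<xi>'"
  using base_tvec[OF A c u(1), of \<xi>] base_tvec[OF A c u(2), of \<xi>'] chart_cinv[OF u(1)] chart_cinv[OF u(2)]
    deriv_along_tvec_self[OF A c u(1), of \<xi>] deriv_along_tvec_self[OF A c u(2), of \<xi>'] by metis

lemma tvec_in_tspace:
  assumes A: "smooth_atlas A" and c: "c \<in> maximal_atlas A" and u: "u \<in> cimg c"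
  shows "tvec A c u \<xi> \<in> tangent_space A (cinv c u)"
  unfolding tangent_space_def tvec_def using straight_curve(1)[OF A c u, of \<xi>] by force

lemma tspace_eq_tvec:
  assumes A: "smooth_atlas A" and c: "c \<in> maximal_atlas A" "p \<in> fst c" and v: "v \<in> tangent_space A p"
  shows "v = tvec A c (snd c p) (deriv_along v (snd c))" and "base v = p"
proof -
  obtain \<gamma> where \<gamma>: "v = velocity A \<gamma>" "smooth_curve A \<gamma>" "\<gamma> 0 = p"
    using v unfolding tangent_space_def by blast
  have u: "snd c p \<in> cimg c" using c by blast
  have "v = tvec A c (snd c p) (cvel c \<gamma>)" using velocity_eq_tvec[OF A \<gamma>(2) c(1)] \<gamma> c by simp
  then show "v = tvec A c (snd c p) (deriv_along v (snd c))"
    using deriv_along_tvec_self[OF A c(1) u] by metis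
  show "base v = p" using base_velocity[OF \<gamma>(2)] \<gamma> by simp
qed

lemma tangent_space_base:
  assumes "v \<in> tangent_space A p" shows "base v = p"
  using assms base_velocity unfolding tangent_space_def by auto

lemma tangent_bundle_base: "v \<in> tangent_bundle A \<longleftrightarrow> base v \<in> carrier A \<and> v \<in> tangent_space A (base v)"
  unfolding tangent_bundle_def using tangent_space_base[of v A] by (metis UN_E UN_I)

text \<open>Prescribed components are consistent when they come from one vector by transition
  derivatives. Uniqueness holds because the component in a single atlas chart already determines the
  vector.\<close>

lemma tangent_with_coords_tvec:
  assumes A: "smooth_atlas A" and c: "c \<in> maximal_atlas A" and u: "u \<in> cimg c"
    and k: "\<And>d. d \<in> charts_at A (cinv c u) \<Longrightarrow> k d = FD (\<lambda>u. snd d (cinv c u)) u \<xi>"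
  shows "tangent_with_coords A (cinv c u) k = tvec A c u \<xi>"
proof -
  have da: "deriv_along (tvec A c u \<zeta>) (snd d) = FD (\<lambda>u. snd d (cinv c u)) u \<zeta>"
    if "d \<in> charts_at A (cinv c u)" for d \<zeta>
    using that chart_in_max[OF A] unfolding charts_at_def
    by (intro deriv_along_tvec[OF A c u] transition_deriv[OF A c _ u]) auto
  show ?thesis unfolding tangent_with_coords_def
  proof (rule the_equality)
    show "tvec A c u \<xi> \<in> tangent_space A (cinv c u) \<and>
      (\<forall>d\<in>charts_at A (cinv c u). deriv_along (tvec A c u \<xi>) (snd d) = k d)"
      using tvec_in_tspace[OF A c u] da k by simp
    fix w assume w: "w \<in> tangent_space A (cinv c u) \<and> (\<forall>d\<in>charts_at A (cinv c u). deriv_along w (snd d) = k d)"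
    have "cinv c u \<in> carrier A" using smooth_map_in[OF smooth_map_cinv[OF c] u] .
    then obtain d where d: "d \<in> A" "d \<in> maximal_atlas A" "cinv c u \<in> fst d" by (rule carrier_chart[OF A])
    then have d': "d \<in> charts_at A (cinv c u)" unfolding charts_at_def by simp
    have "w = tvec A d (snd d (cinv c u)) (k d)"
      using tspace_eq_tvec(1)[OF A d(2,3) conjunct1[OF w]] w d' by simp
    moreover have "tvec A c u \<xi> = tvec A d (snd d (cinv c u)) (k d)"
      using tspace_eq_tvec(1)[OF A d(2,3) tvec_in_tspace[OF A c u]] da[OF d'] k[OF d'] by simp
    ultimately show "w = tvec A c u \<xi>" by simp
  qed
qed

text \<open>Transition derivatives are linear, so adding or scaling components in every chart at
  once is the same as doing it in the single chart \<open>c\<close>.\<close>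

lemma
  assumes A: "smooth_atlas A" and c: "c \<in> maximal_atlas A" and u: "u \<in> cimg c"
  shows tadd_tvec: "tadd A (tvec A c u \<xi>) (tvec A c u \<eta>) = tvec A c u (\<xi> + \<eta>)"
    and tscale_tvec: "tscale A r (tvec A c u \<xi>) = tvec A c u (r *\<^sub>R \<xi>)"
    and tdiff_tvec: "tdiff A (tvec A c u \<xi>) (tvec A c u \<eta>) = tvec A c u (\<xi> - \<eta>)"
proof -
  have d: "((\<lambda>u. snd d (cinv c u)) has_derivative FD (\<lambda>u. snd d (cinv c u)) u) (at u)"
    if "d \<in> charts_at A (cinv c u)" for d
    using that chart_in_max[OF A] unfolding charts_at_def by (intro transition_deriv[OF A c _ u]) auto
  note da = deriv_along_tvec[OF A c u d] and lin = has_derivative_linear[OF d]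
  show a: "tadd A (tvec A c u \<xi>) (tvec A c u \<eta>) = tvec A c u (\<xi> + \<eta>)" for \<xi> \<eta>
    unfolding tadd_def base_tvec[OF A c u]
    by (rule tangent_with_coords_tvec[OF A c u]) (simp add: da linear_add[OF lin])
  show s: "tscale A r (tvec A c u \<xi>) = tvec A c u (r *\<^sub>R \<xi>)" for r \<xi>
    unfolding tscale_def base_tvec[OF A c u]
    by (rule tangent_with_coords_tvec[OF A c u]) (simp add: da linear_cmul[OF lin])
  show "tdiff A (tvec A c u \<xi>) (tvec A c u \<eta>) = tvec A c u (\<xi> - \<eta>)"
    unfolding tdiff_def s a by simp
qed

text \<open>The vector is pushed forward through the curve chosen by \<open>rep\<close>; by the
  chain rule only the coordinate velocity of that curve matters.\<close>

lemma pushforward_tvec: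
  assumes A: "smooth_atlas A" and B: "smooth_atlas B" and f: "smooth_map A B S f"
    and c: "c \<in> maximal_atlas A" and u: "u \<in> cimg c" "cinv c u \<in> S"
    and d: "d \<in> maximal_atlas B" "f (cinv c u) \<in> fst d"
  shows "pushforward B f (tvec A c u \<xi>) = tvec B d (snd d (f (cinv c u))) (FD (\<lambda>u. snd d (f (cinv c u))) u \<xi>)"
proof -
  let ?\<rho> = "rep (tvec A c u \<xi>)"
  have r: "smooth_curve A ?\<rho>" "?\<rho> 0 = cinv c u" "cvel c ?\<rho> = \<xi>"
    using smooth_curve_rep_tvec[OF A c u(1)] rep_tvec_0[OF A c u(1)] cvel_rep_tvec[OF A c u(1)] by auto
  have sc: "smooth_curve B (\<lambda>t. f (?\<rho> t))" using smooth_curve_compose[OF A r(1) f] r(2) u(2) by simp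
  have "((\<lambda>u. snd d (f (cinv c u))) has_derivative FD (\<lambda>u. snd d (f (cinv c u))) u) (at u)"
    by (rule smooth_deriv[OF local_rep(2)[OF A B f c d(1)]]) (use u d(2) in simp)
  then have "cvel d (\<lambda>t. f (?\<rho> t)) = FD (\<lambda>u. snd d (f (cinv c u))) u \<xi>"
    using curve_deriv_function[OF A r(1) c, of "\<lambda>x. snd d (f x)"] r cinv_in[OF u(1)] chart_cinv[OF u(1)]
    by (simp add: vector_derivative_at)
  then show ?thesis
    unfolding pushforward_def o_def using velocity_eq_tvec[OF B sc d(1)] r(2) d(2) by simp
qed

section \<open>Charts of the tangent bundle and the Lie bracket\<close>

lemma smoothly_related_iff:
  assumes "is_chart c"
  shows "smoothly_related c d \<longleftrightarrow>
    open {u \<in> cimg c. cinv c u \<in> fst d} \<and>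
    smooth_on {u \<in> cimg c. cinv c u \<in> fst d} (\<lambda>u. snd d (cinv c u))"
  using chart_image_eq[OF assms, of "\<lambda>x. x \<in> fst d"]
  unfolding smoothly_related_def by (simp add: Int_def o_def)

lemma maximal_smoothly_related:
  assumes A: "smooth_atlas A" and c: "c \<in> maximal_atlas A" and d: "d \<in> maximal_atlas A"
  shows "smoothly_related c d"
proof -
  have "{u \<in> cimg c. cinv c u \<in> fst c \<and> cinv c u \<in> fst d} = {u \<in> cimg c. cinv c u \<in> fst d}"
    by (intro Collect_cong) (use cinv_in[of _ c] in metis)
  then show ?thesis
    using local_rep[OF A A smooth_map_ident[OF A openin_chart_domain[OF A c]] c d]
    unfolding smoothly_related_iff[OF max_chart[OF c]] by (metis (no_types))
qed

definition tchart :: "('a, 'e::real_normed_vector) atlas \<Rightarrow> ('a, 'e) chart \<Rightarrow> ('a tangent, 'e \<times> 'e) chart" where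
  "tchart A c = ({v \<in> tangent_bundle A. base v \<in> fst c}, \<lambda>v. (snd c (base v), deriv_along v (snd c)))"

lemma tangent_atlas_eq: "tangent_atlas A = tchart A ` A"
  unfolding tangent_atlas_def tchart_def ..

lemma tchart_tvec:
  assumes A: "smooth_atlas A" and c: "c \<in> maximal_atlas A" and u: "u \<in> cimg c"
  shows "tvec A c u \<xi> \<in> fst (tchart A c)" and "snd (tchart A c) (tvec A c u \<xi>) = (u, \<xi>)"
proof -
  have "cinv c u \<in> carrier A" using smooth_map_in[OF smooth_map_cinv[OF c] u] .
  then show "tvec A c u \<xi> \<in> fst (tchart A c)"
    unfolding tchart_def using tvec_in_tspace[OF A c u] cinv_in[OF u] base_tvec[OF A c u]
    by (simp add: tangent_bundle_base)
  show "snd (tchart A c) (tvec A c u \<xi>) = (u, \<xi>)"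
    unfolding tchart_def using base_tvec[OF A c u] deriv_along_tvec_self[OF A c u] chart_cinv[OF u] by simp
qed

lemma tchart_rep:
  assumes A: "smooth_atlas A" and c: "c \<in> maximal_atlas A" and v: "v \<in> fst (tchart A c)"
  shows "snd c (base v) \<in> cimg c" and "v = tvec A c (snd c (base v)) (deriv_along v (snd c))"
proof -
  have b: "base v \<in> fst c" "v \<in> tangent_space A (base v)"
    using v unfolding tchart_def by (simp_all add: tangent_bundle_base)
  show "snd c (base v) \<in> cimg c" using b by blast
  show "v = tvec A c (snd c (base v)) (deriv_along v (snd c))"
    using tspace_eq_tvec(1)[OF A c b] .
qed

lemma
  assumes A: "smooth_atlas A" and c: "c \<in> maximal_atlas A"
  shows tchart_is_chart: "is_chart (tchart A c)"
    and tchart_image: "cimg (tchart A c) = cimg c \<times> UNIV"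
    and tchart_cinv: "z \<in> cimg c \<times> UNIV \<Longrightarrow> cinv (tchart A c) z = tvec A c (fst z) (snd z)"
proof -
  have inj: "inj_on (snd (tchart A c)) (fst (tchart A c))"
  proof (rule inj_onI)
    fix v w assume h: "v \<in> fst (tchart A c)" "w \<in> fst (tchart A c)" "snd (tchart A c) v = snd (tchart A c) w"
    then have "snd c (base v) = snd c (base w)" "deriv_along v (snd c) = deriv_along w (snd c)"
      by (simp_all add: tchart_def)
    then show "v = w" using tchart_rep(2)[OF A c h(1)] tchart_rep(2)[OF A c h(2)] by simp
  qed
  show im: "cimg (tchart A c) = cimg c \<times> UNIV" (is "?L = ?R")
  proof
    show "?L \<subseteq> ?R" using tchart_rep(1)[OF A c] by (auto simp: tchart_def)
    show "?R \<subseteq> ?L"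
    proof
      fix z assume "z \<in> ?R"
      then have u: "fst z \<in> cimg c" by auto
      have "z = snd (tchart A c) (tvec A c (fst z) (snd z))" using tchart_tvec(2)[OF A c u] by simp
      then show "z \<in> ?L" using tchart_tvec(1)[OF A c u] by blast
    qed
  qed
  show "is_chart (tchart A c)"
    unfolding is_chart_def im using inj chart_open[OF max_chart[OF c]] by (simp add: open_Times)
  show "cinv (tchart A c) z = tvec A c (fst z) (snd z)" if "z \<in> cimg c \<times> UNIV"
  proof (rule inv_into_f_eq[OF inj])
    have u: "fst z \<in> cimg c" using that by auto
    show "tvec A c (fst z) (snd z) \<in> fst (tchart A c)" "snd (tchart A c) (tvec A c (fst z) (snd z)) = z"
      using tchart_tvec[OF A c u] by simp_all
  qed
qed

lemma tchart_mem_iff: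
  assumes A: "smooth_atlas A" and c: "c \<in> maximal_atlas A" and u: "u \<in> cimg c"
  shows "tvec A c u \<xi> \<in> fst (tchart A d) \<longleftrightarrow> cinv c u \<in> fst d"
  using tchart_tvec(1)[OF A c u] base_tvec[OF A c u] unfolding tchart_def by simp

text \<open>The transition sends \<open>(u, \<xi>)\<close> to
  \<open>(\<tau> u, FD \<tau> u \<xi>)\<close>, and the second component is smooth by
  \<open>smooth_on_FD\<close>.\<close>

lemma tchart_smoothly_related:
  fixes A :: "('a, 'e::real_inner) atlas"
  assumes A: "smooth_atlas A" and c: "c \<in> maximal_atlas A" and d: "d \<in> maximal_atlas A"
  shows "smoothly_related (tchart A c) (tchart A d)"
proof -
  let ?O = "{u \<in> cimg c. cinv c u \<in> fst d}"
  let ?\<tau> = "\<lambda>u. snd d (cinv c u)"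
  have r: "open ?O" "smooth_on ?O ?\<tau>"
    using maximal_smoothly_related[OF A c d] unfolding smoothly_related_iff[OF max_chart[OF c]] by auto
  have Q: "{z \<in> cimg (tchart A c). cinv (tchart A c) z \<in> fst (tchart A d)} = ?O \<times> UNIV"
  proof -
    have "{z \<in> cimg c \<times> UNIV. cinv (tchart A c) z \<in> fst (tchart A d)} = ?O \<times> (UNIV :: 'e set)"
      using tchart_cinv[OF A c] tchart_mem_iff[OF A c, of _ _ d] by auto
    then show ?thesis unfolding tchart_image[OF A c] .
  qed
  have op: "open (?O \<times> (UNIV :: 'e set))" using r by (simp add: open_Times)
  note fd = atlas_findim[OF A]
  have f: "smooth_on (?O \<times> (UNIV :: 'e set)) fst" "smooth_on (?O \<times> (UNIV :: 'e set)) snd"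
    using smooth_on_fst[OF op smooth_on_ident] smooth_on_snd[OF op smooth_on_ident] by simp_all
  have "smooth_on (?O \<times> UNIV) (\<lambda>z. (?\<tau> (fst z), FD ?\<tau> (fst z) (snd z)))"
    by (intro smooth_on_Pair[OF op] smooth_on_compose[OF fd op f(1) _ r(2)] smooth_on_FD[OF fd op r(2) f(1) _ f(2)])
      auto
  then have "smooth_on (?O \<times> UNIV) (\<lambda>z. snd (tchart A d) (cinv (tchart A c) z))"
  proof (rule smooth_on_cong[OF op])
    fix z assume z: "z \<in> ?O \<times> (UNIV :: 'e set)"
    then have u: "fst z \<in> cimg c" "cinv c (fst z) \<in> fst d" and z': "z \<in> cimg c \<times> UNIV" by auto
    show "(?\<tau> (fst z), FD ?\<tau> (fst z) (snd z)) = snd (tchart A d) (cinv (tchart A c) z)"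
      unfolding tchart_cinv[OF A c z'] tchart_def[of A d] snd_conv base_tvec[OF A c u(1)]
        deriv_along_tvec[OF A c u(1) transition_deriv[OF A c d u]] ..
  qed
  then show ?thesis
    unfolding smoothly_related_iff[OF tchart_is_chart[OF A c]] Q using op by blast
qed

lemma atlas_tangent:
  fixes A :: "('a, 'e::real_inner) atlas"
  assumes A: "smooth_atlas A"
  shows "smooth_atlas (tangent_atlas A)"
  unfolding smooth_atlas_def all_charts_def tangent_atlas_eq
  using findim_prod[OF atlas_findim[OF A] atlas_findim[OF A]]
    tchart_is_chart[OF A] tchart_smoothly_related[OF A] chart_in_max[OF A] by blast

lemma carrier_tangent_atlas: "carrier (tangent_atlas A) = tangent_bundle A"
proof -
  have "\<exists>c\<in>A. base v \<in> fst c" if "v \<in> tangent_bundle A" for v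
    using that unfolding tangent_bundle_base carrier_def by blast
  then show ?thesis unfolding carrier_def tangent_atlas_eq tchart_def by auto
qed

lemma tchart_in_maximal:
  assumes A: "smooth_atlas A" and c: "c \<in> maximal_atlas A"
  shows "tchart A c \<in> maximal_atlas (tangent_atlas A)"
proof -
  have "fst (tchart A c) \<subseteq> carrier (tangent_atlas A)"
    unfolding carrier_tangent_atlas by (auto simp: tchart_def)
  then show ?thesis
    unfolding maximal_atlas_def using tchart_is_chart[OF A c] tchart_smoothly_related[OF A] c chart_in_max[OF A]
    by (auto simp: tangent_atlas_eq)
qed

lemma function_rep:
  fixes A :: "('a, 'e::real_inner) atlas"
  assumes A: "smooth_atlas A" and h: "smooth_map A standard_atlas S h" and c: "c \<in> maximal_atlas A"
  shows "open {u \<in> cimg c. cinv c u \<in> S}"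
    and "smooth_on {u \<in> cimg c. cinv c u \<in> S} (\<lambda>u. h (cinv c u))"
  using smooth_map_compose[OF std_charts atlas_charts[OF A] atlas_findim[OF A] smooth_map_cinv[OF c] h]
  unfolding smooth_map_standard by blast+

text \<open>In coordinates \<open>X (Y h)\<close> is a second derivative of \<open>h\<close> plus
  the derivative of \<open>h\<close> in the direction \<open>FD Y' u (X' u)\<close>; the second
  derivatives cancel by symmetry. No other vector qualifies, since the components of the chart are
  admissible test functions.\<close>

lemma lie_bracket_tvec:
  fixes A :: "('a, 'e::real_inner) atlas"
  assumes A: "smooth_atlas A" and c: "c \<in> maximal_atlas A"
    and V: "open V" "V \<subseteq> cimg c" "u \<in> V"
    and X': "smooth_on V X'" and Y': "smooth_on V Y'"
    and X: "\<And>u. u \<in> V \<Longrightarrow> X (cinv c u) = tvec A c u (X' u)"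
    and Y: "\<And>u. u \<in> V \<Longrightarrow> Y (cinv c u) = tvec A c u (Y' u)"
  shows "lie_bracket A X Y (cinv c u) = tvec A c u (FD Y' u (X' u) - FD X' u (Y' u))"
proof -
  note fd = atlas_findim[OF A]
  have u: "u \<in> cimg c" using V by blast
  let ?Z = "FD Y' u (X' u) - FD X' u (Y' u)"
  \<comment> \<open>\<open>X1\<close> is only evaluated at the point, while \<open>X2\<close> is
    differentiated and has to be known on all of \<open>V\<close>.\<close>
  have second: "deriv_along (X1 (cinv c u)) (\<lambda>q. deriv_along (X2 q) h)
      = FD (\<lambda>z. FD (\<lambda>u. h (cinv c u)) z (X2' u)) u (X1' u) + FD (\<lambda>u. h (cinv c u)) u (FD X2' u (X1' u))"
    if h: "open T" "smooth_on T (\<lambda>u. h (cinv c u))" "u \<in> T" "T \<subseteq> cimg c"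
      and X1: "X1 (cinv c u) = tvec A c u (X1' u)"
      and X2: "smooth_on V X2'" "\<And>u. u \<in> V \<Longrightarrow> X2 (cinv c u) = tvec A c u (X2' u)"
    for h :: "'a \<Rightarrow> real" and T X1 X2 X1' X2'
  proof -
    let ?h = "\<lambda>u. h (cinv c u)"
    have "((\<lambda>z. FD ?h z (X2' z)) has_derivative
       (\<lambda>v. FD (\<lambda>z. FD ?h z (X2' u)) u v + FD ?h u (FD X2' u v))) (at u)"
      using has_derivative_FD[OF fd h(2,1) h(3) has_derivative_ident smooth_deriv[OF X2(1) V(3)]] .
    then have "((\<lambda>z. deriv_along (X2 (cinv c z)) h) has_derivative
       (\<lambda>v. FD (\<lambda>z. FD ?h z (X2' u)) u v + FD ?h u (FD X2' u v))) (at u)"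
    proof (rule has_derivative_transform_within_open)
      show "open (V \<inter> T)" "u \<in> V \<inter> T" using V h by auto
      show "FD ?h z (X2' z) = deriv_along (X2 (cinv c z)) h" if "z \<in> V \<inter> T" for z
        using deriv_along_tvec[OF A c _ smooth_deriv[OF h(2)], of z "X2' z"] X2(2)[of z] that V(2) by auto
    qed
    from deriv_along_tvec[OF A c u this, of "X1' u"] X1 show ?thesis by simp
  qed
  let ?B = "\<lambda>v. v \<in> tangent_space A (cinv c u) \<and>
     (\<forall>N (h :: 'a \<Rightarrow> real). openin (atlas_topology A) N \<and> cinv c u \<in> N \<and> smooth_map A standard_atlas N h \<longrightarrow>
        deriv_along v h =
        deriv_along (X (cinv c u)) (\<lambda>q. deriv_along (Y q) h) - deriv_along (Y (cinv c u)) (\<lambda>q. deriv_along (X q) h))"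
  show ?thesis unfolding lie_bracket_def
  proof (rule the_equality)
    show "?B (tvec A c u ?Z)"
    proof (intro conjI allI impI)
      show "tvec A c u ?Z \<in> tangent_space A (cinv c u)" using tvec_in_tspace[OF A c u] .
      fix N and h :: "'a \<Rightarrow> real"
      assume h: "openin (atlas_topology A) N \<and> cinv c u \<in> N \<and> smooth_map A standard_atlas N h"
      define T where "T = {u \<in> cimg c. cinv c u \<in> N}"
      let ?h = "\<lambda>u. h (cinv c u)"
      have T: "open T" "smooth_on T ?h" "u \<in> T" "T \<subseteq> cimg c"
        using function_rep[OF A _ c, of N h] h u unfolding T_def by auto
      have 1: "deriv_along (tvec A c u ?Z) h = FD ?h u ?Z"
        using deriv_along_tvec[OF A c u smooth_deriv[OF T(2,3)]] .
      have 2: "FD ?h u ?Z = FD ?h u (FD Y' u (X' u)) - FD ?h u (FD X' u (Y' u))"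
        using linear_diff[OF linear_FD[OF T(2,3)]] .
      show "deriv_along (tvec A c u ?Z) h =
        deriv_along (X (cinv c u)) (\<lambda>q. deriv_along (Y q) h) - deriv_along (Y (cinv c u)) (\<lambda>q. deriv_along (X q) h)"
        using 1 2 second[of T h X X' Y' Y, OF T X[OF V(3)] Y' Y] second[of T h Y Y' X' X, OF T Y[OF V(3)] X' X]
          FD_symmetric[OF T(1,2,3), of "X' u" "Y' u"] by linarith
    qed
    fix v assume v: "?B v"
    define \<zeta> where "\<zeta> = deriv_along v (snd c)"
    have v': "v = tvec A c u \<zeta>"
      using tspace_eq_tvec(1)[OF A c cinv_in[OF u] conjunct1[OF v]] chart_cinv[OF u] by (simp add: \<zeta>_def)
    \<comment> \<open>The function \<open>\<lambda>q. snd c q \<bullet> b\<close> is smooth on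
      \<open>fst c\<close>, and its derivative along \<open>v\<close> is the component of
      \<open>\<zeta>\<close> in the direction \<open>b\<close>.\<close>
    have "\<zeta> \<bullet> b = ?Z \<bullet> b" for b
    proof -
      let ?h = "\<lambda>q. snd c q \<bullet> b"
      define T where "T = cimg c"
      have T0: "open T" unfolding T_def using chart_open[OF max_chart[OF c]] .
      have lin: "smooth_on T (\<lambda>u. u \<bullet> b)"
        by (rule smooth_on_linear[OF T0 bounded_linear_inner_left smooth_on_ident])
      have T: "open T" "smooth_on T (\<lambda>u. ?h (cinv c u))" "u \<in> T" "T \<subseteq> cimg c"
        using T0 smooth_on_cong[OF T0 lin, of "\<lambda>u. ?h (cinv c u)"] u chart_cinv[of _ c] by (auto simp: T_def)
      have ht: "((\<lambda>u. ?h (cinv c u)) has_derivative (\<lambda>v. v \<bullet> b)) (at u)"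
        by (rule has_derivative_transform_within_open[OF _ T0 T(3), of "\<lambda>u. u \<bullet> b"])
          (auto simp: T_def chart_cinv intro!: derivative_eq_intros)
      have "smooth_map standard_atlas standard_atlas UNIV (\<lambda>u. u \<bullet> b)"
        unfolding smooth_map_standard
        by (auto intro: smooth_on_linear[OF open_UNIV bounded_linear_inner_left smooth_on_ident])
      from smooth_map_comp[OF atlas_charts[OF A] std_charts fd
          smooth_map_chart[OF atlas_charts[OF A] c] this]
      have "smooth_map A standard_atlas (fst c) ?h" by simp
      then have "deriv_along v ?h =
        deriv_along (X (cinv c u)) (\<lambda>q. deriv_along (Y q) ?h) - deriv_along (Y (cinv c u)) (\<lambda>q. deriv_along (X q) ?h)"
        using v openin_chart_domain[OF A c] cinv_in[OF u] by blast
      also have "\<dots> = FD (\<lambda>u. ?h (cinv c u)) u (FD Y' u (X' u)) - FD (\<lambda>u. ?h (cinv c u)) u (FD X' u (Y' u))"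
        using second[of T ?h X X' Y' Y, OF T X[OF V(3)] Y' Y] second[of T ?h Y Y' X' X, OF T Y[OF V(3)] X' X]
          FD_symmetric[OF T(1,2,3), of "X' u" "Y' u"] by linarith
      also have "\<dots> = ?Z \<bullet> b" unfolding FD_eqI[OF ht] by (simp add: inner_diff_left)
      finally show ?thesis unfolding v' deriv_along_tvec[OF A c u ht] .
    qed
    then have "\<zeta> = ?Z" by (metis (no_types, lifting) vector_eq_rdot)
    then show "v = tvec A c u ?Z" using v' by simp
  qed
qed

section \<open>Adapted charts\<close>

lemma product_atlas_charts:
  assumes "all_charts A" "all_charts B"
  shows "all_charts (product_atlas A B)"
  using assms unfolding all_charts_def product_atlas_def is_chart_def
  by (auto simp: map_prod_inj_on map_prod_surj_on[OF refl refl] open_Times)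

text \<open>The chart is a local trivialisation followed by a product chart, so its first component
  is a chart of the base composed with \<open>\<pi>\<close>. Compatibility with the atlas of
  \<open>E\<close> is smoothness of the trivialisation in one direction and of its inverse in the
  other.\<close>

lemma adapted_chart_exists:
  fixes M :: "('a, 'm::real_inner) atlas" and F :: "('c, 'f::real_inner) atlas" and E :: "('b, 'm \<times> 'f) atlas"
  assumes fb: "fiber_bundle M F E \<pi>" and e: "e \<in> carrier E"
  shows "\<exists>c\<in>adapted_charts M E \<pi>. e \<in> fst c"
proof -
  have M: "smooth_atlas M" and F: "smooth_atlas F" and E: "smooth_atlas E"
    and \<pi>: "smooth_map E M (carrier E) \<pi>"
    using fb manifold_imp_atlas unfolding fiber_bundle_def by blast+
  note Mc = atlas_charts[OF M] and Fc = atlas_charts[OF F] and Ec = atlas_charts[OF E]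
  have "\<pi> e \<in> carrier M" using smooth_map_in[OF \<pi> e] .
  then obtain U \<tau> where U: "\<pi> e \<in> U"
    and dif: "diffeomorphism E (product_atlas M F) {e \<in> carrier E. \<pi> e \<in> U} (U \<times> carrier F) (\<lambda>e. (\<pi> e, \<tau> e))"
    using fb unfolding fiber_bundle_def by blast
  define S where "S = {e \<in> carrier E. \<pi> e \<in> U}"
  define \<phi> where "\<phi> = (\<lambda>e. (\<pi> e, \<tau> e))"
  have bij: "bij_betw \<phi> S (U \<times> carrier F)" and sm: "smooth_map E (product_atlas M F) S \<phi>"
    and smi: "smooth_map (product_atlas M F) E (U \<times> carrier F) (inv_into S \<phi>)"
    using dif unfolding diffeomorphism_def S_def \<phi>_def by auto
  have eS: "e \<in> S" using e U by (simp add: S_def)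
  then have "\<tau> e \<in> carrier F" using bij bij_betwE by (fastforce simp: \<phi>_def)
  then obtain k where k: "k \<in> F" "\<tau> e \<in> fst k" by (auto simp: carrier_def)
  obtain d where d: "d \<in> M" "\<pi> e \<in> fst d" using \<open>\<pi> e \<in> carrier M\<close> by (auto simp: carrier_def)
  define c :: "('b, 'm \<times> 'f) chart" where
    "c = ({x \<in> S. \<pi> x \<in> fst d \<and> \<tau> x \<in> fst k}, \<lambda>x. (snd d (\<pi> x), snd k (\<tau> x)))"
  define pc where "pc = (fst d \<times> fst k, map_prod (snd d) (snd k))"
  have pc: "pc \<in> product_atlas M F" using d k unfolding product_atlas_def pc_def by force
  then have pcc: "is_chart pc" using product_atlas_charts[OF Mc Fc] unfolding all_charts_def by blast
  have c_eq: "fst c = {x \<in> S. \<phi> x \<in> fst pc}" "snd c x = snd pc (\<phi> x)" for x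
    by (auto simp: c_def pc_def \<phi>_def)
  have inj\<phi>: "inj_on \<phi> S" using bij by (simp add: bij_betw_def)
  have inj: "inj_on (snd c) (fst c)"
    unfolding c_eq using pcc inj\<phi> unfolding is_chart_def by (smt (verit, best) inj_on_def mem_Collect_eq)
  have rel1: "smoothly_related b c" if b: "b \<in> E" for b
  proof -
    have bc: "is_chart b" using Ec b unfolding all_charts_def by blast
    show ?thesis unfolding smoothly_related_iff[OF bc] c_eq
      using smooth_map_chartD[OF Ec sm b pc] by simp
  qed
  have rel2: "smoothly_related c b" if b: "b \<in> E" for b
  proof -
    let ?T = "U \<times> carrier F"
    let ?Q = "{z \<in> cimg pc. cinv pc z \<in> ?T \<and> inv_into S \<phi> (cinv pc z) \<in> fst b}"
    note sQ = smooth_map_chartD[OF product_atlas_charts[OF Mc Fc] smi pc b]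
    have inv: "inv_into S \<phi> (cinv pc (snd c x)) = x" "cinv pc (snd c x) = \<phi> x" "cinv c (snd c x) = x"
      if "x \<in> fst c" for x
    proof -
      show 1: "cinv pc (snd c x) = \<phi> x" using that cinv_chart[OF pcc] by (simp add: c_eq)
      show "inv_into S \<phi> (cinv pc (snd c x)) = x" using that inj\<phi> unfolding 1 by (simp add: c_eq)
      show "cinv c (snd c x) = x" by (rule inv_into_f_f[OF inj that])
    qed
    \<comment> \<open>The coordinate domain provided by the smooth inverse trivialisation is exactly
      the image of the overlap that \<open>smoothly_related\<close> asks for.\<close>
    have Q: "?Q = snd c ` (fst c \<inter> fst b)"
    proof
      show "snd c ` (fst c \<inter> fst b) \<subseteq> ?Q"
      proof
        fix z assume "z \<in> snd c ` (fst c \<inter> fst b)"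
        then obtain x where x: "x \<in> fst c" "x \<in> fst b" "z = snd c x" by blast
        then have "\<phi> x \<in> ?T" using bij bij_betwE c_eq(1) by blast
        then show "z \<in> ?Q" using inv[OF x(1)] x c_eq by auto
      qed
      show "?Q \<subseteq> snd c ` (fst c \<inter> fst b)"
      proof
        fix z assume z: "z \<in> ?Q"
        define x where "x = inv_into S \<phi> (cinv pc z)"
        have zi: "z \<in> cimg pc" using z by simp
        have "cinv pc z \<in> \<phi> ` S" using z bij unfolding bij_betw_def by simp
        then have "x \<in> S" "\<phi> x = cinv pc z" unfolding x_def by (rule inv_into_into, rule f_inv_into_f)
        moreover have "cinv pc z \<in> fst pc" "snd pc (cinv pc z) = z" using cinv_in[OF zi] chart_cinv[OF zi] .
        ultimately have "x \<in> fst c" "snd c x = z" using c_eq by auto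
        moreover have "x \<in> fst b" using z unfolding x_def by simp
        ultimately show "z \<in> snd c ` (fst c \<inter> fst b)" by blast
      qed
    qed
    have "smooth_on ?Q (\<lambda>u. snd b (cinv c u))"
    proof (rule smooth_on_cong[OF sQ])
      fix z assume "z \<in> ?Q"
      then obtain x where "x \<in> fst c" "z = snd c x" unfolding Q by blast
      then show "snd b (inv_into S \<phi> (cinv pc z)) = snd b (cinv c z)" using inv by simp
    qed
    then show ?thesis unfolding smoothly_related_def o_def Q[symmetric] using sQ(1) by simp
  qed
  have sub: "fst c \<subseteq> carrier E" by (auto simp: c_def S_def)
  \<comment> \<open>The whole chart image is open as the union of the overlap images with the charts
    of \<open>E\<close>.\<close>
  have "cimg c = (\<Union>b\<in>E. snd c ` (fst c \<inter> fst b))" using sub unfolding carrier_def by blast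
  then have "open (cimg c)" using rel2 unfolding smoothly_related_def by auto
  then have "c \<in> maximal_atlas E"
    unfolding maximal_atlas_def is_chart_def using inj sub rel1 rel2 by simp
  moreover have "\<forall>x\<in>fst c. \<pi> x \<in> fst d \<and> fst (snd c x) = snd d (\<pi> x)" by (simp add: c_def)
  ultimately have "c \<in> adapted_charts M E \<pi>" unfolding adapted_charts_def using d(1) by blast
  moreover have "e \<in> fst c" using eS d k by (simp add: c_def)
  ultimately show ?thesis by blast
qed

section \<open>The vertical bundle\<close>

text \<open>The trivialisations are replaced by their consequence for coordinates: adapted charts
  cover the total space. From the fiber manifold, the finite dimension of its model space is
  kept.\<close>

locale fibration =
  fixes M :: "('a, 'm::real_inner) atlas" and E :: "('b, 'm \<times> 'f::real_inner) atlas" and \<pi> :: "'b \<Rightarrow> 'a"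
  assumes M: "smooth_atlas M" and E: "smooth_atlas E" and fdf: "findim TYPE('f)"
    and proj: "smooth_map E M (carrier E) \<pi>"
    and adapted_exists: "\<And>e. e \<in> carrier E \<Longrightarrow> \<exists>c\<in>adapted_charts M E \<pi>. e \<in> fst c"
begin

abbreviation "VA \<equiv> vertical_atlas M E \<pi>"
abbreviation "AC \<equiv> adapted_charts M E \<pi>"

lemma fdm: "findim TYPE('m)"
  using atlas_findim[OF M] .

lemma fde: "findim TYPE('m \<times> 'f)"
  using atlas_findim[OF E] .

lemma adapted_max: "c \<in> AC \<Longrightarrow> c \<in> maximal_atlas E"
  unfolding adapted_charts_def by blast

lemma adapted_base_chart:
  assumes "c \<in> AC"
  obtains d where "d \<in> M" "d \<in> maximal_atlas M"
    "\<And>e. e \<in> fst c \<Longrightarrow> \<pi> e \<in> fst d" "\<And>e. e \<in> fst c \<Longrightarrow> snd d (\<pi> e) = fst (snd c e)"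
proof -
  obtain d where "d \<in> M" "\<forall>e\<in>fst c. \<pi> e \<in> fst d \<and> fst (snd c e) = snd d (\<pi> e)"
    using assms unfolding adapted_charts_def by blast
  then show ?thesis using that[of d] chart_in_max[OF M] by auto
qed

text \<open>The first coordinates of \<open>e\<close> are those of \<open>\<pi> e\<close> in a chart
  of the base, and that chart is injective.\<close>

lemma proj_eq_iff:
  assumes c: "c \<in> AC" and e: "e \<in> fst c" "e' \<in> fst c"
  shows "\<pi> e = \<pi> e' \<longleftrightarrow> fst (snd c e) = fst (snd c e')"
proof -
  obtain d where d: "d \<in> maximal_atlas M" "\<And>e. e \<in> fst c \<Longrightarrow> \<pi> e \<in> fst d"
    "\<And>e. e \<in> fst c \<Longrightarrow> snd d (\<pi> e) = fst (snd c e)"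
    using adapted_base_chart[OF c] by metis
  then show ?thesis using e cinv_chart[OF max_chart[OF d(1)]] by metis
qed

lemma proj_chart_eq:
  assumes "c \<in> AC" "u \<in> cimg c" "u' \<in> cimg c" "fst u = fst u'"
  shows "\<pi> (cinv c u) = \<pi> (cinv c u')"
  using proj_eq_iff[OF assms(1) cinv_in[OF assms(2)] cinv_in[OF assms(3)]]
    chart_cinv[OF assms(2)] chart_cinv[OF assms(3)] assms(4) by simp

lemma pushforward_proj:
  assumes c: "c \<in> AC" and d: "d \<in> maximal_atlas M"
    and cd: "\<And>e. e \<in> fst c \<Longrightarrow> \<pi> e \<in> fst d" "\<And>e. e \<in> fst c \<Longrightarrow> snd d (\<pi> e) = fst (snd c e)"
    and u: "u \<in> cimg c"
  shows "pushforward M \<pi> (tvec E c u \<xi>) = tvec M d (fst u) (fst \<xi>)"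
proof -
  note cm = adapted_max[OF c]
  have e: "snd d (\<pi> (cinv c u)) = fst u" if "u \<in> cimg c" for u
    using cd(2)[OF cinv_in[OF that]] chart_cinv[OF that] by simp
  have "((\<lambda>u. snd d (\<pi> (cinv c u))) has_derivative fst) (at u)"
    by (rule has_derivative_transform_within_open[OF has_derivative_fst[OF has_derivative_ident]
          chart_open[OF max_chart[OF cm]] u]) (simp add: e)
  then have "FD (\<lambda>u. snd d (\<pi> (cinv c u))) u = fst" by (rule FD_eqI)
  moreover have "cinv c u \<in> carrier E" using smooth_map_in[OF smooth_map_cinv[OF cm] u] .
  ultimately show ?thesis
    using pushforward_tvec[OF E M proj cm u _ d cd(1)[OF cinv_in[OF u]], of \<xi>] e[OF u] by simp
qed

text \<open>In adapted coordinates \<open>\<pi>\<close> is the first projection, and the constant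
  curve in the definition of vertical vectors represents the zero vector
  \<open>tvec M d (fst u) 0\<close>.\<close>

lemma vertical_tvec_iff:
  assumes c: "c \<in> AC" and u: "u \<in> cimg c"
  shows "tvec E c u \<xi> \<in> vertical_space M E \<pi> (cinv c u) \<longleftrightarrow> fst \<xi> = 0"
proof -
  obtain d where d: "d \<in> maximal_atlas M" "\<And>e. e \<in> fst c \<Longrightarrow> \<pi> e \<in> fst d"
    "\<And>e. e \<in> fst c \<Longrightarrow> snd d (\<pi> e) = fst (snd c e)"
    using adapted_base_chart[OF c] by metis
  have e: "snd d (\<pi> (cinv c u)) = fst u"
    using d(3)[OF cinv_in[OF u]] chart_cinv[OF u] by simp
  have i: "fst u \<in> cimg d" using d(2)[OF cinv_in[OF u]] e by (metis image_eqI)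
  have "\<pi> (cinv c u) = cinv d (fst u)"
    using cinv_chart[OF max_chart[OF d(1)] d(2)[OF cinv_in[OF u]]] e by simp
  then have "velocity M (\<lambda>_. \<pi> (cinv c u)) = tvec M d (fst u) 0" unfolding tvec_def by simp
  then show ?thesis
    unfolding vertical_space_def
    using tvec_in_tspace[OF E adapted_max[OF c] u] pushforward_proj[OF c d u] tvec_eq_iff[OF M d(1) i i]
    by simp
qed

lemma vertical_bundle_base:
  "v \<in> vertical_bundle M E \<pi> \<longleftrightarrow> base v \<in> carrier E \<and> v \<in> vertical_space M E \<pi> (base v)"
proof -
  have b: "base v = e" if "v \<in> vertical_space M E \<pi> e" for e
    using that tangent_space_base[of v E e] unfolding vertical_space_def by simp
  show ?thesis
  proof
    assume "v \<in> vertical_bundle M E \<pi>"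
    then obtain e where "e \<in> carrier E" "v \<in> vertical_space M E \<pi> e" unfolding vertical_bundle_def by (rule UN_E)
    then show "base v \<in> carrier E \<and> v \<in> vertical_space M E \<pi> (base v)" using b by simp
  next
    assume "base v \<in> carrier E \<and> v \<in> vertical_space M E \<pi> (base v)"
    then show "v \<in> vertical_bundle M E \<pi>" unfolding vertical_bundle_def by (elim conjE) (rule UN_I)
  qed
qed

definition vchart :: "('b, 'm \<times> 'f) chart \<Rightarrow> ('b tangent, 'm \<times> ('f \<times> 'f)) chart" where
  "vchart c = ({v \<in> vertical_bundle M E \<pi>. base v \<in> fst c},
     \<lambda>v. (fst (snd c (base v)), (snd (snd c (base v)), snd (deriv_along v (snd c)))))"

lemma vertical_atlas_eq: "VA = vchart ` AC"
  unfolding vertical_atlas_def vchart_def ..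

lemma vchart_tvec:
  assumes c: "c \<in> AC" and u: "(x, y) \<in> cimg c"
  shows "tvec E c (x, y) (0, w) \<in> fst (vchart c)"
    and "snd (vchart c) (tvec E c (x, y) (0, w)) = (x, (y, w))"
    and "tvec E c (x, y) (0, w) \<in> fst (vchart d) \<longleftrightarrow> cinv c (x, y) \<in> fst d"
proof -
  note cm = adapted_max[OF c]
  have "cinv c (x, y) \<in> carrier E" using smooth_map_in[OF smooth_map_cinv[OF cm] u] .
  then have vb: "tvec E c (x, y) (0, w) \<in> vertical_bundle M E \<pi>"
    unfolding vertical_bundle_base base_tvec[OF E cm u] using vertical_tvec_iff[OF c u] by simp
  then show "tvec E c (x, y) (0, w) \<in> fst (vchart c)"
    "tvec E c (x, y) (0, w) \<in> fst (vchart d) \<longleftrightarrow> cinv c (x, y) \<in> fst d"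
    using base_tvec[OF E cm u] cinv_in[OF u] by (simp_all add: vchart_def)
  show "snd (vchart c) (tvec E c (x, y) (0, w)) = (x, (y, w))"
    unfolding vchart_def snd_conv base_tvec[OF E cm u] deriv_along_tvec_self[OF E cm u] chart_cinv[OF u] by simp
qed

lemma vchart_rep:
  assumes c: "c \<in> AC" and v: "v \<in> fst (vchart c)"
  shows "snd c (base v) \<in> cimg c" and "v = tvec E c (snd c (base v)) (0, snd (deriv_along v (snd c)))"
proof -
  note cm = adapted_max[OF c]
  have b: "base v \<in> fst c" "v \<in> vertical_space M E \<pi> (base v)"
    using v vertical_bundle_base by (auto simp: vchart_def)
  then show u: "snd c (base v) \<in> cimg c" by blast
  have "v \<in> tangent_space E (base v)" using b(2) unfolding vertical_space_def by blast
  then have eq: "v = tvec E c (snd c (base v)) (deriv_along v (snd c))"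
    using tspace_eq_tvec(1)[OF E cm b(1)] by blast
  have "cinv c (snd c (base v)) = base v" using cinv_chart[OF max_chart[OF cm] b(1)] .
  then have "fst (deriv_along v (snd c)) = 0"
    using vertical_tvec_iff[OF c u, of "deriv_along v (snd c)"] b(2) eq by simp
  then have "deriv_along v (snd c) = (0, snd (deriv_along v (snd c)))" by (simp add: prod_eq_iff)
  then show "v = tvec E c (snd c (base v)) (0, snd (deriv_along v (snd c)))" using eq by simp
qed

abbreviation vdom :: "('b, 'm \<times> 'f) chart \<Rightarrow> ('m \<times> ('f \<times> 'f)) set" where
  "vdom c \<equiv> {z. (fst z, fst (snd z)) \<in> cimg c}"

lemma
  assumes c: "c \<in> AC"
  shows vchart_is_chart: "is_chart (vchart c)"
    and vchart_image: "cimg (vchart c) = vdom c"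
    and vchart_cinv: "z \<in> vdom c \<Longrightarrow> cinv (vchart c) z = tvec E c (fst z, fst (snd z)) (0, snd (snd z))"
proof -
  note cm = adapted_max[OF c]
  have inj: "inj_on (snd (vchart c)) (fst (vchart c))"
  proof (rule inj_onI)
    fix v w assume h: "v \<in> fst (vchart c)" "w \<in> fst (vchart c)" "snd (vchart c) v = snd (vchart c) w"
    then have "snd c (base v) = snd c (base w)" "snd (deriv_along v (snd c)) = snd (deriv_along w (snd c))"
      by (simp_all add: vchart_def prod_eq_iff)
    then show "v = w" using vchart_rep(2)[OF c h(1)] vchart_rep(2)[OF c h(2)] by simp
  qed
  show im: "cimg (vchart c) = vdom c"
  proof
    show "cimg (vchart c) \<subseteq> vdom c"
      using vchart_rep(1)[OF c] by (auto simp: vchart_def)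
    show "vdom c \<subseteq> cimg (vchart c)"
    proof
      fix z assume "z \<in> vdom c"
      then have u: "(fst z, fst (snd z)) \<in> cimg c" by simp
      have "z = snd (vchart c) (tvec E c (fst z, fst (snd z)) (0, snd (snd z)))"
        using vchart_tvec(2)[OF c u] by simp
      then show "z \<in> cimg (vchart c)" using vchart_tvec(1)[OF c u] by blast
    qed
  qed
  have "open ((\<lambda>z::'m \<times> ('f \<times> 'f). (fst z, fst (snd z))) -` cimg c)"
    by (intro open_vimage chart_open[OF max_chart[OF cm]] continuous_intros)
  then have "open (vdom c)" unfolding vimage_def .
  then show "is_chart (vchart c)" unfolding is_chart_def im using inj by simp
  show "cinv (vchart c) z = tvec E c (fst z, fst (snd z)) (0, snd (snd z))" if z: "z \<in> vdom c"
  proof (rule inv_into_f_eq[OF inj])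
    have u: "(fst z, fst (snd z)) \<in> cimg c" using z by simp
    show "tvec E c (fst z, fst (snd z)) (0, snd (snd z)) \<in> fst (vchart c)"
      "snd (vchart c) (tvec E c (fst z, fst (snd z)) (0, snd (snd z))) = z"
      using vchart_tvec[OF c u] by simp_all
  qed
qed

text \<open>The transition of the tangent charts restricted to the vertical slice: a vertical vector
  enters as \<open>(0, w)\<close>, and the fiber component of its image is kept.\<close>

lemma vchart_smoothly_related:
  assumes c: "c \<in> AC" and d: "d \<in> AC"
  shows "smoothly_related (vchart c) (vchart d)"
proof -
  note cm = adapted_max[OF c] and dm = adapted_max[OF d]
  let ?O = "{u \<in> cimg c. cinv c u \<in> fst d}"
  let ?\<tau> = "\<lambda>u. snd d (cinv c u)"
  let ?u = "\<lambda>z::'m \<times> ('f \<times> 'f). (fst z, fst (snd z))"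
  let ?w = "\<lambda>z::'m \<times> ('f \<times> 'f). (0::'m, snd (snd z))"
  define O' where "O' = ?u -` ?O"
  have r: "open ?O" "smooth_on ?O ?\<tau>"
    using maximal_smoothly_related[OF E cm dm] unfolding smoothly_related_iff[OF max_chart[OF cm]] by auto
  have op: "open O'" unfolding O'_def by (intro open_vimage r continuous_intros)
  have Q: "{z \<in> cimg (vchart c). cinv (vchart c) z \<in> fst (vchart d)} = O'"
  proof -
    have "cinv (vchart c) z \<in> fst (vchart d) \<longleftrightarrow> cinv c (?u z) \<in> fst d" if "z \<in> vdom c" for z
      using vchart_cinv[OF c that] vchart_tvec(3)[OF c] that by simp
    then have "{z \<in> vdom c. cinv (vchart c) z \<in> fst (vchart d)} = O'" by (auto simp: O'_def)
    then show ?thesis unfolding vchart_image[OF c] .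
  qed
  have su: "smooth_on O' ?u" "smooth_on O' ?w"
    by (intro smooth_on_Pair[OF op] smooth_on_fst[OF op] smooth_on_snd[OF op] smooth_on_ident smooth_on_const)+
  have im: "?u ` O' \<subseteq> ?O" by (auto simp: O'_def)
  have 1: "smooth_on O' (\<lambda>z. ?\<tau> (?u z))" using smooth_on_compose[OF fde op su(1) im r(2)] .
  have 2: "smooth_on O' (\<lambda>z. FD ?\<tau> (?u z) (?w z))" using smooth_on_FD[OF fde op r(2) su(1) im su(2)] .
  have "smooth_on O' (\<lambda>z. (fst (?\<tau> (?u z)), (snd (?\<tau> (?u z)), snd (FD ?\<tau> (?u z) (?w z)))))"
    by (intro smooth_on_Pair[OF op] smooth_on_fst[OF op] smooth_on_snd[OF op] 1 2)
  then have "smooth_on O' (\<lambda>z. snd (vchart d) (cinv (vchart c) z))"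
  proof (rule smooth_on_cong[OF op])
    fix z assume z: "z \<in> O'"
    then have u: "?u z \<in> cimg c" "cinv c (?u z) \<in> fst d" and z': "z \<in> vdom c" by (auto simp: O'_def)
    show "(fst (?\<tau> (?u z)), (snd (?\<tau> (?u z)), snd (FD ?\<tau> (?u z) (?w z)))) = snd (vchart d) (cinv (vchart c) z)"
      unfolding vchart_cinv[OF c z'] vchart_def[of d] snd_conv base_tvec[OF E cm u(1)]
        deriv_along_tvec[OF E cm u(1) transition_deriv[OF E cm dm u]] ..
  qed
  then show ?thesis
    unfolding smoothly_related_iff[OF vchart_is_chart[OF c]] Q using op by blast
qed

lemma atlas_vertical: "smooth_atlas VA"
  unfolding smooth_atlas_def all_charts_def vertical_atlas_eq
  using findim_prod[OF fdm findim_prod[OF fdf fdf]] vchart_is_chart vchart_smoothly_related by blast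

lemma vchart_max: "c \<in> AC \<Longrightarrow> vchart c \<in> maximal_atlas VA"
  using chart_in_max[OF atlas_vertical] unfolding vertical_atlas_eq by blast

section \<open>Surfaces in the fibers\<close>

text \<open>The element of the second vertical bundle with coordinates
  \<open>(y; dy/dt; dy/d\<epsilon>; d\<^sup>2y/dt d\<epsilon>) = (y; a; b; m)\<close> in the fiber over \<open>x\<close>.\<close>

definition xi :: "('b, 'm \<times> 'f) chart \<Rightarrow> 'm \<Rightarrow> 'f \<Rightarrow> 'f \<Rightarrow> 'f \<Rightarrow> 'f \<Rightarrow> 'b tangent tangent" where
  "xi c x y b a m = tvec VA (vchart c) (x, (y, b)) (0, (a, m))"

lemma vdom_iff: "c \<in> AC \<Longrightarrow> (x, (y, b)) \<in> cimg (vchart c) \<longleftrightarrow> (x, y) \<in> cimg c"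
  by (simp add: vchart_image)

lemma xi_eq_iff:
  assumes "c \<in> AC" "(x, y) \<in> cimg c" "(x', y') \<in> cimg c"
  shows "xi c x y b a m = xi c x' y' b' a' m' \<longleftrightarrow> x = x' \<and> y = y' \<and> b = b' \<and> a = a' \<and> m = m'"
  unfolding xi_def using assms
  by (subst tvec_eq_iff[OF atlas_vertical vchart_max]) (auto simp: vdom_iff simp del: vchart_image)

lemma base_xi:
  assumes c: "c \<in> AC" and u: "(x, y) \<in> cimg c"
  shows "base (xi c x y b a m) = tvec E c (x, y) (0, b)"
  unfolding xi_def
  using base_tvec[OF atlas_vertical vchart_max[OF c]] vdom_iff[OF c] u vchart_cinv[OF c, of "(x, (y, b))"]
  by simp

text \<open>What is known about a surface \<open>\<gamma>\<close> with coordinates \<open>(x, y; a; b; m)\<close>; the last conjunct is the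
  transformation rule of the mixed derivative.\<close>

definition surf :: "('b, 'm \<times> 'f) chart \<Rightarrow> (real \<times> real \<Rightarrow> 'b) \<Rightarrow> 'm \<Rightarrow> 'f \<Rightarrow> 'f \<Rightarrow> 'f \<Rightarrow> 'f \<Rightarrow> bool" where
  "surf c \<gamma> x y b a m \<longleftrightarrow> fiber_surface E \<pi> \<gamma> \<and> (x, y) \<in> cimg c \<and> \<gamma> (0, 0) = cinv c (x, y) \<and>
     velocity E (\<lambda>\<epsilon>. \<gamma> (0, \<epsilon>)) = tvec E c (x, y) (0, b) \<and>
     velocity E (\<lambda>t. \<gamma> (t, 0)) = tvec E c (x, y) (0, a) \<and>
     surface_velocity M E \<pi> \<gamma> = xi c x y b a m \<and>
     surface_velocity M E \<pi> (\<lambda>(t, \<epsilon>). \<gamma> (\<epsilon>, t)) = xi c x y a b m \<and>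
     (\<forall>c'\<in>AC. \<gamma> (0, 0) \<in> fst c' \<longrightarrow> mixed_coord c' \<gamma> =
        FD (\<lambda>y. FD (\<lambda>y. snd (snd c' (cinv c (x, y)))) y b) y a + FD (\<lambda>y. snd (snd c' (cinv c (x, y)))) y m)"

section \<open>Functions of two real parameters\<close>

lemma open_section:
  fixes Q :: "(real \<times> real) set"
  assumes "open Q"
  shows "open {\<epsilon>. (t, \<epsilon>) \<in> Q}" "open {t. (t, \<epsilon>) \<in> Q}"
proof -
  have "open ((\<lambda>\<epsilon>. (t, \<epsilon>)) -` Q)" "open ((\<lambda>t. (t, \<epsilon>)) -` Q)"
    by (intro open_vimage assms continuous_intros)+
  then show "open {\<epsilon>. (t, \<epsilon>) \<in> Q}" "open {t. (t, \<epsilon>) \<in> Q}" by (simp_all add: vimage_def)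
qed

lemma fdr2: "findim TYPE(real \<times> real)"
  using findim_prod[OF findim_real findim_real] .

lemma partial_derivatives:
  fixes h :: "real \<times> real \<Rightarrow> 'g::real_normed_vector"
  assumes h: "smooth_on Q h" and z: "(t, \<epsilon>) \<in> Q"
  shows "((\<lambda>\<epsilon>. h (t, \<epsilon>)) has_vector_derivative FD h (t, \<epsilon>) (0, 1)) (at \<epsilon>)"
    and "((\<lambda>t. h (t, \<epsilon>)) has_vector_derivative FD h (t, \<epsilon>) (1, 0)) (at t)"
proof -
  have d: "(h has_derivative FD h (t, \<epsilon>)) (at (t, \<epsilon>))" using smooth_deriv[OF h z] .
  have l: "FD h (t, \<epsilon>) (r *\<^sub>R v) = r *\<^sub>R FD h (t, \<epsilon>) v" for r v
    using linear_cmul[OF has_derivative_linear[OF d]] .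
  have 1: "((\<lambda>\<epsilon>. (t, \<epsilon>)) has_derivative (\<lambda>r. (0, r))) (at \<epsilon>)" "((\<lambda>t. (t, \<epsilon>)) has_derivative (\<lambda>r. (r, 0))) (at t)"
    by (auto intro!: derivative_eq_intros)
  show "((\<lambda>\<epsilon>. h (t, \<epsilon>)) has_vector_derivative FD h (t, \<epsilon>) (0, 1)) (at \<epsilon>)"
    using has_derivative_compose[OF 1(1) d] unfolding has_vector_derivative_def l[symmetric] by simp
  show "((\<lambda>t. h (t, \<epsilon>)) has_vector_derivative FD h (t, \<epsilon>) (1, 0)) (at t)"
    using has_derivative_compose[OF 1(2) d] unfolding has_vector_derivative_def l[symmetric] by simp
qed

lemma smooth_on_section:
  fixes h :: "real \<times> real \<Rightarrow> 'g::real_normed_vector"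
  assumes Q: "open Q" and h: "smooth_on Q h"
  shows "smooth_on {\<epsilon>. (t, \<epsilon>) \<in> Q} (\<lambda>\<epsilon>. h (t, \<epsilon>))" "smooth_on {t. (t, \<epsilon>) \<in> Q} (\<lambda>t. h (t, \<epsilon>))"
proof -
  show "smooth_on {\<epsilon>. (t, \<epsilon>) \<in> Q} (\<lambda>\<epsilon>. h (t, \<epsilon>))"
    by (rule smooth_on_compose[OF fdr2 open_section(1)[OF Q]
          smooth_on_Pair[OF open_section(1)[OF Q] smooth_on_const smooth_on_ident] _ h]) auto
  show "smooth_on {t. (t, \<epsilon>) \<in> Q} (\<lambda>t. h (t, \<epsilon>))"
    by (rule smooth_on_compose[OF fdr2 open_section(2)[OF Q]
          smooth_on_Pair[OF open_section(2)[OF Q] smooth_on_ident smooth_on_const] _ h]) auto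
qed

text \<open>Pairs are \<open>(t, \<epsilon>)\<close>; the derivative in \<open>\<epsilon>\<close> is
  taken inside, as in \<open>surface_velocity\<close>.\<close>

abbreviation mixed :: "(real \<times> real \<Rightarrow> 'g::real_normed_vector) \<Rightarrow> 'g" where
  "mixed h \<equiv> FD (\<lambda>z. FD h z (0, 1)) (0, 0) (1, 0)"

section \<open>Surfaces expressed in one adapted chart\<close>

context
  fixes c \<gamma> x h and Q :: "(real \<times> real) set"
  assumes c: "c \<in> AC" and Q: "open Q" "(0, 0) \<in> Q" and h: "smooth_on Q h"
    and \<gamma>: "\<And>z. z \<in> Q \<Longrightarrow> \<gamma> z = cinv c (x, h z)" and hQ: "\<And>z. z \<in> Q \<Longrightarrow> (x, h z) \<in> cimg c"
begin

lemma velocity_slice: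
  assumes "(t, 0) \<in> Q"
  shows "velocity E (\<lambda>\<epsilon>. \<gamma> (t, \<epsilon>)) = tvec E c (x, h (t, 0)) (0, FD h (t, 0) (0, 1))"
proof (rule velocity_eqI[OF E adapted_max[OF c], where N = "{\<epsilon>. (t, \<epsilon>) \<in> Q}" and w = "\<lambda>\<epsilon>. (x, h (t, \<epsilon>))"])
  show o: "open {\<epsilon>. (t, \<epsilon>) \<in> Q}" "0 \<in> {\<epsilon>. (t, \<epsilon>) \<in> Q}" using open_section[OF Q(1)] assms by auto
  show "smooth_on {\<epsilon>. (t, \<epsilon>) \<in> Q} (\<lambda>\<epsilon>. (x, h (t, \<epsilon>)))"
    by (intro smooth_on_Pair o smooth_on_const smooth_on_section Q h)
  show "(\<lambda>\<epsilon>. (x, h (t, \<epsilon>))) ` {\<epsilon>. (t, \<epsilon>) \<in> Q} \<subseteq> cimg c" using hQ by auto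
  show "\<gamma> (t, \<epsilon>) = cinv c (x, h (t, \<epsilon>))" if "\<epsilon> \<in> {\<epsilon>. (t, \<epsilon>) \<in> Q}" for \<epsilon> using \<gamma> that by simp
  show "((\<lambda>\<epsilon>. (x, h (t, \<epsilon>))) has_vector_derivative (0, FD h (t, 0) (0, 1))) (at 0)"
    by (intro has_vector_derivative_Pair has_vector_derivative_const partial_derivatives(1)[OF h assms])
qed

lemma velocity_slice':
  shows "velocity E (\<lambda>t. \<gamma> (t, 0)) = tvec E c (x, h (0, 0)) (0, FD h (0, 0) (1, 0))"
proof (rule velocity_eqI[OF E adapted_max[OF c], where N = "{t. (t, 0) \<in> Q}" and w = "\<lambda>t. (x, h (t, 0))"])
  show o: "open {t. (t, 0) \<in> Q}" "0 \<in> {t. (t, 0) \<in> Q}" using open_section[OF Q(1)] Q by auto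
  show "smooth_on {t. (t, 0) \<in> Q} (\<lambda>t. (x, h (t, 0)))"
    by (intro smooth_on_Pair o smooth_on_const smooth_on_section Q h)
  show "(\<lambda>t. (x, h (t, 0))) ` {t. (t, 0) \<in> Q} \<subseteq> cimg c" using hQ by auto
  show "\<gamma> (t, 0) = cinv c (x, h (t, 0))" if "t \<in> {t. (t, 0) \<in> Q}" for t using \<gamma> that by simp
  show "((\<lambda>t. (x, h (t, 0))) has_vector_derivative (0, FD h (0, 0) (1, 0))) (at 0)"
    by (intro has_vector_derivative_Pair has_vector_derivative_const partial_derivatives(2)[OF h Q(2)])
qed

text \<open>For \<open>t\<close> near \<open>0\<close> the inner velocity has the fiber coordinates
  \<open>h (t, 0)\<close> and \<open>FD h (t, 0) (0, 1)\<close>; differentiating this curve in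
  \<open>t\<close> yields the two remaining coordinates.\<close>

lemma surface_velocity_chart:
  "surface_velocity M E \<pi> \<gamma> = xi c x (h (0, 0)) (FD h (0, 0) (0, 1)) (FD h (0, 0) (1, 0))
     (mixed h)"
  unfolding surface_velocity_def xi_def
proof (rule velocity_eqI[OF atlas_vertical vchart_max[OF c], where N = "{t. (t, 0) \<in> Q}"
      and w = "\<lambda>t. (x, (h (t, 0), FD h (t, 0) (0, 1)))"])
  show o: "open {t. (t, 0) \<in> Q}" "0 \<in> {t. (t, 0) \<in> Q}" using open_section[OF Q(1)] Q by auto
  show "smooth_on {t. (t, 0) \<in> Q} (\<lambda>t. (x, (h (t, 0), FD h (t, 0) (0, 1))))"
    by (intro smooth_on_Pair o smooth_on_const smooth_on_section(2)[OF Q(1)] h smooth_on_dir)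
  show "(\<lambda>t. (x, (h (t, 0), FD h (t, 0) (0, 1)))) ` {t. (t, 0) \<in> Q} \<subseteq> cimg (vchart c)"
    using hQ by (auto simp: vchart_image[OF c])
  show "velocity E (\<lambda>\<epsilon>. \<gamma> (t, \<epsilon>)) = cinv (vchart c) (x, (h (t, 0), FD h (t, 0) (0, 1)))"
    if "t \<in> {t. (t, 0) \<in> Q}" for t
    using velocity_slice[of t] vchart_cinv[OF c, of "(x, (h (t, 0), FD h (t, 0) (0, 1)))"] that hQ[of "(t, 0)"] by simp
  show "((\<lambda>t. (x, (h (t, 0), FD h (t, 0) (0, 1)))) has_vector_derivative
      (0, (FD h (0, 0) (1, 0), mixed h))) (at 0)"
    by (intro has_vector_derivative_Pair has_vector_derivative_const partial_derivatives(2)[OF h Q(2)]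
        partial_derivatives(2)[OF smooth_on_dir[OF h] Q(2)])
qed

text \<open>The second order chain rule for the fiber transition composed with \<open>h\<close>. Its
  quadratic term involves only the foot point and the first order coordinates, so it cancels between
  surfaces with the same double projection; hence the affine difference is independent of the
  chart.\<close>

lemma mixed_coord_chart:
  assumes c': "c' \<in> AC" "\<gamma> (0, 0) \<in> fst c'"
  shows "mixed_coord c' \<gamma> =
        FD (\<lambda>y. FD (\<lambda>y. snd (snd c' (cinv c (x, y)))) y (FD h (0, 0) (0, 1))) (h (0, 0)) (FD h (0, 0) (1, 0)) +
        FD (\<lambda>y. snd (snd c' (cinv c (x, y)))) (h (0, 0)) (mixed h)"
proof -
  let ?\<psi> = "\<lambda>y. snd (snd c' (cinv c (x, y)))"
  note cm = adapted_max[OF c] and cm' = adapted_max[OF c'(1)]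
  define W where "W = {u \<in> cimg c. cinv c u \<in> fst c'}"
  define Y where "Y = {y. (x, y) \<in> W}"
  have r: "open W" "smooth_on W (\<lambda>u. snd c' (cinv c u))"
    using maximal_smoothly_related[OF E cm cm'] unfolding W_def smoothly_related_iff[OF max_chart[OF cm]] by auto
  have "open ((\<lambda>y. (x, y)) -` W)" by (intro open_vimage r continuous_intros)
  then have Y: "open Y" by (simp add: Y_def vimage_def)
  have "smooth_on Y (\<lambda>y. (x, y))" by (intro smooth_on_Pair[OF Y] smooth_on_const smooth_on_ident)
  from smooth_on_compose[OF fde Y this _ r(2)]
  have \<psi>: "smooth_on Y ?\<psi>" by (intro smooth_on_snd[OF Y]) (auto simp: Y_def)
  define Q' where "Q' = Q \<inter> h -` Y"
  have Q': "open Q'" unfolding Q'_def using continuous_open_preimage[OF smooth_on_continuous[OF h] Q(1) Y] .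
  have 0: "(0, 0) \<in> Q'"
    using c'(2) \<gamma>[OF Q(2)] hQ[OF Q(2)] Q(2) unfolding Q'_def Y_def W_def by auto
  have h': "smooth_on Q' h" using h by (rule smooth_on_subset) (auto simp: Q'_def)
  have sm: "smooth_on Q' (\<lambda>z. ?\<psi> (h z))" using smooth_on_compose[OF fdf Q' h' _ \<psi>] by (auto simp: Q'_def)
  \<comment> \<open>The inner derivative is needed for all \<open>t\<close> near \<open>0\<close>,
    not only at the origin, since it is differentiated in \<open>t\<close> afterwards.\<close>
  have in1: "vector_derivative (\<lambda>\<epsilon>. snd (snd c' (\<gamma> (t, \<epsilon>)))) (at 0) = FD ?\<psi> (h (t, 0)) (FD h (t, 0) (0, 1))"
    if t: "(t, 0) \<in> Q'" for t
  proof -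
    have "((\<lambda>\<epsilon>. ?\<psi> (h (t, \<epsilon>))) has_vector_derivative FD (\<lambda>z. ?\<psi> (h z)) (t, 0) (0, 1)) (at 0)"
      using partial_derivatives(1)[OF sm t] .
    then have "((\<lambda>\<epsilon>. snd (snd c' (\<gamma> (t, \<epsilon>)))) has_vector_derivative FD (\<lambda>z. ?\<psi> (h z)) (t, 0) (0, 1)) (at 0)"
      by (rule has_vector_derivative_transform_within_open[OF _ open_section(1)[OF Q', of t]])
        (use t \<gamma> in \<open>auto simp: Q'_def\<close>)
    moreover have "FD (\<lambda>z. ?\<psi> (h z)) (t, 0) = (\<lambda>v. FD ?\<psi> (h (t, 0)) (FD h (t, 0) v))"
      using t by (intro FD_eqI has_derivative_compose[OF smooth_deriv[OF h' t] smooth_deriv[OF \<psi>]])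
        (auto simp: Q'_def)
    ultimately show ?thesis by (simp add: vector_derivative_at)
  qed
  have sh: "((\<lambda>t. h (t, 0)) has_derivative (\<lambda>r. r *\<^sub>R FD h (0, 0) (1, 0))) (at 0)"
    using partial_derivatives(2)[OF h Q(2)] unfolding has_vector_derivative_def .
  have sh2: "((\<lambda>t. FD h (t, 0) (0, 1)) has_derivative (\<lambda>r. r *\<^sub>R mixed h)) (at 0)"
    using partial_derivatives(2)[OF smooth_on_dir[OF h] Q(2)] unfolding has_vector_derivative_def .
  have hy: "h (0, 0) \<in> Y" using 0 by (simp add: Q'_def)
  have "((\<lambda>t. FD ?\<psi> (h (t, 0)) (FD h (t, 0) (0, 1))) has_derivative
      (\<lambda>r. FD (\<lambda>y. FD ?\<psi> y (FD h (0, 0) (0, 1))) (h (0, 0)) (r *\<^sub>R FD h (0, 0) (1, 0)) +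
        FD ?\<psi> (h (0, 0)) (r *\<^sub>R mixed h))) (at 0)"
    using has_derivative_FD[OF fdf \<psi> Y hy sh sh2] .
  then have "((\<lambda>t. FD ?\<psi> (h (t, 0)) (FD h (t, 0) (0, 1))) has_vector_derivative
      (FD (\<lambda>y. FD ?\<psi> y (FD h (0, 0) (0, 1))) (h (0, 0)) (FD h (0, 0) (1, 0)) +
        FD ?\<psi> (h (0, 0)) (mixed h))) (at 0)"
    unfolding has_vector_derivative_def
    by (simp add: linear_cmul[OF linear_FD[OF \<psi> hy]] scaleR_add_right
        linear_cmul[OF linear_FD[OF smooth_on_dir[OF \<psi>] hy]])
  then have "((\<lambda>t. vector_derivative (\<lambda>\<epsilon>. snd (snd c' (\<gamma> (t, \<epsilon>)))) (at 0)) has_vector_derivative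
      (FD (\<lambda>y. FD ?\<psi> y (FD h (0, 0) (0, 1))) (h (0, 0)) (FD h (0, 0) (1, 0)) +
        FD ?\<psi> (h (0, 0)) (mixed h))) (at 0)"
    by (rule has_vector_derivative_transform_within_open[OF _ open_section(2)[OF Q', of 0]])
      (use 0 in1 in auto)
  then show ?thesis unfolding mixed_coord_def by (rule vector_derivative_at)
qed

end

lemma smooth_on_swap:
  assumes Q: "open Q" and h: "smooth_on (Q :: (real \<times> real) set) h"
  shows "open (prod.swap -` Q)" "smooth_on (prod.swap -` Q) (\<lambda>z. h (prod.swap z))"
    "(t, \<epsilon>) \<in> Q \<Longrightarrow> FD (\<lambda>z. h (prod.swap z)) (\<epsilon>, t) (p, q) = FD h (t, \<epsilon>) (q, p)"
proof -
  show o: "open (prod.swap -` Q)" by (intro open_vimage Q continuous_intros)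
  have "smooth_on (prod.swap -` Q) (\<lambda>z::real \<times> real. (snd z, fst z))"
    by (intro smooth_on_Pair[OF o] smooth_on_fst[OF o] smooth_on_snd[OF o] smooth_on_ident)
  moreover have sw: "prod.swap = (\<lambda>z::real \<times> real. (snd z, fst z))" by auto
  ultimately have "smooth_on (prod.swap -` Q) (prod.swap :: real \<times> real \<Rightarrow> _)" by simp
  from smooth_on_compose[OF fdr2 o this _ h]
  show "smooth_on (prod.swap -` Q) (\<lambda>z. h (prod.swap z))" by auto
  assume "(t, \<epsilon>) \<in> Q"
  then have "(h has_derivative FD h (t, \<epsilon>)) (at (prod.swap (\<epsilon>, t)))" using smooth_deriv[OF h] by simp
  moreover have "(prod.swap has_derivative prod.swap) (at (\<epsilon>, t))"
    unfolding sw by (auto intro!: derivative_eq_intros)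
  ultimately have "((\<lambda>z. h (prod.swap z)) has_derivative (\<lambda>v. FD h (t, \<epsilon>) (prod.swap v))) (at (\<epsilon>, t))"
    using has_derivative_compose by blast
  then show "FD (\<lambda>z. h (prod.swap z)) (\<epsilon>, t) (p, q) = FD h (t, \<epsilon>) (q, p)" by (simp add: FD_eqI)
qed

text \<open>Exchanging the parameters exchanges the first order coordinates and, by Schwarz's
  theorem, preserves the mixed one.\<close>

lemma surfI:
  assumes c: "c \<in> AC" and Q: "open Q" "(0, 0) \<in> Q" and h: "smooth_on Q h"
    and \<gamma>: "\<And>z. z \<in> Q \<Longrightarrow> \<gamma> z = cinv c (x, h z)" and hQ: "\<And>z. z \<in> Q \<Longrightarrow> (x, h z) \<in> cimg c"
    and fs: "fiber_surface E \<pi> \<gamma>"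
  shows "surf c \<gamma> x (h (0, 0)) (FD h (0, 0) (0, 1)) (FD h (0, 0) (1, 0)) (mixed h)"
proof -
  note sw = smooth_on_swap[OF Q(1) h]
  let ?h = "\<lambda>z. h (prod.swap z)"
  have s1: "surface_velocity M E \<pi> (\<lambda>z. \<gamma> (prod.swap z)) = xi c x (?h (0, 0)) (FD ?h (0, 0) (0, 1))
    (FD ?h (0, 0) (1, 0)) (mixed ?h)"
    by (rule surface_velocity_chart[OF c sw(1) _ sw(2)]) (use Q(2) \<gamma> hQ in auto)
  have e1: "FD (\<lambda>z. FD ?h z (0, 1)) (0, 0) = FD (\<lambda>z. FD h (prod.swap z) (1, 0)) (0, 0)"
  proof (rule FD_cong_open[OF sw(1)])
    show "(0, 0) \<in> prod.swap -` Q" using Q(2) by simp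
    show "FD ?h z (0, 1) = FD h (prod.swap z) (1, 0)" if "z \<in> prod.swap -` Q" for z
      using sw(3)[of "snd z" "fst z" 0 1] that by (cases z) simp
  qed
  have "mixed ?h = FD (\<lambda>z. FD h z (1, 0)) (0, 0) (0, 1)"
    unfolding e1 using smooth_on_swap(3)[OF Q(1) smooth_on_dir[OF h] Q(2)] .
  also have "\<dots> = mixed h" using FD_symmetric[OF Q(1) h Q(2)] .
  finally have s2: "mixed ?h = mixed h" .
  have "surface_velocity M E \<pi> (\<lambda>(t, \<epsilon>). \<gamma> (\<epsilon>, t)) = xi c x (h (0, 0)) (FD h (0, 0) (1, 0)) (FD h (0, 0) (0, 1))
     (mixed h)"
    using s1 unfolding s2 sw(3)[OF Q(2)] by (simp add: case_prod_beta' prod.swap_def)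
  then show ?thesis
    unfolding surf_def
    using fs hQ[OF Q(2)] \<gamma>[OF Q(2)] velocity_slice[OF c Q h \<gamma> hQ Q(2)] velocity_slice'[OF c Q h \<gamma> hQ]
      surface_velocity_chart[OF c Q h \<gamma> hQ] mixed_coord_chart[OF c Q h \<gamma> hQ] by blast
qed

text \<open>A surface inside one fiber has constant base coordinates in an adapted chart, so near
  the origin it is described by its fiber coordinates alone.\<close>

lemma surf_of_fiber_surface:
  assumes c: "c \<in> AC" and fs: "fiber_surface E \<pi> \<gamma>" and 0: "\<gamma> (0, 0) \<in> fst c"
  shows "\<exists>x y b a m. surf c \<gamma> x y b a m"
proof -
  note cm = adapted_max[OF c]
  define Q where "Q = {z. \<gamma> z \<in> fst c}"
  define x where "x = fst (snd c (\<gamma> (0, 0)))"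
  have "smooth_map standard_atlas standard_atlas {z \<in> UNIV. \<gamma> z \<in> fst c} (\<lambda>z. snd c (\<gamma> z))"
    using fs smooth_map_compose[OF std_charts atlas_charts[OF E] fde _ smooth_map_chart[OF atlas_charts[OF E] cm]]
    unfolding fiber_surface_def by blast
  then have Q: "open Q" "smooth_on Q (\<lambda>z. snd c (\<gamma> z))" unfolding smooth_map_standard by (simp_all add: Q_def)
  have x: "fst (snd c (\<gamma> z)) = x" if "z \<in> Q" for z
    using proj_eq_iff[OF c _ 0, of "\<gamma> z"] fs that unfolding fiber_surface_def Q_def x_def by blast
  then have eq: "(x, snd (snd c (\<gamma> z))) = snd c (\<gamma> z)" if "z \<in> Q" for z using that by (metis prod.collapse)
  have "surf c \<gamma> x (snd (snd c (\<gamma> (0, 0)))) (FD (\<lambda>z. snd (snd c (\<gamma> z))) (0, 0) (0, 1))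
    (FD (\<lambda>z. snd (snd c (\<gamma> z))) (0, 0) (1, 0)) (FD (\<lambda>z. FD (\<lambda>z. snd (snd c (\<gamma> z))) z (0, 1)) (0, 0) (1, 0))"
  proof (rule surfI[OF c Q(1) _ smooth_on_snd[OF Q] _ _ fs])
    show "(0, 0) \<in> Q" using 0 by (simp add: Q_def)
    fix z assume z: "z \<in> Q"
    then have i: "\<gamma> z \<in> fst c" by (simp add: Q_def)
    show "\<gamma> z = cinv c (x, snd (snd c (\<gamma> z)))"
      unfolding eq[OF z] using cinv_chart[OF max_chart[OF cm] i] by simp
    show "(x, snd (snd c (\<gamma> z))) \<in> cimg c" unfolding eq[OF z] using i by (rule imageI)
  qed
  then show ?thesis by blast
qed

text \<open>The coordinates of a surface can be recovered from its velocity, so everything recorded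
  in \<open>surf\<close> is independent of the representing surface. This is the uniqueness half of
  the definite descriptions on the second vertical bundle.\<close>

lemma surf_of_velocity:
  assumes c: "c \<in> AC" and u: "(x, y) \<in> cimg c" and fs: "fiber_surface E \<pi> \<gamma>"
    and eq: "xi c x y b a m = surface_velocity M E \<pi> \<gamma>"
  shows "surf c \<gamma> x y b a m"
proof -
  have "\<gamma> (0, 0) \<in> carrier E" using fs smooth_map_in[of _ E UNIV \<gamma> "(0, 0)"] unfolding fiber_surface_def by blast
  then obtain c' where c': "c' \<in> AC" "\<gamma> (0, 0) \<in> fst c'" using adapted_exists by blast
  then obtain x' y' b' a' m' where s: "surf c' \<gamma> x' y' b' a' m'" using surf_of_fiber_surface fs by blast
  then have u': "(x', y') \<in> cimg c'" and sv: "surface_velocity M E \<pi> \<gamma> = xi c' x' y' b' a' m'"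
    and g: "\<gamma> (0, 0) = cinv c' (x', y')"
    unfolding surf_def by blast+
  \<comment> \<open>Two applications of \<open>base\<close> give the foot point in \<open>E\<close>.
    This places the surface in the domain of \<open>c\<close> before its coordinates there are
    compared.\<close>
  have "base (base (xi c x y b a m)) = base (base (xi c' x' y' b' a' m'))" using eq sv by simp
  then have "cinv c (x, y) = cinv c' (x', y')"
    unfolding base_xi[OF c u] base_xi[OF c'(1) u'] base_tvec[OF E adapted_max[OF c] u]
      base_tvec[OF E adapted_max[OF c'(1)] u'] .
  then have "\<gamma> (0, 0) \<in> fst c" using cinv_in[OF u] g by simp
  then obtain x'' y'' b'' a'' m'' where s2: "surf c \<gamma> x'' y'' b'' a'' m''" using surf_of_fiber_surface[OF c fs] by blast
  from s2 have i: "(x'', y'') \<in> cimg c" and sv: "surface_velocity M E \<pi> \<gamma> = xi c x'' y'' b'' a'' m''"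
    unfolding surf_def by blast+
  have "x = x'' \<and> y = y'' \<and> b = b'' \<and> a = a'' \<and> m = m''"
    using trans[OF eq sv] unfolding xi_eq_iff[OF c u i] .
  then show ?thesis using s2 by simp
qed

end

section \<open>Involution, double projection and affine difference\<close>

text \<open>A bounded function with value \<open>0\<close> and derivative \<open>1\<close> at \<open>0\<close>. It replaces the parameter of a
  straight line in a chart, which would leave the chart domain.\<close>

definition wave :: "real \<Rightarrow> real \<Rightarrow> real" where
  "wave \<delta> t = \<delta> * sin (t / \<delta>)"

lemma wave_0 [simp]: "wave \<delta> 0 = 0"
  by (simp add: wave_def)

lemma wave_bound: "\<delta> > 0 \<Longrightarrow> \<bar>wave \<delta> t\<bar> \<le> \<delta>"
  by (simp add: wave_def abs_mult mult_left_le)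

lemma wave_derivative: "\<delta> > 0 \<Longrightarrow> (wave \<delta> has_derivative (\<lambda>r. cos (t / \<delta>) * r)) (at t)"
  unfolding wave_def by (auto intro!: derivative_eq_intros)

lemma wave_derivative_0: "\<delta> > 0 \<Longrightarrow> (wave \<delta> has_derivative (\<lambda>r. r)) (at 0)"
  using wave_derivative[of \<delta> 0] by simp

lemma smooth_on_wave:
  assumes "open S" "smooth_on S f"
  shows "smooth_on S (\<lambda>x. wave \<delta> (f x))"
proof -
  have "smooth_on S (\<lambda>x. f x / \<delta>)" using smooth_on_linear[OF assms(1) bounded_linear_divide assms(2)] .
  from smooth_on_compose[OF findim_real assms(1) this subset_UNIV smooth_on_sin]
  show ?thesis unfolding wave_def by (rule smooth_on_linear[OF assms(1) bounded_linear_mult_right])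
qed

context fibration
begin

text \<open>The existence half. The model is the polynomial surface
  \<open>y + t a + \<epsilon> b + t \<epsilon> m\<close>; as fiber surfaces are defined on the whole
  plane, \<open>wave \<delta>\<close> takes the place of both parameters and confines the surface to
  the chart.\<close>

lemma surf_exists:
  assumes c: "c \<in> AC" and u: "(x, y) \<in> cimg c"
  shows "\<exists>\<gamma>. surf c \<gamma> x y b a m"
proof -
  note cm = adapted_max[OF c]
  define k where "k = (\<lambda>z :: real \<times> real. (x, y + fst z *\<^sub>R a + snd z *\<^sub>R b + (fst z * snd z) *\<^sub>R m))"
  have "open (k -` cimg c)"
    unfolding k_def by (intro open_vimage chart_open[OF max_chart[OF cm]] continuous_intros)
  moreover have "(0, 0) \<in> k -` cimg c" using u by (simp add: k_def)
  ultimately obtain r where r: "r > 0" "ball (0, 0) r \<subseteq> k -` cimg c" using openE by blast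
  \<comment> \<open>Both waves are bounded by \<open>\<delta>\<close>, and
    \<open>2 * \<delta> < r\<close> keeps the pair of them in the ball.\<close>
  define \<delta> where "\<delta> = r / 3"
  have \<delta>: "\<delta> > 0" using r by (simp add: \<delta>_def)
  define h where "h z = y + wave \<delta> (fst z) *\<^sub>R a + wave \<delta> (snd z) *\<^sub>R b + (wave \<delta> (fst z) * wave \<delta> (snd z)) *\<^sub>R m" for z
  have kin: "(x, h z) \<in> cimg c" for z
  proof -
    have "norm (wave \<delta> (fst z), wave \<delta> (snd z)) \<le> \<bar>wave \<delta> (fst z)\<bar> + \<bar>wave \<delta> (snd z)\<bar>"
      using norm_Pair_le[of "wave \<delta> (fst z)" "wave \<delta> (snd z)"] by simp
    also have "\<dots> \<le> \<delta> + \<delta>" using wave_bound[OF \<delta>] by (intro add_mono)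
    also have "\<dots> < r" using r by (simp add: \<delta>_def)
    finally have "norm ((0, 0) - (wave \<delta> (fst z), wave \<delta> (snd z))) < r"
      by (simp add: norm_minus_commute norm_Pair)
    then have "(wave \<delta> (fst z), wave \<delta> (snd z)) \<in> ball (0, 0) r" by (simp add: dist_norm)
    then show ?thesis using r(2) by (auto simp: k_def h_def)
  qed
  have wf: "smooth_on UNIV (\<lambda>z :: real \<times> real. wave \<delta> (fst z))" "smooth_on UNIV (\<lambda>z :: real \<times> real. wave \<delta> (snd z))"
    by (intro smooth_on_wave open_UNIV smooth_on_fst smooth_on_snd smooth_on_ident)+
  have hs: "smooth_on UNIV h"
    unfolding h_def scaleR_scaleR[symmetric]
    by (intro smooth_on_add smooth_on_scaleR smooth_on_const wf open_UNIV)
  have wd: "((\<lambda>z. wave \<delta> (fst z)) has_derivative (\<lambda>v. cos (fst z / \<delta>) * fst v)) (at z)"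
    "((\<lambda>z. wave \<delta> (snd z)) has_derivative (\<lambda>v. cos (snd z / \<delta>) * snd v)) (at z)" for z :: "real \<times> real"
    by (rule has_derivative_compose[OF has_derivative_fst[OF has_derivative_ident] wave_derivative[OF \<delta>]],
        rule has_derivative_compose[OF has_derivative_snd[OF has_derivative_ident] wave_derivative[OF \<delta>]])
  have dh: "FD h z v = (cos (fst z / \<delta>) * fst v) *\<^sub>R a + (cos (snd z / \<delta>) * snd v) *\<^sub>R b +
      (wave \<delta> (fst z) * (cos (snd z / \<delta>) * snd v) + cos (fst z / \<delta>) * fst v * wave \<delta> (snd z)) *\<^sub>R m" for z v
  proof -
    have "(h has_derivative (\<lambda>v. (cos (fst z / \<delta>) * fst v) *\<^sub>R a + (cos (snd z / \<delta>) * snd v) *\<^sub>R b +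
      (wave \<delta> (fst z) * (cos (snd z / \<delta>) * snd v) + cos (fst z / \<delta>) * fst v * wave \<delta> (snd z)) *\<^sub>R m)) (at z)"
      unfolding h_def by (rule derivative_eq_intros wd refl)+ simp
    then show ?thesis by (simp add: FD_eqI)
  qed
  \<comment> \<open>The cosine factor is stationary at the origin and adds nothing to the mixed
    derivative, which is then exactly \<open>m\<close>.\<close>
  have cd: "((\<lambda>z :: real \<times> real. cos (snd z / \<delta>)) has_derivative (\<lambda>v. 0)) (at (0, 0))"
    using \<delta> by (auto intro!: derivative_eq_intros)
  have "((\<lambda>z. cos (snd z / \<delta>) *\<^sub>R b + (wave \<delta> (fst z) * cos (snd z / \<delta>)) *\<^sub>R m) has_derivative (\<lambda>v. fst v *\<^sub>R m)) (at (0, 0))"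
    by (rule derivative_eq_intros wd cd refl)+ simp
  moreover have "(\<lambda>z. FD h z (0, 1)) = (\<lambda>z. cos (snd z / \<delta>) *\<^sub>R b + (wave \<delta> (fst z) * cos (snd z / \<delta>)) *\<^sub>R m)"
    unfolding dh by simp
  ultimately have mix: "mixed h = m" by (simp add: FD_eqI)
  have "smooth_on UNIV (\<lambda>z. (x, h z))" by (intro smooth_on_Pair open_UNIV smooth_on_const hs)
  then have "smooth_map standard_atlas standard_atlas UNIV (\<lambda>z. (x, h z))" unfolding smooth_map_standard by simp
  from smooth_map_comp[OF std_charts std_charts fde this smooth_map_cinv[OF cm]]
  have "smooth_map standard_atlas E UNIV (\<lambda>z. cinv c (x, h z))" using kin by (simp add: image_subset_iff)
  then have fs: "fiber_surface E \<pi> (\<lambda>z. cinv c (x, h z))"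
    unfolding fiber_surface_def using proj_chart_eq[OF c kin kin] by simp
  have "surf c (\<lambda>z. cinv c (x, h z)) x (h (0, 0)) (FD h (0, 0) (0, 1)) (FD h (0, 0) (1, 0))
      (mixed h)"
    by (rule surfI[OF c open_UNIV UNIV_I hs refl kin fs])
  moreover have "h (0, 0) = y" "FD h (0, 0) (0, 1) = b" "FD h (0, 0) (1, 0) = a"
    unfolding dh by (simp_all add: h_def)
  ultimately show ?thesis unfolding mix by auto
qed

lemma surf_velocity: "surf c \<gamma> x y b a m \<Longrightarrow> fiber_surface E \<pi> \<gamma> \<and> xi c x y b a m = surface_velocity M E \<pi> \<gamma>"
  unfolding surf_def by simp

text \<open>A surface with the given coordinates exists, and every surface with this velocity has
  these coordinates, which also fixes the velocity after the exchange of parameters. The double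
  projection is evaluated in the same manner.\<close>

lemma involution_xi:
  assumes c: "c \<in> AC" and u: "(x, y) \<in> cimg c"
  shows "involution M E \<pi> (xi c x y b a m) = xi c x y a b m"
  unfolding involution_def
proof (rule the_equality)
  let ?B = "\<lambda>\<eta>. \<exists>\<gamma>. fiber_surface E \<pi> \<gamma> \<and> xi c x y b a m = surface_velocity M E \<pi> \<gamma> \<and>
      \<eta> = surface_velocity M E \<pi> (\<lambda>(t, \<epsilon>). \<gamma> (\<epsilon>, t))"
  obtain \<gamma> where "surf c \<gamma> x y b a m" using surf_exists[OF c u] by blast
  then show "?B (xi c x y a b m)"
    unfolding surf_def by auto
  fix \<eta> assume "?B \<eta>"
  then obtain \<gamma> where g: "fiber_surface E \<pi> \<gamma>" "xi c x y b a m = surface_velocity M E \<pi> \<gamma>"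
    "\<eta> = surface_velocity M E \<pi> (\<lambda>(t, \<epsilon>). \<gamma> (\<epsilon>, t))" by blast
  show "\<eta> = xi c x y a b m"
    using surf_of_velocity[OF c u g(1,2)] g(3) unfolding surf_def by simp
qed

lemma double_projection_xi:
  assumes c: "c \<in> AC" and u: "(x, y) \<in> cimg c"
  shows "double_projection M E \<pi> (xi c x y b a m) = (tvec E c (x, y) (0, b), tvec E c (x, y) (0, a))"
  unfolding double_projection_def
proof (rule the_equality)
  let ?B = "\<lambda>vw. \<exists>\<gamma>. fiber_surface E \<pi> \<gamma> \<and> xi c x y b a m = surface_velocity M E \<pi> \<gamma> \<and>
      vw = (velocity E (\<lambda>\<epsilon>. \<gamma> (0, \<epsilon>)), velocity E (\<lambda>t. \<gamma> (t, 0)))"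
  obtain \<gamma> where "surf c \<gamma> x y b a m" using surf_exists[OF c u] by blast
  then show "?B (tvec E c (x, y) (0, b), tvec E c (x, y) (0, a))"
    unfolding surf_def by auto
  fix vw assume "?B vw"
  then obtain \<gamma> where g: "fiber_surface E \<pi> \<gamma>" "xi c x y b a m = surface_velocity M E \<pi> \<gamma>"
    "vw = (velocity E (\<lambda>\<epsilon>. \<gamma> (0, \<epsilon>)), velocity E (\<lambda>t. \<gamma> (t, 0)))" by blast
  show "vw = (tvec E c (x, y) (0, b), tvec E c (x, y) (0, a))"
    using surf_of_velocity[OF c u g(1,2)] g(3) unfolding surf_def by simp
qed

lemma fiber_transition:
  assumes c: "c \<in> AC" and c': "c' \<in> AC" and u: "(x, y) \<in> cimg c" "cinv c (x, y) \<in> fst c'"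
  shows "((\<lambda>y. snd (snd c' (cinv c (x, y)))) has_derivative
     (\<lambda>w. snd (FD (\<lambda>u. snd c' (cinv c u)) (x, y) (0, w)))) (at y)"
proof -
  have "((\<lambda>y. (x, y)) has_derivative (\<lambda>w. (0, w))) (at y)" by (auto intro!: derivative_eq_intros)
  from has_derivative_compose[OF this transition_deriv[OF E adapted_max[OF c] adapted_max[OF c'] u]]
  show ?thesis by (rule has_derivative_snd)
qed

text \<open>The quadratic terms of the two mixed coordinates coincide, as both elements share
  \<open>a\<close> and \<open>b\<close>. What remains transforms by the derivative of the fiber
  transition, just as the fiber component of a vertical vector does.\<close>

lemma affine_diff_xi:
  assumes c: "c \<in> AC" and u: "(x, y) \<in> cimg c"
  shows "affine_diff M E \<pi> (xi c x y b a m) (xi c x y b a m') = tvec E c (x, y) (0, m - m')"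
  unfolding affine_diff_def
proof (rule the_equality)
  note cm = adapted_max[OF c]
  let ?H = "\<lambda>\<gamma> \<delta>. fiber_surface E \<pi> \<gamma> \<and> xi c x y b a m = surface_velocity M E \<pi> \<gamma> \<and>
     fiber_surface E \<pi> \<delta> \<and> xi c x y b a m' = surface_velocity M E \<pi> \<delta>"
  let ?C = "\<lambda>w \<gamma> \<delta>. w \<in> vertical_space M E \<pi> (\<gamma> (0, 0)) \<and>
       (\<forall>c'\<in>charts_at AC (\<gamma> (0, 0)). snd (deriv_along w (snd c')) = mixed_coord c' \<gamma> - mixed_coord c' \<delta>)"
  let ?\<psi> = "\<lambda>c' y. snd (snd c' (cinv c (x, y)))"
  have mixed: "mixed_coord c' \<gamma> - mixed_coord c' \<delta> = snd (deriv_along (tvec E c (x, y) (0, m - m')) (snd c'))"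
    if "surf c \<gamma> x y b a m" "surf c \<delta> x y b a m'" "c' \<in> charts_at AC (\<gamma> (0, 0))" for \<gamma> \<delta> c'
  proof -
    have c': "c' \<in> AC" and i: "\<gamma> (0, 0) \<in> fst c'" and g: "\<gamma> (0, 0) = cinv c (x, y)" "\<delta> (0, 0) = cinv c (x, y)"
      using that unfolding charts_at_def surf_def by auto
    have "mixed_coord c' \<gamma> = FD (\<lambda>y. FD (?\<psi> c') y b) y a + FD (?\<psi> c') y m"
      "mixed_coord c' \<delta> = FD (\<lambda>y. FD (?\<psi> c') y b) y a + FD (?\<psi> c') y m'"
      using that(1,2) c' i g unfolding surf_def by auto
    then have "mixed_coord c' \<gamma> - mixed_coord c' \<delta> = FD (?\<psi> c') y m - FD (?\<psi> c') y m'" by simp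
    also have "\<dots> = snd (FD (\<lambda>u. snd c' (cinv c u)) (x, y) (0, m - m'))"
    proof -
      have "cinv c (x, y) \<in> fst c'" using i g by simp
      note ft = fiber_transition[OF c c' u this]
      show ?thesis using linear_diff[OF has_derivative_linear[OF ft]] unfolding FD_eqI[OF ft] by simp
    qed
    also have "\<dots> = snd (deriv_along (tvec E c (x, y) (0, m - m')) (snd c'))"
      using deriv_along_tvec[OF E cm u transition_deriv[OF E cm adapted_max[OF c'] u]] i g by simp
    finally show ?thesis .
  qed
  show "\<forall>\<gamma> \<delta>. ?H \<gamma> \<delta> \<longrightarrow> ?C (tvec E c (x, y) (0, m - m')) \<gamma> \<delta>"
  proof (intro allI impI)
    fix \<gamma> \<delta> assume h: "?H \<gamma> \<delta>"
    then have s: "surf c \<gamma> x y b a m" "surf c \<delta> x y b a m'" using surf_of_velocity[OF c u] by blast+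
    have "\<gamma> (0, 0) = cinv c (x, y)" using s(1) unfolding surf_def by blast
    then show "?C (tvec E c (x, y) (0, m - m')) \<gamma> \<delta>"
      using vertical_tvec_iff[OF c u] mixed[OF s] by simp
  qed
  fix w assume w: "\<forall>\<gamma> \<delta>. ?H \<gamma> \<delta> \<longrightarrow> ?C w \<gamma> \<delta>"
  \<comment> \<open>The defining condition is an implication over all representing pairs, so an
    actual pair of surfaces is needed before it says anything about \<open>w\<close>.\<close>
  obtain \<gamma> \<delta> where s: "surf c \<gamma> x y b a m" "surf c \<delta> x y b a m'" using surf_exists[OF c u] by metis
  have g: "\<gamma> (0, 0) = cinv c (x, y)" using s(1) unfolding surf_def by blast
  have cc: "c \<in> charts_at AC (\<gamma> (0, 0))" using c cinv_in[OF u] g unfolding charts_at_def by simp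
  have "?H \<gamma> \<delta>"
    using surf_velocity[OF s(1)] surf_velocity[OF s(2)] by blast
  from w[THEN spec, THEN spec, THEN mp, OF this]
  have w1: "w \<in> vertical_space M E \<pi> (cinv c (x, y))"
    and w2: "snd (deriv_along w (snd c)) = mixed_coord c \<gamma> - mixed_coord c \<delta>"
    using cc unfolding g by blast+
  have "w \<in> tangent_space E (cinv c (x, y))" using w1 unfolding vertical_space_def by blast
  then have w3: "w = tvec E c (x, y) (deriv_along w (snd c))"
    using tspace_eq_tvec(1)[OF E cm cinv_in[OF u]] chart_cinv[OF u] by simp
  have "fst (deriv_along w (snd c)) = 0" using w1 w3 vertical_tvec_iff[OF c u] by metis
  moreover have "snd (deriv_along w (snd c)) = m - m'"
    unfolding w2 mixed[OF s cc] deriv_along_tvec_self[OF E cm u] by simp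
  ultimately have "deriv_along w (snd c) = (0, m - m')" by (simp add: prod_eq_iff)
  then show "w = tvec E c (x, y) (0, m - m')" using w3 by simp
qed

end

section \<open>The connection in adapted charts\<close>

lemma vector_field_coords:
  fixes A :: "('a, 'e::real_inner) atlas"
  assumes A: "smooth_atlas A" and X: "vector_field_on A W X" and c: "c \<in> maximal_atlas A"
  shows "open {u \<in> cimg c. cinv c u \<in> W}"
    and "smooth_on {u \<in> cimg c. cinv c u \<in> W} (\<lambda>u. deriv_along (X (cinv c u)) (snd c))"
    and "\<And>u. u \<in> {u \<in> cimg c. cinv c u \<in> W} \<Longrightarrow>
      X (cinv c u) = tvec A c u (deriv_along (X (cinv c u)) (snd c))"
proof -
  let ?W = "{u \<in> cimg c. cinv c u \<in> W}"
  have sX: "smooth_map A (tangent_atlas A) W X" and tX: "\<And>p. p \<in> W \<Longrightarrow> X p \<in> tangent_space A p"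
    using X unfolding vector_field_on_def by auto
  have b: "X (cinv c u) \<in> fst (tchart A c)" if "u \<in> ?W" for u
    using that tX[of "cinv c u"] cinv_in[of u c] smooth_map_in[OF sX] tangent_space_base[OF tX]
    unfolding tchart_def carrier_tangent_atlas by simp
  then have eq: "{u \<in> cimg c. cinv c u \<in> W \<and> X (cinv c u) \<in> fst (tchart A c)} = ?W" by blast
  note r = local_rep[OF A atlas_tangent[OF A] sX c tchart_in_maximal[OF A c], unfolded eq]
  show o: "open ?W" by (rule r(1))
  show "smooth_on ?W (\<lambda>u. deriv_along (X (cinv c u)) (snd c))"
    using smooth_on_snd[OF o r(2)] unfolding tchart_def by simp
  show "X (cinv c u) = tvec A c u (deriv_along (X (cinv c u)) (snd c))" if "u \<in> ?W" for u
    using that tspace_eq_tvec(1)[OF A c cinv_in[of u c] tX[of "cinv c u"]] chart_cinv[of u c] by simp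
qed

text \<open>Extends a tangent vector by constant coordinates. Such extensions make the description
  of \<open>curvature\<close> at a point nonvacuous.\<close>

lemma constant_vector_field:
  fixes A :: "('a, 'e::real_inner) atlas"
  assumes A: "smooth_atlas A" and c: "c \<in> maximal_atlas A"
  shows "vector_field_on A (fst c) (\<lambda>q. tvec A c (snd c q) \<xi>)"
  unfolding vector_field_on_def
proof (intro conjI ballI)
  note fd = atlas_findim[OF A]
  let ?V = "cimg c"
  have V: "open ?V" using chart_open[OF max_chart[OF c]] .
  show "openin (atlas_topology A) (fst c)" using openin_chart_domain[OF A c] .
  show "tvec A c (snd c p) \<xi> \<in> tangent_space A p" if "p \<in> fst c" for p
    using tvec_in_tspace[OF A c, of "snd c p"] that cinv_chart[OF max_chart[OF c] that] by simp
  have sp: "smooth_map standard_atlas standard_atlas ?V (\<lambda>u. (u, \<xi>))"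
    unfolding smooth_map_standard by (intro conjI V smooth_on_Pair smooth_on_ident smooth_on_const)
  have st: "smooth_map standard_atlas (tangent_atlas A) (?V \<times> UNIV) (cinv (tchart A c))"
    using smooth_map_cinv[OF tchart_in_maximal[OF A c]] unfolding tchart_image[OF A c] .
  have "smooth_map standard_atlas (tangent_atlas A) ?V (\<lambda>u. cinv (tchart A c) (u, \<xi>))"
    by (rule smooth_map_comp[OF std_charts std_charts findim_prod[OF fd fd] sp st]) auto
  then have "smooth_map standard_atlas (tangent_atlas A) ?V (\<lambda>u. tvec A c u \<xi>)"
    by (rule smooth_map_cong[OF std_charts]) (use tchart_cinv[OF A c] in auto)
  from smooth_map_comp[OF atlas_charts[OF A] std_charts fd
      smooth_map_chart[OF atlas_charts[OF A] c] this subset_refl]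
  show "smooth_map A (tangent_atlas A) (fst c) (\<lambda>q. tvec A c (snd c q) \<xi>)" .
qed

text \<open>A derivative is determined along lines, and along a line in direction \<open>v\<close> a
  linear map is affine with slope \<open>L v\<close>. It is used to see that differentiating the
  connection coefficients in their linear argument returns them.\<close>

lemma linear_derivative_eq:
  assumes L: "linear L" and d: "(L has_derivative L') (at x)"
  shows "L' = L"
proof
  fix v
  have "((\<lambda>t::real. x + t *\<^sub>R v) has_derivative (\<lambda>t. t *\<^sub>R v)) (at 0)"
    by (auto intro!: derivative_eq_intros)
  moreover have "(L has_derivative L') (at (x + 0 *\<^sub>R v))" using d by simp
  ultimately have "((\<lambda>t. L (x + t *\<^sub>R v)) has_derivative (\<lambda>t. L' (t *\<^sub>R v))) (at 0)"
    by (rule has_derivative_compose)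
  moreover have "(\<lambda>t. L (x + t *\<^sub>R v)) = (\<lambda>t. L x + t *\<^sub>R L v)"
    using L by (simp add: linear_add linear_cmul)
  moreover have "((\<lambda>t. L x + t *\<^sub>R L v) has_derivative (\<lambda>t. t *\<^sub>R L v)) (at 0)"
    by (auto intro!: derivative_eq_intros)
  ultimately have "(\<lambda>t. L' (t *\<^sub>R v)) = (\<lambda>t. t *\<^sub>R L v)"
    using has_derivative_unique by metis
  from fun_cong[OF this, of 1] show "L' v = L v" by simp
qed

lemma tangent_bundle_of_tvec:
  assumes "smooth_atlas A" "c \<in> maximal_atlas A" "u \<in> cimg c"
  shows "tvec A c u \<xi> \<in> tangent_bundle A"
  using tchart_tvec(1)[OF assms] unfolding tchart_def by simp

locale fibration_connection = fibration M E \<pi>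
  for M :: "('a, 'm::real_inner) atlas" and E :: "('b, 'm \<times> 'f::real_inner) atlas" and \<pi> :: "'b \<Rightarrow> 'a" +
  fixes P :: "'b tangent \<Rightarrow> 'b tangent"
  assumes conn: "nonlinear_connection M E \<pi> P"
begin

text \<open>The connection coefficients: \<open>P\<close> maps the coordinates \<open>(a, w)\<close> at \<open>u\<close> to
  \<open>(0, w + G c u a)\<close>.\<close>

definition G :: "('b, 'm \<times> 'f) chart \<Rightarrow> 'm \<times> 'f \<Rightarrow> 'm \<Rightarrow> 'f" where
  "G c u a = snd (deriv_along (P (tvec E c u (a, 0))) (snd c))"

lemma conn_at:
  assumes e: "e \<in> carrier E" and v: "v \<in> tangent_space E e"
  shows "P v \<in> tangent_space E e" "P v \<in> vertical_space M E \<pi> e"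
    "P (tscale E r v) = tscale E r (P v)"
    "w \<in> tangent_space E e \<Longrightarrow> P (tadd E v w) = tadd E (P v) (P w)"
    "v \<in> vertical_space M E \<pi> e \<Longrightarrow> P v = v"
proof -
  have all: "(\<forall>v\<in>tangent_space E e. P v \<in> tangent_space E e) \<and>
        (\<forall>v\<in>tangent_space E e. \<forall>w\<in>tangent_space E e. P (tadd E v w) = tadd E (P v) (P w)) \<and>
        (\<forall>v\<in>tangent_space E e. \<forall>r. P (tscale E r v) = tscale E r (P v)) \<and>
        (\<forall>v\<in>tangent_space E e. P (P v) = P v) \<and>
        P ` tangent_space E e = vertical_space M E \<pi> e"
    using conn[unfolded nonlinear_connection_def, THEN conjunct2, THEN bspec, OF e] .
  show "P v \<in> tangent_space E e" using all v by simp
  show "P v \<in> vertical_space M E \<pi> e" using all imageI[OF v, of P] by simp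
  show "P (tscale E r v) = tscale E r (P v)" using all v by simp
  show "P (tadd E v w) = tadd E (P v) (P w)" if "w \<in> tangent_space E e" using all v that by simp
  \<comment> \<open>The vertical space is the image of \<open>P\<close> and \<open>P\<close> is
    idempotent, so \<open>P\<close> fixes it pointwise.\<close>
  show "P v = v" if "v \<in> vertical_space M E \<pi> e"
  proof -
    have "v \<in> P ` tangent_space E e" using all that by simp
    then obtain w where "v = P w" "w \<in> tangent_space E e" by (rule imageE)
    then show ?thesis using all by simp
  qed
qed

section \<open>The connection coefficients and their derivatives\<close>

context
  fixes c assumes c: "c \<in> AC"
begin

lemma P_tvec_deriv:
  assumes u: "u \<in> cimg c"
  shows "P (tvec E c u \<xi>) = tvec E c u (deriv_along (P (tvec E c u \<xi>)) (snd c))"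
    and "fst (deriv_along (P (tvec E c u \<xi>)) (snd c)) = 0"
proof -
  note cm = adapted_max[OF c]
  have e: "cinv c u \<in> carrier E" using smooth_map_in[OF smooth_map_cinv[OF cm] u] .
  note ca = conn_at[OF e tvec_in_tspace[OF E cm u]]
  show 1: "P (tvec E c u \<xi>) = tvec E c u (deriv_along (P (tvec E c u \<xi>)) (snd c))"
    using tspace_eq_tvec(1)[OF E cm cinv_in[OF u] ca(1)] chart_cinv[OF u] by simp
  show "fst (deriv_along (P (tvec E c u \<xi>)) (snd c)) = 0"
    using ca(2)[of \<xi>] vertical_tvec_iff[OF c u, of "deriv_along (P (tvec E c u \<xi>)) (snd c)"] 1 by simp
qed

text \<open>\<open>(a, w)\<close> is split into \<open>(a, 0)\<close>, which defines
  \<open>G\<close>, and the vertical part \<open>(0, w)\<close>, which \<open>P\<close>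
  fixes.\<close>

lemma P_tvec:
  assumes u: "u \<in> cimg c"
  shows "P (tvec E c u (a, w)) = tvec E c u (0, w + G c u a)"
proof -
  note cm = adapted_max[OF c]
  have e: "cinv c u \<in> carrier E" using smooth_map_in[OF smooth_map_cinv[OF cm] u] .
  note ca = conn_at[OF e tvec_in_tspace[OF E cm u]]
  have 1: "P (tvec E c u (a, 0)) = tvec E c u (0, G c u a)"
    using P_tvec_deriv[OF u, of "(a, 0)"] unfolding G_def by (metis prod.collapse)
  have 2: "P (tvec E c u (0, w)) = tvec E c u (0, w)"
    using ca(5)[of "(0, w)"] vertical_tvec_iff[OF c u, of "(0, w)"] by simp
  have "tvec E c u (a, w) = tadd E (tvec E c u (a, 0)) (tvec E c u (0, w))"
    unfolding tadd_tvec[OF E cm u] by simp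
  then have "P (tvec E c u (a, w)) = tadd E (P (tvec E c u (a, 0))) (P (tvec E c u (0, w)))"
    using ca(4)[OF tvec_in_tspace[OF E cm u]] by simp
  also have "\<dots> = tvec E c u (0, w + G c u a)" unfolding 1 2 tadd_tvec[OF E cm u] by (simp add: add.commute)
  finally show ?thesis .
qed

lemma linear_G:
  assumes u: "u \<in> cimg c"
  shows "linear (G c u)"
proof -
  note cm = adapted_max[OF c]
  have e: "cinv c u \<in> carrier E" using smooth_map_in[OF smooth_map_cinv[OF cm] u] .
  note ca = conn_at[OF e tvec_in_tspace[OF E cm u]]
  have P0: "P (tvec E c u (a, 0)) = tvec E c u (0, G c u a)" for a using P_tvec[OF u, of a 0] by simp
  show ?thesis
  proof (rule linearI)
    fix a b
    have "P (tvec E c u (a + b, 0)) = tadd E (P (tvec E c u (a, 0))) (P (tvec E c u (b, 0)))"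
      using ca(4)[OF tvec_in_tspace[OF E cm u], of "(a, 0)" "(b, 0)"] unfolding tadd_tvec[OF E cm u] by simp
    then show "G c u (a + b) = G c u a + G c u b"
      unfolding P0 tadd_tvec[OF E cm u] tvec_eq_iff[OF E cm u u] by simp
  next
    fix r a
    have "P (tvec E c u (r *\<^sub>R a, 0)) = tscale E r (P (tvec E c u (a, 0)))"
      using ca(3)[of r "(a, 0)"] unfolding tscale_tvec[OF E cm u] by simp
    then show "G c u (r *\<^sub>R a) = r *\<^sub>R G c u a"
      unfolding P0 tscale_tvec[OF E cm u] tvec_eq_iff[OF E cm u u] by simp
  qed
qed

lemma hor_tvec:
  assumes u: "u \<in> cimg c"
  shows "hor E P (tvec E c u (a, w)) = tvec E c u (a, - G c u a)"
  unfolding hor_def P_tvec[OF u] tdiff_tvec[OF E adapted_max[OF c] u] by simp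

abbreviation gdom :: "(('m \<times> 'f) \<times> 'm) set" where
  "gdom \<equiv> cimg c \<times> UNIV"

lemma open_gdom: "open gdom"
  using chart_open[OF max_chart[OF adapted_max[OF c]]] by (simp add: open_Times)

text \<open>\<open>G\<close> is the fiber component of \<open>P\<close>, read in tangent charts
  along the slice where the fiber component of the argument is \<open>0\<close>; smoothness of
  \<open>P\<close> as a self-map of the tangent bundle passes to it.\<close>

lemma smooth_G: "smooth_on gdom (\<lambda>z. G c (fst z) (snd z))"
proof -
  note cm = adapted_max[OF c]
  let ?T = "tchart E c"
  have sP: "smooth_map (tangent_atlas E) (tangent_atlas E) (tangent_bundle E) P"
    using conn unfolding nonlinear_connection_def by blast
  let ?D = "cimg c \<times> (UNIV :: ('m \<times> 'f) set)"
  have mem: "cinv ?T z \<in> tangent_bundle E \<and> P (cinv ?T z) \<in> fst ?T" if "z \<in> ?D" for z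
  proof -
    have u: "fst z \<in> cimg c" using that by auto
    show ?thesis
      unfolding tchart_cinv[OF E cm that]
      using tchart_tvec(1)[OF E cm u] tangent_bundle_of_tvec[OF E cm u]
      by (subst P_tvec_deriv(1)[OF u, of "snd z"]) blast
  qed
  then have eq: "{z \<in> cimg ?T. cinv ?T z \<in> tangent_bundle E \<and> P (cinv ?T z) \<in> fst ?T} = ?D"
    unfolding tchart_image[OF E cm] by blast
  note r = local_rep[OF atlas_tangent[OF E] atlas_tangent[OF E] sP
      tchart_in_maximal[OF E cm] tchart_in_maximal[OF E cm], unfolded eq]
  have f: "smooth_on gdom (\<lambda>z. (fst z, (snd z, 0::'f)))"
    by (intro smooth_on_Pair open_gdom smooth_on_fst smooth_on_snd smooth_on_ident smooth_on_const)
  have "smooth_on gdom (\<lambda>z. snd ?T (P (cinv ?T (fst z, (snd z, 0::'f)))))"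
    by (rule smooth_on_compose[OF findim_prod[OF fde fde] open_gdom f _ r(2)]) auto
  then have s: "smooth_on gdom (\<lambda>z. snd (snd (snd ?T (P (cinv ?T (fst z, (snd z, 0::'f)))))))"
    by (intro smooth_on_snd open_gdom)
  show ?thesis
  proof (rule smooth_on_cong[OF open_gdom s])
    fix z assume "z \<in> gdom"
    then have "(fst z, (snd z, 0)) \<in> ?D" by auto
    then show "snd (snd (snd ?T (P (cinv ?T (fst z, (snd z, 0::'f)))))) = G c (fst z) (snd z)"
      unfolding G_def by (subst tchart_cinv[OF E cm]) (simp_all add: tchart_def)
  qed
qed

definition DG :: "'m \<times> 'f \<Rightarrow> 'm \<Rightarrow> 'm \<times> 'f \<Rightarrow> 'f" where
  "DG u a v = FD (\<lambda>u. G c u a) u v"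

lemma has_derivative_G_base:
  assumes u: "u \<in> cimg c"
  shows "((\<lambda>u. G c u a) has_derivative DG u a) (at u)"
proof -
  have "(u, a) \<in> gdom" using u by simp
  note d = smooth_deriv[OF smooth_G this]
  have "((\<lambda>u. (u, a)) has_derivative (\<lambda>v. (v, 0))) (at u)" by (auto intro!: derivative_eq_intros)
  from has_derivative_compose[OF this d]
  have h: "((\<lambda>u. G c u a) has_derivative (\<lambda>v. FD (\<lambda>z. G c (fst z) (snd z)) (u, a) (v, 0))) (at u)" by simp
  have "DG u a = (\<lambda>v. FD (\<lambda>z. G c (fst z) (snd z)) (u, a) (v, 0))"
    unfolding DG_def[abs_def] FD_eqI[OF h] ..
  then show ?thesis using h by simp
qed

lemma linear_DG: "u \<in> cimg c \<Longrightarrow> linear (DG u a)"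
  using has_derivative_G_base has_derivative_linear by blast

text \<open>The total derivative is the sum of two partial ones, and linearity of \<open>G\<close>
  in its last argument makes the corresponding partial derivative \<open>G\<close> itself.\<close>

lemma has_derivative_G:
  assumes f: "(f has_derivative f') (at x)" and g: "(g has_derivative g') (at x)"
    and u: "f x \<in> cimg c"
  shows "((\<lambda>x. G c (f x) (g x)) has_derivative (\<lambda>v. DG (f x) (g x) (f' v) + G c (f x) (g' v))) (at x)"
proof -
  let ?G = "\<lambda>z. G c (fst z) (snd z)"
  have i: "(f x, g x) \<in> gdom" using u by simp
  note d = smooth_deriv[OF smooth_G i]
  have "((\<lambda>a. (f x, a)) has_derivative (\<lambda>v. (0, v))) (at (g x))" by (auto intro!: derivative_eq_intros)
  from has_derivative_compose[OF this d]
  have 1: "((\<lambda>a. G c (f x) a) has_derivative (\<lambda>v. FD ?G (f x, g x) (0, v))) (at (g x))" by simp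
  have "((\<lambda>u. (u, g x)) has_derivative (\<lambda>v. (v, 0))) (at (f x))" by (auto intro!: derivative_eq_intros)
  from has_derivative_compose[OF this d]
  have 2: "((\<lambda>u. G c u (g x)) has_derivative (\<lambda>v. FD ?G (f x, g x) (v, 0))) (at (f x))" by simp
  have 3: "FD ?G (f x, g x) (0, v) = G c (f x) v" for v
    using fun_cong[OF linear_derivative_eq[OF linear_G[OF u] 1], of v] .
  have 4: "FD ?G (f x, g x) (v, 0) = DG (f x) (g x) v" for v
    using fun_cong[OF has_derivative_unique[OF 2 has_derivative_G_base[OF u]], of v] .
  have "((\<lambda>x. (f x, g x)) has_derivative (\<lambda>v. (f' v, g' v))) (at x)" by (rule has_derivative_Pair[OF f g])
  from has_derivative_compose[OF this d]
  have "((\<lambda>x. G c (f x) (g x)) has_derivative (\<lambda>v. FD ?G (f x, g x) (f' v, g' v))) (at x)" by simp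
  moreover have "FD ?G (f x, g x) (p, q) = DG (f x) (g x) p + G c (f x) q" for p q
    using linear_add[OF has_derivative_linear[OF d], of "(p, 0)" "(0, q)"] 3 4 by simp
  ultimately show ?thesis by simp
qed

lemma smooth_on_G:
  assumes "open S" "smooth_on S f" "f ` S \<subseteq> cimg c" "smooth_on S g"
  shows "smooth_on S (\<lambda>x. G c (f x) (g x))"
  using smooth_on_compose[OF findim_prod[OF fde fdm] assms(1) smooth_on_Pair[OF assms(1,2,4)] _ smooth_G] assms(3)
  by (auto simp: image_subset_iff)

end

text \<open>In the bracket of the horizontal parts, derivatives of \<open>X'\<close> and
  \<open>Y'\<close> appear in the base component and, through \<open>G\<close>, in the fiber
  component; applying \<open>P\<close> makes them cancel. Only values at the point survive, which is
  the tensoriality of the curvature.\<close>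

lemma curvature_field_tvec:
  assumes c: "c \<in> AC" and u: "u \<in> cimg c" "cinv c u \<in> W"
    and X: "vector_field_on E W X" and Y: "vector_field_on E W Y"
    and Xe: "X (cinv c u) = tvec E c u (a, \<alpha>)" and Ye: "Y (cinv c u) = tvec E c u (b, \<beta>)"
  shows "curvature_field E P X Y (cinv c u)
    = tvec E c u (0, DG c u b (a, - G c u a) - DG c u a (b, - G c u b))"
proof -
  note cm = adapted_max[OF c]
  define V where "V = {u \<in> cimg c. cinv c u \<in> W}"
  define X' where "X' u = deriv_along (X (cinv c u)) (snd c)" for u
  define Y' where "Y' u = deriv_along (Y (cinv c u)) (snd c)" for u
  have V: "open V" "V \<subseteq> cimg c" "u \<in> V"
    using vector_field_coords(1)[OF E X cm] u by (auto simp: V_def)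
  have X': "smooth_on V X'" "\<And>u. u \<in> V \<Longrightarrow> X (cinv c u) = tvec E c u (X' u)"
    using vector_field_coords(2,3)[OF E X cm] by (simp_all add: V_def X'_def[abs_def])
  have Y': "smooth_on V Y'" "\<And>u. u \<in> V \<Longrightarrow> Y (cinv c u) = tvec E c u (Y' u)"
    using vector_field_coords(2,3)[OF E Y cm] by (simp_all add: V_def Y'_def[abs_def])
  have Xu: "X' u = (a, \<alpha>)" and Yu: "Y' u = (b, \<beta>)"
    using Xe Ye X'(2)[OF V(3)] Y'(2)[OF V(3)] tvec_eq_iff[OF E cm u(1) u(1)] by simp_all
  have side: "(hor E P \<circ> Z) (cinv c u) = tvec E c u (fst (Z' u), - G c u (fst (Z' u)))"
      "(P \<circ> Z) (cinv c u) = tvec E c u (0, snd (Z' u) + G c u (fst (Z' u)))"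
    if "u \<in> V" "Z (cinv c u) = tvec E c u (Z' u)" for u Z Z'
    using that V(2) hor_tvec[OF c, of u "fst (Z' u)" "snd (Z' u)"] P_tvec[OF c, of u "fst (Z' u)" "snd (Z' u)"] by auto
  have sG: "smooth_on V (\<lambda>u. G c u (fst (Z' u)))" if "smooth_on V Z'" for Z' :: "'m \<times> 'f \<Rightarrow> 'm \<times> 'f"
    by (intro smooth_on_G[OF c V(1) smooth_on_ident] smooth_on_fst V that) (use V in auto)
  have dG: "((\<lambda>u. G c u (fst (Z' u))) has_derivative (\<lambda>v. DG c u (fst (Z' u)) v + G c u (fst (FD Z' u v)))) (at u)"
    if "smooth_on V Z'" for Z' :: "'m \<times> 'f \<Rightarrow> 'm \<times> 'f"
    using has_derivative_G[OF c has_derivative_ident has_derivative_fst[OF smooth_deriv[OF that V(3)]] u(1)] .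
  let ?h = "\<lambda>Z' u. (fst (Z' u), - G c u (fst (Z' u)))"
  let ?v = "\<lambda>Z' u. (0::'m, snd (Z' u) + G c u (fst (Z' u)))"
  have sh: "smooth_on V (?h Z')" "smooth_on V (?v Z')" if "smooth_on V Z'" for Z' :: "'m \<times> 'f \<Rightarrow> 'm \<times> 'f"
    by (intro smooth_on_Pair V smooth_on_fst smooth_on_snd smooth_on_minus smooth_on_add smooth_on_const sG that)+
  have dh: "FD (?h Z') u v = (fst (FD Z' u v), - (DG c u (fst (Z' u)) v + G c u (fst (FD Z' u v))))"
    if "smooth_on V Z'" for Z' :: "'m \<times> 'f \<Rightarrow> 'm \<times> 'f" and v
    using FD_eqI[OF has_derivative_Pair[OF has_derivative_fst[OF smooth_deriv[OF that V(3)]] has_derivative_minus[OF dG[OF that]]]]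
    by simp
  have dv: "fst (FD (?v Z') u v) = 0" if "smooth_on V Z'" for Z' :: "'m \<times> 'f \<Rightarrow> 'm \<times> 'f" and v
    using FD_eqI[OF has_derivative_Pair[OF has_derivative_const[of "0::'m"] has_derivative_add[OF has_derivative_snd[OF smooth_deriv[OF that V(3)]] dG[OF that]]]]
    by simp
  have L1: "lie_bracket E (hor E P \<circ> X) (hor E P \<circ> Y) (cinv c u)
      = tvec E c u (FD (?h Y') u (?h X' u) - FD (?h X') u (?h Y' u))"
    by (rule lie_bracket_tvec[OF E cm V sh(1)[OF X'(1)] sh(1)[OF Y'(1)]]) (simp_all only: side(1) X'(2) Y'(2))
  have L2: "lie_bracket E (P \<circ> X) (P \<circ> Y) (cinv c u)
      = tvec E c u (FD (?v Y') u (?v X' u) - FD (?v X') u (?v Y' u))"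
    by (rule lie_bracket_tvec[OF E cm V sh(2)[OF X'(1)] sh(2)[OF Y'(1)]]) (simp_all only: side(2) X'(2) Y'(2))
  have split: "tvec E c u \<zeta> = tvec E c u (fst \<zeta>, snd \<zeta>)" for \<zeta> by simp
  note lG = linear_G[OF c u(1)]
  have 1: "P (lie_bracket E (hor E P \<circ> X) (hor E P \<circ> Y) (cinv c u)) =
      tvec E c u (0, DG c u a (b, - G c u b) - DG c u b (a, - G c u a))"
    unfolding L1 by (subst split, subst P_tvec[OF c u(1)])
      (simp add: dh[OF X'(1)] dh[OF Y'(1)] Xu Yu linear_diff[OF lG])
  \<comment> \<open>A bracket of vertical fields has base component \<open>0\<close>, so its
    horizontal part is the zero vector: the vertical distribution is integrable.\<close>
  have 2: "hor E P (lie_bracket E (P \<circ> X) (P \<circ> Y) (cinv c u)) = tvec E c u (0, 0)"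
    unfolding L2 by (subst split, subst hor_tvec[OF c u(1)])
      (simp add: dv[OF X'(1)] dv[OF Y'(1)] linear_0[OF lG])
  show ?thesis
    unfolding curvature_field_def 1 2 tscale_tvec[OF E cm u(1)] tdiff_tvec[OF E cm u(1)] by simp
qed

text \<open>All extensions of the two vectors give the same value by the preceding formula, and
  extensions by constant coordinates exist.\<close>

lemma curvature_tvec:
  assumes c: "c \<in> AC" and u: "u \<in> cimg c"
  shows "curvature E P (cinv c u) (tvec E c u (a, \<alpha>)) (tvec E c u (b, \<beta>))
    = tvec E c u (0, DG c u b (a, - G c u a) - DG c u a (b, - G c u b))"
  unfolding curvature_def
proof (rule the_equality)
  let ?R = "tvec E c u (0, DG c u b (a, - G c u a) - DG c u a (b, - G c u b))"
  let ?B = "\<lambda>w. \<forall>W X Y. cinv c u \<in> W \<and> vector_field_on E W X \<and> vector_field_on E W Y \<and>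
      X (cinv c u) = tvec E c u (a, \<alpha>) \<and> Y (cinv c u) = tvec E c u (b, \<beta>) \<longrightarrow>
      w = curvature_field E P X Y (cinv c u)"
  note cm = adapted_max[OF c]
  show "?B ?R"
    using curvature_field_tvec[OF c u] by metis
  fix w assume w: "?B w"
  let ?X = "\<lambda>q. tvec E c (snd c q) (a, \<alpha>)" and ?Y = "\<lambda>q. tvec E c (snd c q) (b, \<beta>)"
  have 1: "?X (cinv c u) = tvec E c u (a, \<alpha>)" "?Y (cinv c u) = tvec E c u (b, \<beta>)" unfolding chart_cinv[OF u] by simp_all
  have "w = curvature_field E P ?X ?Y (cinv c u)"
    using w[THEN spec, of "fst c", THEN spec, of ?X, THEN spec, of ?Y]
      constant_vector_field[OF E cm] cinv_in[OF u] chart_cinv[OF u] by simp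
  also have "\<dots> = ?R"
    by (rule curvature_field_tvec[OF c u cinv_in[OF u] constant_vector_field[OF E cm] constant_vector_field[OF E cm] 1])
  finally show "w = ?R" .
qed

end

section \<open>Covariant derivatives in adapted charts\<close>

text \<open>Coordinates on the product of the line with \<open>M\<close>, for a chart
  \<open>d\<close> of the maximal atlas. Joint smoothness of a family, as
  \<open>section_family\<close> demands, follows by composing a coordinate formula with this
  map.\<close>

lemma smooth_map_product_chart:
  fixes M :: "('a, 'm::real_inner) atlas"
  assumes M: "smooth_atlas M" and d: "d \<in> maximal_atlas M" and U: "openin (atlas_topology M) U" "U \<subseteq> fst d"
  shows "smooth_map (product_atlas (standard_atlas :: (real, real) atlas) M) standard_atlas (UNIV \<times> U)
    (\<lambda>z. (fst z, snd d (snd z)))"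
  unfolding smooth_map_to_standard[OF product_atlas_charts[OF std_charts atlas_charts[OF M]]]
proof (intro conjI ballI)
  let ?S = "standard_atlas :: (real, real) atlas"
  note pc = product_atlas_charts[OF std_charts atlas_charts[OF M]]
  have U': "U \<subseteq> carrier M" using U(1) openin_atlas[OF atlas_charts[OF M]] by blast
  then show "UNIV \<times> U \<subseteq> carrier (product_atlas ?S M)"
    by (fastforce simp: carrier_def product_atlas_def standard_atlas_def)
  fix k assume k: "k \<in> product_atlas ?S M"
  then obtain b where b: "b \<in> M" "fst k = UNIV \<times> fst b" "snd k = map_prod (\<lambda>x. x) (snd b)"
    unfolding product_atlas_def standard_atlas_def by auto
  note bm = chart_in_max[OF M b(1)]
  have kc: "is_chart k" using pc k unfolding all_charts_def by blast
  have im: "cimg k = UNIV \<times> cimg b" unfolding b(2,3) by force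
  have inv: "cinv k u = (fst u, cinv b (snd u))" if "snd u \<in> cimg b" for u
    by (rule inv_into_f_eq) (use kc that in \<open>auto simp: is_chart_def b(2,3) cinv_in chart_cinv prod_eq_iff\<close>)
  define B where "B = {y \<in> cimg b. cinv b y \<in> U}"
  have B: "open B" unfolding B_def by (rule open_chart_image[OF M bm U(1)])
  have S: "{u \<in> cimg k. cinv k u \<in> UNIV \<times> U} = UNIV \<times> B"
    unfolding im B_def using inv by auto
  have o: "open ((UNIV :: real set) \<times> B)" by (intro open_Times open_UNIV B)
  show "open {u \<in> cimg k. cinv k u \<in> UNIV \<times> U}" unfolding S by (rule o)
  have "smoothly_related b d" by (rule maximal_smoothly_related[OF M bm d])
  then have "smooth_on B (\<lambda>y. snd d (cinv b y))"
    unfolding smoothly_related_iff[OF max_chart[OF bm]] using U(2) by (auto simp: B_def intro: smooth_on_subset)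
  from smooth_on_compose[OF atlas_findim[OF M] o smooth_on_snd[OF o smooth_on_ident] _ this]
  have "smooth_on (UNIV \<times> B) (\<lambda>u :: real \<times> 'm. snd d (cinv b (snd u)))" by auto
  then have "smooth_on (UNIV \<times> B) (\<lambda>u :: real \<times> 'm. (fst u, snd d (cinv b (snd u))))"
    by (intro smooth_on_Pair o smooth_on_fst smooth_on_ident)
  then show "smooth_on {u \<in> cimg k. cinv k u \<in> UNIV \<times> U} (\<lambda>u. (fst (cinv k u), snd d (snd (cinv k u))))"
    unfolding S by (rule smooth_on_cong[OF o]) (auto simp: inv B_def)
qed

context fibration_connection
begin

lemma pushforward_section:
  assumes c: "c \<in> AC" and d: "d \<in> maximal_atlas M" and V: "open V" "V \<subseteq> cimg d" "x \<in> V"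
    and \<eta>: "smooth_on V \<eta>" and W: "smooth_map M E W \<sigma>"
    and \<sigma>: "\<And>x. x \<in> V \<Longrightarrow> cinv d x \<in> W" "\<And>x. x \<in> V \<Longrightarrow> \<sigma> (cinv d x) = cinv c (x, \<eta> x)"
      "\<And>x. x \<in> V \<Longrightarrow> (x, \<eta> x) \<in> cimg c"
  shows "pushforward E \<sigma> (tvec M d x a) = tvec E c (x, \<eta> x) (a, FD \<eta> x a)"
proof -
  have e: "snd c (\<sigma> (cinv d y)) = (y, \<eta> y)" if "y \<in> V" for y
    using \<sigma>(2,3)[OF that] chart_cinv by metis
  have "((\<lambda>y. (y, \<eta> y)) has_derivative (\<lambda>a. (a, FD \<eta> x a))) (at x)"
    by (intro has_derivative_Pair has_derivative_ident smooth_deriv[OF \<eta> V(3)])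
  then have "((\<lambda>y. snd c (\<sigma> (cinv d y))) has_derivative (\<lambda>a. (a, FD \<eta> x a))) (at x)"
    by (rule has_derivative_transform_within_open[OF _ V(1,3)]) (simp add: e)
  moreover have "\<sigma> (cinv d x) \<in> fst c" using \<sigma>(2,3)[OF V(3)] cinv_in by metis
  moreover have "x \<in> cimg d" using V by blast
  ultimately show ?thesis
    using pushforward_tvec[OF M E W d _ \<sigma>(1)[OF V(3)] adapted_max[OF c], of a] e[OF V(3)] by (simp add: FD_eqI)
qed

lemma cov_deriv_section:
  assumes c: "c \<in> AC" and d: "d \<in> maximal_atlas M" and V: "open V" "V \<subseteq> cimg d" "x \<in> V"
    and \<eta>: "smooth_on V \<eta>" and W: "smooth_map M E W \<sigma>"
    and \<sigma>: "\<And>x. x \<in> V \<Longrightarrow> cinv d x \<in> W" "\<And>x. x \<in> V \<Longrightarrow> \<sigma> (cinv d x) = cinv c (x, \<eta> x)"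
      "\<And>x. x \<in> V \<Longrightarrow> (x, \<eta> x) \<in> cimg c"
    and X: "X (cinv d x) = tvec M d x a"
  shows "cov_deriv E P X \<sigma> (cinv d x) = tvec E c (x, \<eta> x) (0, FD \<eta> x a + G c (x, \<eta> x) a)"
proof -
  have "pushforward E \<sigma> (tvec M d x a) = tvec E c (x, \<eta> x) (a, FD \<eta> x a)"
    by (rule pushforward_section[OF c d V \<eta> W \<sigma>])
  then show ?thesis unfolding cov_deriv_def X using P_tvec[OF c \<sigma>(3)[OF V(3)]] by simp
qed

text \<open>A section with values in the vertical bundle is locally the variation of a family of sections:
  move the base points along the fiber coordinates, with the bounded parameter \<open>wave \<delta> \<epsilon>\<close>.\<close>

lemma cov_deriv_vertical:
  assumes ind: "induced_connection M E \<pi> P PV" and X: "vector_field_on M (carrier M) X"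
    and c: "c \<in> AC" and d: "d \<in> maximal_atlas M"
    and cd: "\<And>e. e \<in> fst c \<Longrightarrow> \<pi> e \<in> fst d" "\<And>e. e \<in> fst c \<Longrightarrow> snd d (\<pi> e) = fst (snd c e)"
    and V: "open V" "V \<subseteq> cimg d" "x0 \<in> V"
    and \<eta>: "smooth_on V \<eta>" and w: "smooth_on V w"
    and \<eta>c: "\<And>x. x \<in> V \<Longrightarrow> (x, \<eta> x) \<in> cimg c"
    and g: "\<And>x. x \<in> V \<Longrightarrow> g (cinv d x) = tvec E c (x, \<eta> x) (0, w x)"
    and Xa: "X (cinv d x0) = tvec M d x0 a"
  shows "cov_deriv VA PV X g (cinv d x0) = xi c x0 (\<eta> x0) (w x0) (FD \<eta> x0 a + G c (x0, \<eta> x0) a)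
    (FD w x0 a + DG c (x0, \<eta> x0) a (0, w x0))"
proof -
  note cm = adapted_max[OF c] and dc = max_chart[OF d]
  \<comment> \<open>The affine family \<open>\<eta> + t w\<close> in coordinates, jointly in
    parameter and base point; the preimage of the chart image contains a ball around
    \<open>(0, x0)\<close> on which it stays in the chart.\<close>
  define k where "k = (\<lambda>z :: real \<times> 'm. (snd z, \<eta> (snd z) + fst z *\<^sub>R w (snd z)))"
  have oV: "open ((UNIV :: real set) \<times> V)" by (intro open_Times open_UNIV V)
  have \<eta>2: "smooth_on (UNIV \<times> V) (\<lambda>z :: real \<times> 'm. \<eta> (snd z))"
    by (rule smooth_on_compose[OF fdm oV smooth_on_snd[OF oV smooth_on_ident] _ \<eta>]) auto
  have w2: "smooth_on (UNIV \<times> V) (\<lambda>z :: real \<times> 'm. w (snd z))"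
    by (rule smooth_on_compose[OF fdm oV smooth_on_snd[OF oV smooth_on_ident] _ w]) auto
  have k: "smooth_on (UNIV \<times> V) k"
    unfolding k_def by (intro smooth_on_Pair smooth_on_add smooth_on_scaleR oV \<eta>2 w2 smooth_on_fst smooth_on_snd smooth_on_ident)
  have "open ((UNIV \<times> V) \<inter> k -` cimg c)"
    by (rule continuous_open_preimage[OF smooth_on_continuous[OF k] oV chart_open[OF max_chart[OF cm]]])
  moreover have "(0, x0) \<in> (UNIV \<times> V) \<inter> k -` cimg c" using V(3) \<eta>c[OF V(3)] by (simp add: k_def)
  ultimately obtain r where r: "r > 0" "ball (0, x0) r \<subseteq> (UNIV \<times> V) \<inter> k -` cimg c" using openE by blast
  \<comment> \<open>One third leaves room for two bounds by \<open>\<delta>\<close>: the size of the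
    wave and the distance from \<open>x0\<close>.\<close>
  define \<delta> where "\<delta> = r / 3"
  have \<delta>: "\<delta> > 0" using r by (simp add: \<delta>_def)
  define V' where "V' = ball x0 \<delta>"
  have V'o: "open V'" "x0 \<in> V'" using \<delta> by (auto simp: V'_def)
  have V'in: "x \<in> V" "(x, \<eta> x + wave \<delta> \<epsilon> *\<^sub>R w x) \<in> cimg c" if "x \<in> V'" for x \<epsilon>
  proof -
    have "dist (0, x0) (wave \<delta> \<epsilon>, x) \<le> \<bar>wave \<delta> \<epsilon>\<bar> + dist x0 x"
      using norm_Pair_le[of "- wave \<delta> \<epsilon>" "x0 - x"] by (simp add: dist_norm)
    also have "\<dots> < \<delta> + \<delta>" using wave_bound[OF \<delta>, of \<epsilon>] that by (intro add_le_less_mono) (auto simp: V'_def)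
    also have "\<dots> \<le> r" using r by (simp add: \<delta>_def)
    finally have "(wave \<delta> \<epsilon>, x) \<in> ball (0, x0) r" by simp
    then have "(wave \<delta> \<epsilon>, x) \<in> (UNIV \<times> V) \<inter> k -` cimg c" using r(2) by blast
    then show "x \<in> V" "(x, \<eta> x + wave \<delta> \<epsilon> *\<^sub>R w x) \<in> cimg c" by (simp_all add: k_def)
  qed
  then have V'd: "V' \<subseteq> cimg d" using V(2) by blast
  define U' where "U' = {q \<in> fst d. snd d q \<in> V'}"
  have U'o: "openin (atlas_topology M) U'" unfolding U'_def by (rule openin_chart_preimage[OF M d V'o(1)])
  have U'd: "U' \<subseteq> fst d" by (auto simp: U'_def)
  have U'in: "cinv d x \<in> U'" if "x \<in> V'" for x
  proof -
    have "x \<in> cimg d" using that V'd by blast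
    then show ?thesis using that cinv_in[of x d] chart_cinv[of x d] by (simp add: U'_def)
  qed
  define fam where "fam \<epsilon> q = cinv c (snd d q, \<eta> (snd d q) + wave \<delta> \<epsilon> *\<^sub>R w (snd d q))" for \<epsilon> q
  have fam_cinv: "fam \<epsilon> (cinv d x) = cinv c (x, \<eta> x + wave \<delta> \<epsilon> *\<^sub>R w x)" if "x \<in> V'" for \<epsilon> x
    unfolding fam_def using chart_cinv[of x d] that V'd by (simp add: subset_iff)
  have \<eta>': "smooth_on V' \<eta>" and w': "smooth_on V' w" using smooth_on_subset[OF \<eta>] smooth_on_subset[OF w] V'in(1) by auto
  have fam_smooth: "smooth_map M E U' (fam \<epsilon>)" for \<epsilon>
  proof -
    have "smooth_on V' (\<lambda>x. (x, \<eta> x + wave \<delta> \<epsilon> *\<^sub>R w x))"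
      by (intro smooth_on_Pair smooth_on_add smooth_on_scaleR smooth_on_const smooth_on_ident \<eta>' w' V'o)
    then have 1: "smooth_map standard_atlas standard_atlas V' (\<lambda>x. (x, \<eta> x + wave \<delta> \<epsilon> *\<^sub>R w x))"
      unfolding smooth_map_standard using V'o by blast
    have 2: "smooth_map standard_atlas E V' (\<lambda>x. cinv c (x, \<eta> x + wave \<delta> \<epsilon> *\<^sub>R w x))"
      by (rule smooth_map_comp[OF std_charts std_charts fde 1 smooth_map_cinv[OF cm]])
        (use V'in(2) in auto)
    show ?thesis
      unfolding fam_def
      by (rule smooth_map_comp[OF atlas_charts[OF M] std_charts fdm
            smooth_map_restrict[OF M smooth_map_chart[OF atlas_charts[OF M] d] U'o U'd] 2]) (auto simp: U'_def)
  qed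
  have family: "section_family M E \<pi> U' fam"
    unfolding section_family_def
  proof (intro conjI allI ballI)
    show "openin (atlas_topology M) U'" by (rule U'o)
    have o: "open ((UNIV :: real set) \<times> V')" by (intro open_Times open_UNIV V'o)
    have s: "smooth_on (UNIV \<times> V') (\<lambda>z :: real \<times> 'm. \<eta> (snd z))" "smooth_on (UNIV \<times> V') (\<lambda>z :: real \<times> 'm. w (snd z))"
      by (rule smooth_on_subset[OF \<eta>2], use V'in(1) in auto, rule smooth_on_subset[OF w2], use V'in(1) in auto)
    have "smooth_on (UNIV \<times> V') (\<lambda>z :: real \<times> 'm. (snd z, \<eta> (snd z) + wave \<delta> (fst z) *\<^sub>R w (snd z)))"
      by (intro smooth_on_Pair smooth_on_add smooth_on_scaleR smooth_on_wave smooth_on_fst smooth_on_snd smooth_on_ident o s)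
    then have 1: "smooth_map standard_atlas standard_atlas (UNIV \<times> V')
        (\<lambda>z :: real \<times> 'm. (snd z, \<eta> (snd z) + wave \<delta> (fst z) *\<^sub>R w (snd z)))"
      unfolding smooth_map_standard using o by blast
    have 2: "smooth_map standard_atlas E (UNIV \<times> V')
        (\<lambda>z :: real \<times> 'm. cinv c (snd z, \<eta> (snd z) + wave \<delta> (fst z) *\<^sub>R w (snd z)))"
      by (rule smooth_map_comp[OF std_charts std_charts fde 1 smooth_map_cinv[OF cm]])
        (use V'in(2) in auto)
    have "smooth_map (product_atlas standard_atlas M) E (UNIV \<times> U')
        (\<lambda>z. cinv c (snd (fst z, snd d (snd z)), \<eta> (snd (fst z, snd d (snd z))) +
          wave \<delta> (fst (fst z, snd d (snd z))) *\<^sub>R w (snd (fst z, snd d (snd z)))))"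
      by (rule smooth_map_comp[OF product_atlas_charts[OF std_charts atlas_charts[OF M]]
            std_charts findim_prod[OF findim_real fdm] smooth_map_product_chart[OF M d U'o U'd] 2])
        (auto simp: U'_def)
    then show "smooth_map (product_atlas standard_atlas M) E (UNIV \<times> U') (\<lambda>(\<epsilon>, p). fam \<epsilon> p)"
      by (simp add: fam_def case_prod_beta')
    fix \<epsilon> p assume p: "p \<in> U'"
    let ?u = "(snd d p, \<eta> (snd d p) + wave \<delta> \<epsilon> *\<^sub>R w (snd d p))"
    have u: "?u \<in> cimg c" using V'in(2) p by (simp add: U'_def)
    have "snd d (\<pi> (cinv c ?u)) = snd d p" using cd(2)[OF cinv_in[OF u]] unfolding chart_cinv[OF u] by simp
    moreover have "\<pi> (cinv c ?u) \<in> fst d" using cd(1)[OF cinv_in[OF u]] .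
    ultimately show "\<pi> (fam \<epsilon> p) = p"
      unfolding fam_def using cinv_chart[OF dc, of p] cinv_chart[OF dc, of "\<pi> (cinv c ?u)"] p by (simp add: U'_def)
  qed
  have wd: "((\<lambda>\<epsilon>. wave \<delta> \<epsilon> *\<^sub>R y) has_vector_derivative y) (at 0)" for y :: 'f
    using has_derivative_scaleR_left[OF wave_derivative_0[OF \<delta>]] unfolding has_vector_derivative_def .
  have wy: "((\<lambda>\<epsilon>. z + wave \<delta> \<epsilon> *\<^sub>R y) has_vector_derivative y) (at 0)" for y z :: 'f
    using has_vector_derivative_add[OF has_vector_derivative_const wd, of z y] by simp
  have sy: "smooth_on UNIV (\<lambda>\<epsilon>. z + wave \<delta> \<epsilon> *\<^sub>R y)" for y z :: 'f
    by (intro smooth_on_add smooth_on_scaleR smooth_on_wave smooth_on_const smooth_on_ident open_UNIV)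
  have var: "variation E fam (cinv d x) = g (cinv d x)" if x: "x \<in> V'" for x
  proof -
    have "velocity E (\<lambda>\<epsilon>. fam \<epsilon> (cinv d x)) = tvec E c (x, \<eta> x + wave \<delta> 0 *\<^sub>R w x) (0, w x)"
    proof (rule velocity_eqI[OF E cm open_UNIV UNIV_I, where w = "\<lambda>\<epsilon>. (x, \<eta> x + wave \<delta> \<epsilon> *\<^sub>R w x)"])
      show "smooth_on UNIV (\<lambda>\<epsilon>. (x, \<eta> x + wave \<delta> \<epsilon> *\<^sub>R w x))" by (intro smooth_on_Pair open_UNIV smooth_on_const sy)
      show "range (\<lambda>\<epsilon>. (x, \<eta> x + wave \<delta> \<epsilon> *\<^sub>R w x)) \<subseteq> cimg c" using V'in(2)[OF x] by auto
      show "fam \<epsilon> (cinv d x) = cinv c (x, \<eta> x + wave \<delta> \<epsilon> *\<^sub>R w x)" for \<epsilon> by (rule fam_cinv[OF x])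
      show "((\<lambda>\<epsilon>. (x, \<eta> x + wave \<delta> \<epsilon> *\<^sub>R w x)) has_vector_derivative (0, w x)) (at 0)"
        by (intro has_vector_derivative_Pair has_vector_derivative_const wy)
    qed
    then show ?thesis unfolding variation_def g[OF V'in(1)[OF x]] by simp
  qed
  have x0d: "x0 \<in> cimg d" using V by blast
  \<comment> \<open>The variation agrees with \<open>g\<close> only over \<open>V'\<close>. The
    pushforward uses the germ of a representing curve through the point, so the covariant
    derivatives there are equal.\<close>
  have germ: "cov_deriv VA PV X g (cinv d x0) = cov_deriv VA PV X (variation E fam) (cinv d x0)"
  proof -
    let ?\<rho> = "rep (X (cinv d x0))"
    have \<rho>: "smooth_curve M ?\<rho>" "?\<rho> 0 = cinv d x0"
      unfolding Xa using smooth_curve_rep_tvec[OF M d x0d] rep_tvec_0[OF M d x0d] by auto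
    obtain N where N: "open N" "0 \<in> N" "\<And>t. t \<in> N \<Longrightarrow> ?\<rho> t \<in> fst d" "smooth_on N (\<lambda>t. snd d (?\<rho> t))"
      using smooth_curve_chart[OF M \<rho>(1) d] \<rho>(2) cinv_in[OF x0d] by metis
    have "open (N \<inter> (\<lambda>t. snd d (?\<rho> t)) -` V')"
      by (rule continuous_open_preimage[OF smooth_on_continuous[OF N(4)] N(1) V'o(1)])
    moreover have "0 \<in> N \<inter> (\<lambda>t. snd d (?\<rho> t)) -` V'" using N(2) \<rho>(2) chart_cinv[OF x0d] V'o by simp
    moreover have "(g \<circ> ?\<rho>) t = (variation E fam \<circ> ?\<rho>) t" if "t \<in> N \<inter> (\<lambda>t. snd d (?\<rho> t)) -` V'" for t
      using that var[of "snd d (?\<rho> t)"] cinv_chart[OF dc N(3)] by simp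
    ultimately have "eventually (\<lambda>t. (g \<circ> ?\<rho>) t = (variation E fam \<circ> ?\<rho>) t) (nhds 0)"
      unfolding eventually_nhds by blast
    then have "velocity VA (g \<circ> ?\<rho>) = velocity VA (variation E fam \<circ> ?\<rho>)" by (rule velocity_cong)
    then show ?thesis unfolding cov_deriv_def pushforward_def by simp
  qed
  let ?p = "\<lambda>\<epsilon>. (x0, \<eta> x0 + wave \<delta> \<epsilon> *\<^sub>R w x0)"
  \<comment> \<open>\<open>\<eta>\<close> and \<open>w\<close> are differentiated separately along
    \<open>a\<close>, while the parameter also enters \<open>G\<close> through its foot point
    \<open>?p \<epsilon>\<close>. As the wave has slope \<open>1\<close> at \<open>0\<close>, the
    parameter derivative there is \<open>FD w x0 a\<close> plus a \<open>DG\<close> term.\<close>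
  let ?z = "\<lambda>\<epsilon>. FD \<eta> x0 a + wave \<delta> \<epsilon> *\<^sub>R FD w x0 a + G c (?p \<epsilon>) a"
  have pin: "?p \<epsilon> \<in> cimg c" for \<epsilon> using V'in(2)[OF V'o(2)] .
  have cf: "cov_deriv E P X (fam \<epsilon>) (cinv d x0) = tvec E c (?p \<epsilon>) (0, ?z \<epsilon>)" for \<epsilon>
  proof -
    have "smooth_on V' (\<lambda>x. \<eta> x + wave \<delta> \<epsilon> *\<^sub>R w x)"
      by (intro smooth_on_add smooth_on_scaleR smooth_on_const \<eta>' w' V'o)
    from cov_deriv_section[where X = X, OF c d V'o(1) V'd V'o(2) this fam_smooth U'in fam_cinv V'in(2) Xa]
    have "cov_deriv E P X (fam \<epsilon>) (cinv d x0) =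
      tvec E c (?p \<epsilon>) (0, FD (\<lambda>x. \<eta> x + wave \<delta> \<epsilon> *\<^sub>R w x) x0 a + G c (?p \<epsilon>) a)" .
    moreover have "((\<lambda>x. \<eta> x + wave \<delta> \<epsilon> *\<^sub>R w x) has_derivative (\<lambda>v. FD \<eta> x0 v + wave \<delta> \<epsilon> *\<^sub>R FD w x0 v)) (at x0)"
      by (intro has_derivative_add has_derivative_scaleR_right smooth_deriv[OF \<eta> V(3)] smooth_deriv[OF w V(3)])
    ultimately show ?thesis by (simp add: FD_eqI)
  qed
  let ?m = "FD w x0 a + DG c (x0, \<eta> x0) a (0, w x0)"
  have "velocity VA (\<lambda>\<epsilon>. cov_deriv E P X (fam \<epsilon>) (cinv d x0)) =
     tvec VA (vchart c) (x0, (\<eta> x0 + wave \<delta> 0 *\<^sub>R w x0, ?z 0)) (0, (w x0, ?m))"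
  proof (rule velocity_eqI[OF atlas_vertical vchart_max[OF c] open_UNIV UNIV_I,
        where w = "\<lambda>\<epsilon>. (x0, (\<eta> x0 + wave \<delta> \<epsilon> *\<^sub>R w x0, ?z \<epsilon>))"])
    have sp: "smooth_on UNIV ?p" by (intro smooth_on_Pair open_UNIV smooth_on_const sy)
    have "smooth_on UNIV (\<lambda>\<epsilon>. G c (?p \<epsilon>) a)"
      by (rule smooth_on_G[OF c open_UNIV sp _ smooth_on_const]) (use pin in auto)
    then show "smooth_on UNIV (\<lambda>\<epsilon>. (x0, (\<eta> x0 + wave \<delta> \<epsilon> *\<^sub>R w x0, ?z \<epsilon>)))"
      by (intro smooth_on_Pair open_UNIV smooth_on_const sy smooth_on_add)
    show "range (\<lambda>\<epsilon>. (x0, (\<eta> x0 + wave \<delta> \<epsilon> *\<^sub>R w x0, ?z \<epsilon>))) \<subseteq> cimg (vchart c)"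
      unfolding vchart_image[OF c] using pin by auto
    show "cov_deriv E P X (fam \<epsilon>) (cinv d x0) = cinv (vchart c) (x0, (\<eta> x0 + wave \<delta> \<epsilon> *\<^sub>R w x0, ?z \<epsilon>))" for \<epsilon>
      unfolding cf using vchart_cinv[OF c, of "(x0, (\<eta> x0 + wave \<delta> \<epsilon> *\<^sub>R w x0, ?z \<epsilon>))"] pin[of \<epsilon>] by simp
    have dp: "(?p has_derivative (\<lambda>t. (0, t *\<^sub>R w x0))) (at 0)"
      using has_derivative_Pair[OF has_derivative_const wy[unfolded has_vector_derivative_def]] .
    have ld: "linear (DG c (?p 0) a)" by (rule linear_DG[OF c pin])
    have "((\<lambda>\<epsilon>. G c (?p \<epsilon>) a) has_derivative (\<lambda>t. DG c (?p 0) a (0, t *\<^sub>R w x0) + G c (?p 0) 0)) (at 0)"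
      using has_derivative_G[OF c dp has_derivative_const pin] .
    moreover have "DG c (?p 0) a (0, t *\<^sub>R w x0) = t *\<^sub>R DG c (?p 0) a (0, w x0)" for t
      using linear_cmul[OF ld, of t "(0, w x0)"] by simp
    ultimately have "((\<lambda>\<epsilon>. G c (?p \<epsilon>) a) has_vector_derivative DG c (?p 0) a (0, w x0)) (at 0)"
      unfolding has_vector_derivative_def using linear_0[OF linear_G[OF c pin[of 0]]] by simp
    from has_vector_derivative_add[OF wy this, of "FD \<eta> x0 a" "FD w x0 a"]
    have "(?z has_vector_derivative ?m) (at 0)" by simp
    then show "((\<lambda>\<epsilon>. (x0, (\<eta> x0 + wave \<delta> \<epsilon> *\<^sub>R w x0, ?z \<epsilon>))) has_vector_derivative (0, (w x0, ?m))) (at 0)"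
      by (intro has_vector_derivative_Pair has_vector_derivative_const wy)
  qed
  \<comment> \<open>Here the covariant derivative is the foot point and \<open>w x0\<close> the
    velocity; the involution in the defining property restores the order of the claim.\<close>
  then have "variation VA (\<lambda>\<epsilon>. cov_deriv E P X (fam \<epsilon>)) (cinv d x0) =
      xi c x0 (\<eta> x0) (FD \<eta> x0 a + G c (x0, \<eta> x0) a) (w x0) ?m"
    unfolding variation_def xi_def by simp
  moreover have "cov_deriv VA PV X (variation E fam) (cinv d x0) =
      involution M E \<pi> (variation VA (\<lambda>\<epsilon>. cov_deriv E P X (fam \<epsilon>)) (cinv d x0))"
    using ind[unfolded induced_connection_def, THEN conjunct2, THEN spec, THEN spec, THEN spec, THEN mp, OF conjI, OF X family]
      U'in[OF V'o(2)] by blast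
  ultimately show ?thesis unfolding germ using involution_xi[OF c \<eta>c[OF V(3)]] by simp
qed

text \<open>Everything is read off at \<open>x0\<close> in one adapted chart around
  \<open>f p\<close> and the base chart below it, where both claims become identities between
  coordinates.\<close>

lemma curvature_formula:
  assumes ind: "induced_connection M E \<pi> P PV" and f: "local_section M E \<pi> U f"
    and X: "vector_field_on M (carrier M) X" and Y: "vector_field_on M (carrier M) Y" and p: "p \<in> U"
  defines "\<Theta> \<equiv> involution M E \<pi>" and "D \<equiv> cov_deriv E P" and "DV \<equiv> cov_deriv VA PV"
  shows "double_projection M E \<pi> (DV X (D Y f) p) = double_projection M E \<pi> (\<Theta> (DV Y (D X f) p))"
    and "curvature_along E P X Y f p =
             tdiff E (affine_diff M E \<pi> (DV X (D Y f) p) (\<Theta> (DV Y (D X f) p))) (D (lie_bracket M X Y) f p)"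
proof -
  have fs: "smooth_map M E U f" and sec: "\<And>q. q \<in> U \<Longrightarrow> \<pi> (f q) = q"
    using f unfolding local_section_def by auto
  obtain c where c: "c \<in> AC" and fp: "f p \<in> fst c" using adapted_exists[OF smooth_map_in[OF fs p]] by blast
  note cm = adapted_max[OF c] and cc = max_chart[OF adapted_max[OF c]]
  obtain d where d: "d \<in> maximal_atlas M" and cd: "\<And>e. e \<in> fst c \<Longrightarrow> \<pi> e \<in> fst d"
    "\<And>e. e \<in> fst c \<Longrightarrow> snd d (\<pi> e) = fst (snd c e)"
    using adapted_base_chart[OF c] by metis
  note dc = max_chart[OF d]
  \<comment> \<open>The base points over which the section stays inside \<open>c\<close>; there it
    is the graph of \<open>\<eta>\<close>.\<close>
  define V where "V = {x \<in> cimg d. cinv d x \<in> U \<and> f (cinv d x) \<in> fst c}"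
  define \<eta> where "\<eta> x = snd (snd c (f (cinv d x)))" for x
  define x0 where "x0 = snd d p"
  have pd: "p \<in> fst d" using cd(1)[OF fp] sec[OF p] by simp
  have px: "cinv d x0 = p" unfolding x0_def by (rule cinv_chart[OF dc pd])
  have V: "open V" "V \<subseteq> cimg d" "x0 \<in> V"
    unfolding V_def using local_rep(1)[OF M E fs d cm] p fp pd px by (auto simp: x0_def)
  have \<eta>: "smooth_on V \<eta>"
    using smooth_on_snd[OF V(1) local_rep(2)[OF M E fs d cm, folded V_def]] unfolding \<eta>_def[abs_def] .
  have VU: "cinv d x \<in> U" if "x \<in> V" for x using that by (simp add: V_def)
  have fc: "snd c (f (cinv d x)) = (x, \<eta> x)" if "x \<in> V" for x
  proof -
    have "fst (snd c (f (cinv d x))) = x"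
      using that cd(2)[of "f (cinv d x)"] sec[OF VU[OF that]] chart_cinv[of x d] by (simp add: V_def)
    then show ?thesis by (simp add: \<eta>_def prod_eq_iff)
  qed
  have f\<eta>: "f (cinv d x) = cinv c (x, \<eta> x)" and \<eta>c: "(x, \<eta> x) \<in> cimg c" if "x \<in> V" for x
  proof -
    have i: "f (cinv d x) \<in> fst c" using that by (simp add: V_def)
    show "f (cinv d x) = cinv c (x, \<eta> x)" using cinv_chart[OF cc i] fc[OF that] by simp
    show "(x, \<eta> x) \<in> cimg c" using imageI[OF i, of "snd c"] fc[OF that] by simp
  qed
  let ?z = "(x0, \<eta> x0)"
  note zc = \<eta>c[OF V(3)]
  have field: "smooth_on V (\<lambda>x. deriv_along (Z (cinv d x)) (snd d))"
    "x \<in> V \<Longrightarrow> Z (cinv d x) = tvec M d x (deriv_along (Z (cinv d x)) (snd d))"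
    if Z: "vector_field_on M (carrier M) Z" for Z x
  proof -
    have "V \<subseteq> {x \<in> cimg d. cinv d x \<in> carrier M}"
      using smooth_map_sub[OF fs] by (auto simp: V_def)
    then show "smooth_on V (\<lambda>x. deriv_along (Z (cinv d x)) (snd d))"
      "x \<in> V \<Longrightarrow> Z (cinv d x) = tvec M d x (deriv_along (Z (cinv d x)) (snd d))"
      using smooth_on_subset[OF vector_field_coords(2)[OF M Z d]] vector_field_coords(3)[OF M Z d] by blast+
  qed
  define X' where "X' x = deriv_along (X (cinv d x)) (snd d)" for x
  define Y' where "Y' x = deriv_along (Y (cinv d x)) (snd d)" for x
  have X': "smooth_on V X'" "\<And>x. x \<in> V \<Longrightarrow> X (cinv d x) = tvec M d x (X' x)"
    using field[OF X] unfolding X'_def[abs_def] by auto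
  have Y': "smooth_on V Y'" "\<And>x. x \<in> V \<Longrightarrow> Y (cinv d x) = tvec M d x (Y' x)"
    using field[OF Y] unfolding Y'_def[abs_def] by auto
  define w where "w Z x = FD \<eta> x (Z x) + G c (x, \<eta> x) (Z x)" for Z x
  have sg: "smooth_on V (\<lambda>x. (x, \<eta> x))" by (intro smooth_on_Pair V smooth_on_ident \<eta>)
  have ws: "smooth_on V (w Z)" if "smooth_on V Z" for Z
    unfolding w_def
    by (intro smooth_on_add V smooth_on_FD[OF fdm V(1) \<eta> smooth_on_ident _ that] smooth_on_G[OF c V(1) sg _ that])
      (use \<eta>c in auto)
  have Dw: "D Z f (cinv d x) = tvec E c (x, \<eta> x) (0, w Z' x)"
    if "x \<in> V" "Z (cinv d x) = tvec M d x (Z' x)" for Z Z' x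
    unfolding D_def w_def using cov_deriv_section[where X = Z, OF c d V(1,2) that(1) \<eta> fs VU f\<eta> \<eta>c that(2)] .
  let ?m = "\<lambda>A B. FD (w B) x0 (A x0) + DG c ?z (A x0) (0, w B x0)"
  \<comment> \<open>\<open>D B f\<close> is itself a section of the vertical bundle, with fiber
    coordinates \<open>\<eta>\<close> and \<open>w B'\<close>, so the formula for vertical sections
    applies to it.\<close>
  have DVw: "DV A (D B f) p = xi c x0 (\<eta> x0) (w B' x0) (w A' x0) (?m A' B')"
    if "vector_field_on M (carrier M) A" "\<And>x. x \<in> V \<Longrightarrow> A (cinv d x) = tvec M d x (A' x)"
      "smooth_on V B'" "\<And>x. x \<in> V \<Longrightarrow> B (cinv d x) = tvec M d x (B' x)" for A B A' B'
    unfolding DV_def px[symmetric] w_def[of A']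
    by (rule cov_deriv_vertical[OF ind that(1) c d cd V \<eta> ws[OF that(3)] \<eta>c Dw[where Z = B and Z' = B', OF _ that(4)] that(2)[OF V(3)]])
  have XY: "DV X (D Y f) p = xi c x0 (\<eta> x0) (w Y' x0) (w X' x0) (?m X' Y')"
    by (rule DVw[OF X X'(2) Y'])
  have YX: "DV Y (D X f) p = xi c x0 (\<eta> x0) (w X' x0) (w Y' x0) (?m Y' X')"
    by (rule DVw[OF Y Y'(2) X'])
  have TYX: "\<Theta> (DV Y (D X f) p) = xi c x0 (\<eta> x0) (w Y' x0) (w X' x0) (?m Y' X')"
    unfolding YX \<Theta>_def by (rule involution_xi[OF c zc])
  show "double_projection M E \<pi> (DV X (D Y f) p) = double_projection M E \<pi> (\<Theta> (DV Y (D X f) p))"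
    unfolding XY TYX double_projection_xi[OF c zc] ..
  have ad: "affine_diff M E \<pi> (DV X (D Y f) p) (\<Theta> (DV Y (D X f) p)) = tvec E c ?z (0, ?m X' Y' - ?m Y' X')"
    unfolding XY TYX by (rule affine_diff_xi[OF c zc])
  let ?Z = "FD Y' x0 (X' x0) - FD X' x0 (Y' x0)"
  have lb: "lie_bracket M X Y (cinv d x0) = tvec M d x0 ?Z"
    by (rule lie_bracket_tvec[OF M d V X'(1) Y'(1) X'(2) Y'(2)])
  have DZ: "D (lie_bracket M X Y) f p = tvec E c ?z (0, FD \<eta> x0 ?Z + G c ?z ?Z)"
    unfolding D_def px[symmetric] by (rule cov_deriv_section[where X = "lie_bracket M X Y", OF c d V \<eta> fs VU f\<eta> \<eta>c lb])
  have pf: "pushforward E f (Z p) = tvec E c ?z (Z' x0, FD \<eta> x0 (Z' x0))"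
    if "Z (cinv d x0) = tvec M d x0 (Z' x0)" for Z Z'
    using pushforward_section[OF c d V \<eta> fs VU f\<eta> \<eta>c] that unfolding px by simp
  have "f p = cinv c ?z" using f\<eta>[OF V(3)] unfolding px .
  then have curv: "curvature_along E P X Y f p =
      tvec E c ?z (0, DG c ?z (Y' x0) (X' x0, - G c ?z (X' x0)) - DG c ?z (X' x0) (Y' x0, - G c ?z (Y' x0)))"
    unfolding curvature_along_def pf[of X X', OF X'(2)[OF V(3)]] pf[of Y Y', OF Y'(2)[OF V(3)]]
    using curvature_tvec[OF c zc] by simp
  have dw: "FD (w Z) x0 v = FD (\<lambda>z. FD \<eta> z (Z x0)) x0 v + FD \<eta> x0 (FD Z x0 v) +
      (DG c ?z (Z x0) (v, FD \<eta> x0 v) + G c ?z (FD Z x0 v))" if "smooth_on V Z" for Z v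
  proof -
    note dZ = smooth_deriv[OF that V(3)]
    have "((\<lambda>x. FD \<eta> x (Z x)) has_derivative (\<lambda>v. FD (\<lambda>z. FD \<eta> z (Z x0)) x0 v + FD \<eta> x0 (FD Z x0 v))) (at x0)"
      using has_derivative_FD[OF fdm \<eta> V(1,3) has_derivative_ident dZ] .
    moreover have "((\<lambda>x. G c (x, \<eta> x) (Z x)) has_derivative
        (\<lambda>v. DG c ?z (Z x0) (v, FD \<eta> x0 v) + G c ?z (FD Z x0 v))) (at x0)"
      using has_derivative_G[OF c has_derivative_Pair[OF has_derivative_ident smooth_deriv[OF \<eta> V(3)]] dZ zc] .
    ultimately have "(w Z has_derivative (\<lambda>v. (FD (\<lambda>z. FD \<eta> z (Z x0)) x0 v + FD \<eta> x0 (FD Z x0 v)) +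
      (DG c ?z (Z x0) (v, FD \<eta> x0 v) + G c ?z (FD Z x0 v)))) (at x0)"
      unfolding w_def[abs_def] by (rule has_derivative_add)
    then show ?thesis by (simp add: FD_eqI)
  qed
  \<comment> \<open>With \<open>r = FD \<eta> x0 a\<close> and \<open>q = G c ?z a\<close>, the
    vector \<open>r + q\<close> is the fiber component of the covariant derivative along
    \<open>a\<close>. A \<open>DG\<close> term from differentiating one covariant derivative and the
    \<open>DG\<close> term of the other mixed coordinate thus combine to a derivative along the
    horizontal lift \<open>(a, - q)\<close>.\<close>
  have dg: "DG c ?z b (a, - q) = DG c ?z b (a, r) - DG c ?z b (0, r + q)" for a b q r
    using linear_diff[OF linear_DG[OF c zc], of b "(a, r)" "(0, r + q)"] by simp
  have sym: "FD (\<lambda>z. FD \<eta> z (Y' x0)) x0 (X' x0) = FD (\<lambda>z. FD \<eta> z (X' x0)) x0 (Y' x0)"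
    by (rule FD_symmetric[OF V(1) \<eta> V(3)])
  \<comment> \<open>Linearity gathers the terms with derivatives of \<open>X'\<close> and
    \<open>Y'\<close> into the covariant derivative along the bracket.\<close>
  note l\<eta> = linear_diff[OF linear_FD[OF \<eta> V(3)]] and lG = linear_diff[OF linear_G[OF c zc]]
  have "DG c ?z (Y' x0) (X' x0, - G c ?z (X' x0)) - DG c ?z (X' x0) (Y' x0, - G c ?z (Y' x0)) =
      (?m X' Y' - ?m Y' X') - (FD \<eta> x0 ?Z + G c ?z ?Z)"
    unfolding dw[OF X'(1)] dw[OF Y'(1)] l\<eta> lG sym
      dg[of "Y' x0" "X' x0" "G c ?z (X' x0)" "FD \<eta> x0 (X' x0)"] dg[of "X' x0" "Y' x0" "G c ?z (Y' x0)" "FD \<eta> x0 (Y' x0)"]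
      w_def[of X' x0] w_def[of Y' x0]
    by (simp add: algebra_simps)
  then show "curvature_along E P X Y f p =
             tdiff E (affine_diff M E \<pi> (DV X (D Y f) p) (\<Theta> (DV Y (D X f) p))) (D (lie_bracket M X Y) f p)"
    unfolding curv ad DZ tdiff_tvec[OF E cm zc] by simp
qed

end

theorem mainTheorem1:
  fixes M :: "('a, 'm::real_inner) atlas"
    and F :: "('c, 'f::real_inner) atlas"
    and E :: "('b, 'm \<times> 'f) atlas"
    and \<pi> :: "'b \<Rightarrow> 'a"
    and P :: "'b tangent \<Rightarrow> 'b tangent"
    and PV :: "'b tangent tangent \<Rightarrow> 'b tangent tangent"
    and X Y :: "'a \<Rightarrow> 'a tangent"
    and U :: "'a set"
    and f :: "'a \<Rightarrow> 'b"
  assumes "fiber_bundle M F E \<pi>"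
    and "nonlinear_connection M E \<pi> P"
    and "induced_connection M E \<pi> P PV"
    and "local_section M E \<pi> U f"
    and "vector_field_on M (carrier M) X"
    and "vector_field_on M (carrier M) Y"
  shows "let D = cov_deriv E P;
             DV = cov_deriv (vertical_atlas M E \<pi>) PV;
             \<Theta> = involution M E \<pi>
         in \<forall>p\<in>U.
           double_projection M E \<pi> (DV X (D Y f) p) = double_projection M E \<pi> (\<Theta> (DV Y (D X f) p)) \<and>
           curvature_along E P X Y f p =
             tdiff E
               (affine_diff M E \<pi> (DV X (D Y f) p) (\<Theta> (DV Y (D X f) p)))
               (D (lie_bracket M X Y) f p)"
proof -
  have "smooth_atlas M" "smooth_atlas F" "smooth_atlas E" "smooth_map E M (carrier E) \<pi>"
    using assms(1) manifold_imp_atlas unfolding fiber_bundle_def by blast+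
  \<comment> \<open>The cover by adapted charts is the locale assumption that rests on the local
    trivialisations.\<close>
  then interpret fibration_connection M E \<pi> P
    by unfold_locales (use adapted_chart_exists[OF assms(1)] assms(2) atlas_findim in blast)+
  show ?thesis
    unfolding Let_def using curvature_formula[OF assms(3-6)] by blast
qed

end
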